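(* Let $M$ be a surface and let $f:M\to\mathbb{R}^3$ be a nondegenerate affine immersion with induced Blaschke structure $(\nabla,h,S)$. Assume that the Blaschke connection $\nabla$ is projectively flat and that the affine Gauss curvature $\tau=\det S$ is constant. If $S$ is $\mathbb{C}$-diagonalizable, then $(M,f)$ is affinely equivalent to a locally symmetric affine surface or to an affine sphere.
   Context: Let $M$ be a smooth 2-dimensional manifold, $f:M\to\mathbb{R}^3$ an immersion, $D$ the standard flat connection on $\mathbb{R}^3$. For a transversal vector field $\xi$ along $f$ write $D_Xf_*Y=f_*(\nabla_XY)+h(X,Y)\xi$. The field $\xi$ is equiaffine if $D_X\xi=-f_*(SX)$ for an endomorphism field $S$; then $(\nabla,h,S)$ is the induced equiaffine structure, $h$ is the affine metric and $S$ the shape operator. The immersion is nondegenerate if $h$ is nondegenerate (definite or indefinite). Let $\hat\nabla$ be the Levi-Civita connection of $h$ and $K(X,Y)=\nabla_XY-\hat\nabla_XY$ the difference tensor. The Blaschke structure is the equiaffine structure induced by the affine normal $\xi$; it is characterized by apolarity $\mathrm{tr}_hK=\sum h^{ij}K(e_i,e_j)=0$ together with the normalization $|\det(f_*X_1,f_*X_2,\xi)|=|\det(h(X_i,X_j))|^{1/2}$. Projective flatness: a torsion-free equiaffine connection $\nabla$ on an $n$-manifold, with curvature tensor $R$ and $\gamma(X,Y)=\frac1{n-1}\mathrm{tr}\{Z\mapsto R(Z,X)Y\}$, is projectively flat iff $R(X,Y)Z=\gamma(Y,Z)X-\gamma(X,Z)Y$ and $(\nabla_X\gamma)(Y,Z)=(\nabla_Y\gamma)(X,Z)$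 for all $X,Y,Z$ (here $n=2$). An endomorphism field $S$ is $\mathbb{C}$-diagonalizable if its complexification is diagonalizable at each point. A locally symmetric affine surface is an affine surface whose Blaschke connection satisfies $\nabla R=0$. An affine sphere is an affine surface whose Blaschke shape operator is $S=H\,\mathrm{Id}$ with $H\in\mathbb{R}$ constant. Two surfaces $(M,f)$ and $(N,g)$ are affinely equivalent if there are a diffeomorphism $\phi:M\to N$ and an affine transformation $A$ of $\mathbb{R}^3$ with $g\circ\phi=A\circ f$.
   Formalization: The surface M is assumed connected; without this the claim fails, e.g. for the disjoint union of a component of xyz=1 and a non-spherical Euclidean surface of constant positive Gauss curvature, scaled so that det S agrees. *)

theory Defs
  imports "HOL-Analysis.Analysis"
begin

section \<open>Smooth maps between Euclidean spaces\<close>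

text \<open>The following two predicates are meant for open sets \<open>U\<close> of a finite-dimensional domain; there,
  being \<open>k + 1\<close> times continuously differentiable amounts to being differentiable with all
  directional derivatives \<open>k\<close> times continuously differentiable.\<close>

primrec Ck_on :: "nat \<Rightarrow> 'a::real_normed_vector set \<Rightarrow> ('a \<Rightarrow> 'b::real_normed_vector) \<Rightarrow> bool" where
  "Ck_on 0 U = (\<lambda>f. continuous_on U f)"
| "Ck_on (Suc k) U =
     (\<lambda>f. f differentiable_on U \<and> (\<forall>v. Ck_on k U (\<lambda>x. frechet_derivative f (at x) v)))"

definition smooth_on :: "'a::real_normed_vector set \<Rightarrow> ('a \<Rightarrow> 'b::real_normed_vector) \<Rightarrow> bool" where
  "smooth_on U f \<longleftrightarrow> (\<forall>k. Ck_on k U f)"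


section \<open>Surfaces and immersions\<close>

type_synonym 'a chart = "'a set \<times> ('a \<Rightarrow> real^2)"

definition coord_dom :: "'a chart \<Rightarrow> (real^2) set" where
  "coord_dom c = snd c ` fst c"

definition coord_rep :: "'a chart \<Rightarrow> ('a \<Rightarrow> 'b) \<Rightarrow> real^2 \<Rightarrow> 'b" where
  "coord_rep c f = f \<circ> inv_into (fst c) (snd c)"

definition is_chart :: "'a topology \<Rightarrow> 'a chart \<Rightarrow> bool" where
  "is_chart M c \<longleftrightarrow> openin M (fst c) \<and> open (coord_dom c) \<and>
     homeomorphic_map (subtopology M (fst c)) (top_of_set (coord_dom c)) (snd c)"

definition smooth_2_manifold :: "'a topology \<Rightarrow> 'a chart set \<Rightarrow> bool" where
  "smooth_2_manifold M A \<longleftrightarrow>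
     Hausdorff_space M \<and> second_countable M \<and>
     (\<forall>c\<in>A. is_chart M c) \<and> (\<Union>c\<in>A. fst c) = topspace M \<and>
     (\<forall>c\<in>A. \<forall>d\<in>A. smooth_on (snd c ` (fst c \<inter> fst d)) (coord_rep c (snd d)))"

text \<open>Surfaces are connected, as usual. This matters for alternatives such as ``locally symmetric or
  an affine sphere'': a disjoint union of a proper affine sphere that is not a quadric and of a
  locally symmetric surface that is not an affine sphere is neither, even if \<open>det S\<close> agrees.\<close>

definition surface :: "'a topology \<Rightarrow> 'a chart set \<Rightarrow> bool" where
  "surface M A \<longleftrightarrow> smooth_2_manifold M A \<and> connected_space M"

definition smooth_map ::
  "'a topology \<Rightarrow> 'a chart set \<Rightarrow> 'b topology \<Rightarrow> 'b chart set \<Rightarrow> ('a \<Rightarrow> 'b) \<Rightarrow> bool" where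
  "smooth_map M A N B \<phi> \<longleftrightarrow> continuous_map M N \<phi> \<and>
     (\<forall>c\<in>A. \<forall>d\<in>B. smooth_on (snd c ` {p \<in> fst c. \<phi> p \<in> fst d}) (coord_rep c (snd d \<circ> \<phi>)))"

definition diffeomorphism ::
  "'a topology \<Rightarrow> 'a chart set \<Rightarrow> 'b topology \<Rightarrow> 'b chart set \<Rightarrow> ('a \<Rightarrow> 'b) \<Rightarrow> bool" where
  "diffeomorphism M A N B \<phi> \<longleftrightarrow> smooth_map M A N B \<phi> \<and>
     (\<exists>\<psi>. smooth_map N B M A \<psi> \<and>
        (\<forall>p\<in>topspace M. \<psi> (\<phi> p) = p) \<and> (\<forall>q\<in>topspace N. \<phi> (\<psi> q) = q))"

definition smooth_fun :: "'a chart set \<Rightarrow> ('a \<Rightarrow> 'b::real_normed_vector) \<Rightarrow> bool" where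
  "smooth_fun A f \<longleftrightarrow> (\<forall>c\<in>A. smooth_on (coord_dom c) (coord_rep c f))"

definition push :: "'a chart \<Rightarrow> ('a \<Rightarrow> 'b::real_normed_vector) \<Rightarrow> real^2 \<Rightarrow> real^2 \<Rightarrow> 'b" where
  "push c f x = frechet_derivative (coord_rep c f) (at x)"

definition immersion :: "'a chart set \<Rightarrow> ('a \<Rightarrow> real^3) \<Rightarrow> bool" where
  "immersion A f \<longleftrightarrow> smooth_fun A f \<and> (\<forall>c\<in>A. \<forall>x\<in>coord_dom c. inj (push c f x))"


section \<open>Connections on open subsets of the plane\<close>

text \<open>A vector field on the domain of a chart is written in the coordinates of that chart, i.e. as
  a map on an open set \<open>U\<close> of the plane; connections act on such fields. Values
  outside \<open>U\<close> are irrelevant.\<close>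

type_synonym vfield = "real^2 \<Rightarrow> real^2"
type_synonym connection = "vfield \<Rightarrow> vfield \<Rightarrow> vfield"
type_synonym metric = "real^2 \<Rightarrow> real^2 \<Rightarrow> real^2 \<Rightarrow> real"
type_synonym endo_field = "real^2 \<Rightarrow> real^2 \<Rightarrow> real^2"

definition vfields :: "(real^2) set \<Rightarrow> vfield set" where
  "vfields U = {X. smooth_on U X}"

definition dir_deriv :: "vfield \<Rightarrow> (real^2 \<Rightarrow> 'b::real_normed_vector) \<Rightarrow> real^2 \<Rightarrow> 'b" where
  "dir_deriv X V x = frechet_derivative V (at x) (X x)"

definition bracket :: "vfield \<Rightarrow> vfield \<Rightarrow> vfield" where
  "bracket X Y x = dir_deriv X Y x - dir_deriv Y X x"

definition affine_connection :: "(real^2) set \<Rightarrow> connection \<Rightarrow> bool" where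
  "affine_connection U nabla \<longleftrightarrow>
     (\<forall>X\<in>vfields U. \<forall>Y\<in>vfields U. nabla X Y \<in> vfields U) \<and>
     (\<forall>X\<in>vfields U. \<forall>X'\<in>vfields U. \<forall>Y\<in>vfields U. \<forall>Y'\<in>vfields U. \<forall>x\<in>U.
        nabla (\<lambda>y. X y + X' y) Y x = nabla X Y x + nabla X' Y x \<and>
        nabla X (\<lambda>y. Y y + Y' y) x = nabla X Y x + nabla X Y' x) \<and>
     (\<forall>a. smooth_on U a \<longrightarrow> (\<forall>X\<in>vfields U. \<forall>Y\<in>vfields U. \<forall>x\<in>U.
        nabla (\<lambda>y. a y *\<^sub>R X y) Y x = a x *\<^sub>R nabla X Y x \<and>
        nabla X (\<lambda>y. a y *\<^sub>R Y y) x = a x *\<^sub>R nabla X Y x + dir_deriv X a x *\<^sub>R Y x))"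

definition levi_civita :: "(real^2) set \<Rightarrow> metric \<Rightarrow> connection \<Rightarrow> bool" where
  "levi_civita U h nabla \<longleftrightarrow> affine_connection U nabla \<and>
     (\<forall>X\<in>vfields U. \<forall>Y\<in>vfields U. \<forall>x\<in>U. nabla X Y x - nabla Y X x = bracket X Y x) \<and>
     (\<forall>X\<in>vfields U. \<forall>Y\<in>vfields U. \<forall>Z\<in>vfields U. \<forall>x\<in>U.
        dir_deriv X (\<lambda>y. h y (Y y) (Z y)) x = h x (nabla X Y x) (Z x) + h x (Y x) (nabla X Z x))"

definition curvature :: "connection \<Rightarrow> vfield \<Rightarrow> vfield \<Rightarrow> vfield \<Rightarrow> vfield" where
  "curvature nabla X Y Z x =
     nabla X (nabla Y Z) x - nabla Y (nabla X Z) x - nabla (bracket X Y) Z x"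

text \<open>The tensor \<open>\<gamma>\<close>; the factor \<open>1 / (n - 1)\<close> is \<open>1\<close> since \<open>n = 2\<close>. As the curvature is
  tensorial, a vector \<open>z\<close> may be extended to the constant field with value \<open>z\<close>.\<close>

definition gamma :: "connection \<Rightarrow> vfield \<Rightarrow> vfield \<Rightarrow> real^2 \<Rightarrow> real" where
  "gamma nabla X Y x = trace (matrix (\<lambda>z. curvature nabla (\<lambda>_. z) X Y x))"

definition cov_gamma :: "connection \<Rightarrow> vfield \<Rightarrow> vfield \<Rightarrow> vfield \<Rightarrow> real^2 \<Rightarrow> real" where
  "cov_gamma nabla X Y Z x =
     dir_deriv X (gamma nabla Y Z) x - gamma nabla (nabla X Y) Z x - gamma nabla Y (nabla X Z) x"

definition projectively_flat :: "(real^2) set \<Rightarrow> connection \<Rightarrow> bool" where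
  "projectively_flat U nabla \<longleftrightarrow>
     (\<forall>X\<in>vfields U. \<forall>Y\<in>vfields U. \<forall>Z\<in>vfields U. \<forall>x\<in>U.
        curvature nabla X Y Z x = gamma nabla Y Z x *\<^sub>R X x - gamma nabla X Z x *\<^sub>R Y x \<and>
        cov_gamma nabla X Y Z x = cov_gamma nabla Y X Z x)"

definition cov_curvature ::
  "connection \<Rightarrow> vfield \<Rightarrow> vfield \<Rightarrow> vfield \<Rightarrow> vfield \<Rightarrow> vfield" where
  "cov_curvature nabla W X Y Z x =
     nabla W (curvature nabla X Y Z) x - curvature nabla (nabla W X) Y Z x
     - curvature nabla X (nabla W Y) Z x - curvature nabla X Y (nabla W Z) x"

definition parallel_curvature :: "(real^2) set \<Rightarrow> connection \<Rightarrow> bool" where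
  "parallel_curvature U nabla \<longleftrightarrow>
     (\<forall>W\<in>vfields U. \<forall>X\<in>vfields U. \<forall>Y\<in>vfields U. \<forall>Z\<in>vfields U. \<forall>x\<in>U.
        cov_curvature nabla W X Y Z x = 0)"

definition C_diagonalizable :: "(real^2 \<Rightarrow> real^2) \<Rightarrow> bool" where
  "C_diagonalizable T \<longleftrightarrow>
     (\<exists>P D :: complex^2^2. invertible P \<and> (\<forall>i j. i \<noteq> j \<longrightarrow> D $ i $ j = 0) \<and>
        (\<chi> i j. complex_of_real (matrix T $ i $ j)) = P ** D ** matrix_inv P)"


section \<open>Equiaffine structures and the Blaschke structure\<close>

text \<open>The fields \<open>\<nabla>\<close>, \<open>h\<close>, \<open>S\<close> on a surface are given by their expressions in the charts \<open>c\<close> of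
  the atlas. The expressions in different charts are those of one object on the surface, because
  \<open>f\<close> and \<open>\<xi>\<close> determine each of them through the formulas of Gauss and Weingarten.\<close>

definition equiaffine_structure ::
  "'a chart set \<Rightarrow> ('a \<Rightarrow> real^3) \<Rightarrow> ('a \<Rightarrow> real^3) \<Rightarrow>
   ('a chart \<Rightarrow> connection) \<Rightarrow> ('a chart \<Rightarrow> metric) \<Rightarrow> ('a chart \<Rightarrow> endo_field) \<Rightarrow> bool" where
  "equiaffine_structure A f \<xi> nabla h S \<longleftrightarrow>
     smooth_fun A \<xi> \<and>
     (\<forall>c\<in>A. \<forall>x\<in>coord_dom c.
        coord_rep c \<xi> x \<notin> range (push c f x) \<and>
        bilinear (h c x) \<and> linear (S c x) \<and>
        (\<forall>X\<in>vfields (coord_dom c). \<forall>Y\<in>vfields (coord_dom c).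
           dir_deriv X (\<lambda>y. push c f y (Y y)) x =
             push c f x (nabla c X Y x) + h c x (X x) (Y x) *\<^sub>R coord_rep c \<xi> x) \<and>
        (\<forall>v. push c \<xi> x v = - push c f x (S c x v)))"

definition nondegenerate :: "'a chart set \<Rightarrow> ('a chart \<Rightarrow> metric) \<Rightarrow> bool" where
  "nondegenerate A h \<longleftrightarrow> (\<forall>c\<in>A. \<forall>x\<in>coord_dom c. \<forall>v. v \<noteq> 0 \<longrightarrow> (\<exists>w. h c x v w \<noteq> 0))"

definition gram :: "(real^2 \<Rightarrow> real^2 \<Rightarrow> real) \<Rightarrow> real^2 \<Rightarrow> real^2 \<Rightarrow> real^2^2" where
  "gram b v w = vector [vector [b v v, b v w], vector [b w v, b w w]]"

text \<open>Apolarity is expressed in the coordinate frame \<open>e\<^sub>i = axis i 1\<close>.\<close>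

definition apolar :: "(real^2) set \<Rightarrow> connection \<Rightarrow> metric \<Rightarrow> bool" where
  "apolar U nabla h \<longleftrightarrow> (\<exists>nabla_hat. levi_civita U h nabla_hat \<and>
     (\<forall>x\<in>U. (\<Sum>i\<in>UNIV. \<Sum>j\<in>UNIV.
        matrix_inv (gram (h x) (axis 1 1) (axis 2 1)) $ i $ j *\<^sub>R
          (nabla (\<lambda>_. axis i 1) (\<lambda>_. axis j 1) x
           - nabla_hat (\<lambda>_. axis i 1) (\<lambda>_. axis j 1) x)) = 0))"

definition blaschke_structure ::
  "'a chart set \<Rightarrow> ('a \<Rightarrow> real^3) \<Rightarrow> ('a \<Rightarrow> real^3) \<Rightarrow>
   ('a chart \<Rightarrow> connection) \<Rightarrow> ('a chart \<Rightarrow> metric) \<Rightarrow> ('a chart \<Rightarrow> endo_field) \<Rightarrow> bool" where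
  "blaschke_structure A f \<xi> nabla h S \<longleftrightarrow>
     equiaffine_structure A f \<xi> nabla h S \<and>
     (\<forall>c\<in>A. apolar (coord_dom c) (nabla c) (h c)) \<and>
     (\<forall>c\<in>A. \<forall>x\<in>coord_dom c. \<forall>v w.
        \<bar>det (vector [push c f x v, push c f x w, coord_rep c \<xi> x] :: real^3^3)\<bar> =
          sqrt \<bar>det (gram (h c x) v w)\<bar>)"

definition locally_symmetric_affine_surface ::
  "'a topology \<Rightarrow> 'a chart set \<Rightarrow> ('a \<Rightarrow> real^3) \<Rightarrow> bool" where
  "locally_symmetric_affine_surface M A f \<longleftrightarrow> surface M A \<and> immersion A f \<and>
     (\<exists>\<xi> nabla h S. nondegenerate A h \<and> blaschke_structure A f \<xi> nabla h S \<and>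
        (\<forall>c\<in>A. parallel_curvature (coord_dom c) (nabla c)))"

definition affine_sphere :: "'a topology \<Rightarrow> 'a chart set \<Rightarrow> ('a \<Rightarrow> real^3) \<Rightarrow> bool" where
  "affine_sphere M A f \<longleftrightarrow> surface M A \<and> immersion A f \<and>
     (\<exists>\<xi> nabla h S. nondegenerate A h \<and> blaschke_structure A f \<xi> nabla h S \<and>
        (\<exists>H::real. \<forall>c\<in>A. \<forall>x\<in>coord_dom c. \<forall>v. S c x v = H *\<^sub>R v))"

definition affine_transformation :: "(real^3 \<Rightarrow> real^3) \<Rightarrow> bool" where
  "affine_transformation T \<longleftrightarrow> (\<exists>L b. linear L \<and> bij L \<and> T = (\<lambda>x. L x + b))"

definition affinely_equivalent ::
  "'a topology \<Rightarrow> 'a chart set \<Rightarrow> ('a \<Rightarrow> real^3) \<Rightarrow>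
   'b topology \<Rightarrow> 'b chart set \<Rightarrow> ('b \<Rightarrow> real^3) \<Rightarrow> bool" where
  "affinely_equivalent M A f N B g \<longleftrightarrow>
     (\<exists>\<phi> T. diffeomorphism M A N B \<phi> \<and> affine_transformation T \<and>
        (\<forall>p\<in>topspace M. g (\<phi> p) = T (f p)))"

end

theory Submission
  imports Defs
begin

text \<open>Write \<open>C = \<nabla>h\<close> and \<open>G = \<nabla>\<gamma>\<close>. The Gauss equation gives
  \<open>\<gamma>(Y, Z) = tr S h(Y, Z) - h(SY, Z)\<close>, the Codazzi equation makes \<open>C\<close> a symmetric cubic form, and
  projective flatness is the same symmetry for \<open>G\<close>. Three traces vanish: the \<open>h\<close>-trace of \<open>C\<close> by
  apolarity (\<open>tr_C\<close>), the \<open>h\<close>-trace of \<open>G\<close> by the Codazzi equation of \<open>S\<close> (\<open>tr_G\<close>), and the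
  trace of \<open>G\<close> against the adjugate of \<open>\<gamma>\<close>, because \<open>det \<gamma> = det S det h\<close>, the volume of \<open>h\<close> is
  parallel and \<open>det S\<close> is constant (\<open>tr_gm_G\<close>). A binary cubic form annihilated by two binary
  quadratic forms with nonzero resultant is zero, and here the resultant is
  \<open>(det h)\<^sup>2 ((tr S)\<^sup>2 - 4 det S)\<close>. So \<open>\<nabla>\<gamma> = 0\<close>, and with it \<open>\<nabla>R = 0\<close>, wherever \<open>S\<close> has two
  distinct eigenvalues; where they coincide, diagonalizability over the complex numbers makes
  \<open>S\<close> a multiple of the identity.

  What remains is to see that the two kinds of points do not mix: if \<open>S\<close> is scalar on a nonempty
  open set, it is scalar everywhere (\<open>disc_unique_continuation\<close>). In isothermal coordinates of a
  definite \<open>h\<close>, the trace condition on \<open>G\<close> says that the trace-free part of \<open>\<gamma>\<close> is a holomorphic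
  quadratic differential; for an indefinite \<open>h\<close> it says that each null component of \<open>\<gamma>\<close>, suitably
  scaled, is constant along the other family of null lines. No such coordinates are
  constructed. For null fields \<open>d, d'\<close> of the form \<open>w + z v\<close>, the two trace conditions give
  the first-order equation \<open>d'(\<gamma>(d, d)) = 2\<alpha> \<gamma>(d, d)\<close> with a real function \<open>\<alpha>\<close>
  (\<open>null_direction_equations\<close>). Vanishing of a solution then spreads across the boundary of a ball
  in its zero set, by maximizing the squared modulus against a steep weight. At the
  maximum the first derivative along \<open>d'\<close> is contradictory if \<open>d'\<close> is real and transversal to the
  sphere (\<open>continuation_along_transversal_field\<close>); if \<open>d'\<close> is complex, the second derivatives are
  (\<open>continuation_along_complex_field\<close>), as in the three circles theorem.

  Hence on a connected surface either \<open>S = H Id\<close> throughout, with \<open>H\<^sup>2 = det S\<close> and therefore \<open>H\<close>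
  constant, or the points where \<open>S\<close> has distinct eigenvalues are dense and \<open>\<nabla>R = 0\<close> follows everywhere
  by continuity. The given surface is itself an affine sphere or locally symmetric.\<close>


section \<open>Calculus of smooth maps\<close>

text \<open>The direction comes first, so that iterated derivatives read \<open>pd u (pd v f)\<close>.\<close>

definition pd :: "'a \<Rightarrow> ('a::real_normed_vector \<Rightarrow> 'b::real_normed_vector) \<Rightarrow> 'a \<Rightarrow> 'b" where
  "pd v f x = frechet_derivative f (at x) v"

lemma pd_eqI: "(f has_derivative f') (at x) \<Longrightarrow> pd v f x = f' v"
  unfolding pd_def by (metis frechet_derivative_at)

lemma has_derivative_pd: "f differentiable (at x) \<Longrightarrow> (f has_derivative (\<lambda>v. pd v f x)) (at x)"
  unfolding pd_def by (simp add: frechet_derivative_works)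

lemma linear_pd: "f differentiable (at x) \<Longrightarrow> linear (\<lambda>v. pd v f x)"
  using has_derivative_pd has_derivative_linear by blast

lemma pd_add_dir: "f differentiable (at x) \<Longrightarrow> pd (u + v) f x = pd u f x + pd v f x"
  using linear_add[OF linear_pd] .

lemma pd_scaleR_dir: "f differentiable (at x) \<Longrightarrow> pd (c *\<^sub>R v) f x = c *\<^sub>R pd v f x"
  using linear_cmul[OF linear_pd] .

lemma pd_zero_dir: "f differentiable (at x) \<Longrightarrow> pd 0 f x = 0"
  using linear_0[OF linear_pd] .

lemma pd_transform:
  assumes "open U" "x \<in> U" "f differentiable (at x)" "\<And>y. y \<in> U \<Longrightarrow> f y = g y"
  shows "pd v g x = pd v f x" "g differentiable (at x)"
proof -
  have "(g has_derivative (\<lambda>v. pd v f x)) (at x)"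
    using has_derivative_transform_within_open[OF has_derivative_pd[OF assms(3)] assms(1,2)] assms(4)
    by blast
  then show "pd v g x = pd v f x" "g differentiable (at x)"
    using pd_eqI by (auto simp: differentiable_def)
qed

lemma pd_const [simp]: "pd v (\<lambda>_. c) x = 0"
  by (rule pd_eqI[where f' = "\<lambda>_. 0", simplified]) simp

lemma pd_add:
  "f differentiable (at x) \<Longrightarrow> g differentiable (at x) \<Longrightarrow>
    pd v (\<lambda>y. f y + g y) x = pd v f x + pd v g x"
  by (rule pd_eqI[where f' = "\<lambda>v. pd v f x + pd v g x"]) (intro has_derivative_add has_derivative_pd)

lemma pd_diff:
  "f differentiable (at x) \<Longrightarrow> g differentiable (at x) \<Longrightarrow>
    pd v (\<lambda>y. f y - g y) x = pd v f x - pd v g x"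
  by (rule pd_eqI[where f' = "\<lambda>v. pd v f x - pd v g x"]) (intro has_derivative_diff has_derivative_pd)

lemma pd_minus: "f differentiable (at x) \<Longrightarrow> pd v (\<lambda>y. - f y) x = - pd v f x"
  by (rule pd_eqI[where f' = "\<lambda>v. - pd v f x"]) (intro has_derivative_minus has_derivative_pd)

lemma pd_linear:
  assumes "bounded_linear L" "f differentiable (at x)"
  shows "pd v (\<lambda>y. L (f y)) x = L (pd v f x)"
  by (rule pd_eqI[where f' = "\<lambda>v. L (pd v f x)"])
     (intro bounded_linear.has_derivative[OF assms(1)] has_derivative_pd assms)

lemma pd_bilinear:
  assumes "bounded_bilinear B" "f differentiable (at x)" "g differentiable (at x)"
  shows "pd v (\<lambda>y. B (f y) (g y)) x = B (f x) (pd v g x) + B (pd v f x) (g x)"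
  by (rule pd_eqI[where f' = "\<lambda>v. B (f x) (pd v g x) + B (pd v f x) (g x)"])
     (intro bounded_bilinear.FDERIV[OF assms(1)] has_derivative_pd assms)

lemmas pd_mult = pd_bilinear[OF bounded_bilinear_mult]
lemmas pd_scaleR = pd_bilinear[OF bounded_bilinear_scaleR]

lemma differentiable_linear:
  assumes "bounded_linear L" "f differentiable (at x)"
  shows "(\<lambda>y. L (f y)) differentiable (at x)"
  using bounded_linear.has_derivative[OF assms(1) has_derivative_pd[OF assms(2)]]
  by (auto simp: differentiable_def)

lemma Ck_on_Suc_pd:
  "Ck_on (Suc k) U f \<longleftrightarrow> f differentiable_on U \<and> (\<forall>v. Ck_on k U (pd v f))"
  by (simp add: pd_def[abs_def])

declare Ck_on.simps(2) [simp del]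

lemma Ck_on_mono1: "Ck_on (Suc k) U f \<Longrightarrow> Ck_on k U f"
proof (induction k arbitrary: f)
  case 0
  then show ?case by (simp add: Ck_on_Suc_pd differentiable_imp_continuous_on)
next
  case (Suc k)
  then show ?case unfolding Ck_on_Suc_pd[of "Suc k"] Ck_on_Suc_pd[of k] by blast
qed

lemma Ck_on_differentiable:
  assumes "open U" "Ck_on (Suc k) U f" "x \<in> U"
  shows "f differentiable (at x)"
  using assms by (simp add: Ck_on_Suc_pd differentiable_on_eq_differentiable_at)

lemma Ck_on_cong:
  assumes "open U" "\<And>x. x \<in> U \<Longrightarrow> f x = g x" "Ck_on k U f"
  shows "Ck_on k U g"
  using assms(2,3)
proof (induction k arbitrary: f g)
  case 0
  then show ?case by (metis Ck_on.simps(1) continuous_on_cong)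
next
  case (Suc k)
  have d: "f differentiable (at x)" if "x \<in> U" for x
    using Ck_on_differentiable[OF assms(1) Suc.prems(2) that] .
  have "pd v f x = pd v g x" "g differentiable (at x)" if "x \<in> U" for x v
    using pd_transform[OF assms(1) that d[OF that] Suc.prems(1)] by auto
  then show ?case
    using Suc.IH[of "pd v f" "pd v g" for v] Suc.prems(2) assms(1) unfolding Ck_on_Suc_pd
    by (auto simp: differentiable_on_eq_differentiable_at)
qed

lemma Ck_on_subset: "Ck_on k U f \<Longrightarrow> V \<subseteq> U \<Longrightarrow> Ck_on k V f"
  by (induction k arbitrary: f) (auto simp: Ck_on_Suc_pd intro: continuous_on_subset differentiable_on_subset)

lemma Ck_on_SucI:
  assumes U: "open U" and D: "\<And>x. x \<in> U \<Longrightarrow> (f has_derivative D x) (at x)"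
    and k: "\<And>v. Ck_on k U (\<lambda>x. D x v)"
  shows "Ck_on (Suc k) U f"
proof -
  have "Ck_on k U (pd v f)" for v
    by (rule Ck_on_cong[OF U _ k[of v]]) (simp add: pd_eqI[OF D])
  then show ?thesis
    unfolding Ck_on_Suc_pd using D U
    by (auto simp: differentiable_on_eq_differentiable_at differentiable_def)
qed

lemma Ck_on_SucD:
  assumes "open U" "Ck_on (Suc k) U f"
  shows "x \<in> U \<Longrightarrow> (f has_derivative (\<lambda>v. pd v f x)) (at x)" "Ck_on k U (pd v f)" "Ck_on k U f"
  using has_derivative_pd[OF Ck_on_differentiable[OF assms]] assms Ck_on_mono1 by (auto simp: Ck_on_Suc_pd)

lemma Ck_on_const: "Ck_on k U (\<lambda>_. c)"
proof (induction k arbitrary: c)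
  case (Suc k)
  have "pd v (\<lambda>_. c) = (\<lambda>_. 0)" for v :: 'a by (rule ext) simp
  then show ?case unfolding Ck_on_Suc_pd using Suc by simp
qed simp

lemma Ck_on_id: "Ck_on k U (\<lambda>x. x)"
proof (cases k)
  case (Suc k)
  have "pd v (\<lambda>x. x) = (\<lambda>_. v)" for v :: 'a
    by (rule ext) (rule pd_eqI[where f' = "\<lambda>v. v"], simp)
  then show ?thesis unfolding Suc Ck_on_Suc_pd by (simp add: Ck_on_const differentiable_on_id)
qed simp

lemma Ck_on_linear:
  assumes U: "open U" and L: "bounded_linear L"
  shows "Ck_on k U f \<Longrightarrow> Ck_on k U (\<lambda>x. L (f x))"
proof (induction k arbitrary: f)
  case (Suc k)
  note f = Ck_on_SucD[OF U Suc.prems]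
  show ?case by (rule Ck_on_SucI[OF U bounded_linear.has_derivative[OF L f(1)] Suc.IH[OF f(2)]])
qed (simp add: bounded_linear.continuous_on[OF L])

lemma Ck_on_add:
  assumes U: "open U"
  shows "Ck_on k U f \<Longrightarrow> Ck_on k U g \<Longrightarrow> Ck_on k U (\<lambda>x. f x + g x)"
proof (induction k arbitrary: f g)
  case (Suc k)
  note f = Ck_on_SucD[OF U Suc.prems(1)] and g = Ck_on_SucD[OF U Suc.prems(2)]
  show ?case by (rule Ck_on_SucI[OF U has_derivative_add[OF f(1) g(1)] Suc.IH[OF f(2) g(2)]])
qed (simp add: continuous_on_add)

lemma Ck_on_bilinear:
  assumes U: "open U" and B: "bounded_bilinear B"
  shows "Ck_on k U f \<Longrightarrow> Ck_on k U g \<Longrightarrow> Ck_on k U (\<lambda>x. B (f x) (g x))"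
proof (induction k arbitrary: f g)
  case (Suc k)
  note f = Ck_on_SucD[OF U Suc.prems(1)] and g = Ck_on_SucD[OF U Suc.prems(2)]
  show ?case
    by (rule Ck_on_SucI[OF U bounded_bilinear.FDERIV[OF B f(1) g(1)]
          Ck_on_add[OF U Suc.IH[OF f(3) g(2)] Suc.IH[OF f(2) g(3)]]])
qed (simp add: bounded_bilinear.continuous_on[OF B])

lemmas Ck_on_mult = Ck_on_bilinear[OF _ bounded_bilinear_mult]

lemma Ck_on_inverse:
  fixes f :: "'a::real_normed_vector \<Rightarrow> 'b::real_normed_field"
  assumes U: "open U" and nz: "\<And>x. x \<in> U \<Longrightarrow> f x \<noteq> 0"
  shows "Ck_on k U f \<Longrightarrow> Ck_on k U (\<lambda>x. inverse (f x))"
proof (induction k)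
  case (Suc k)
  note f = Ck_on_SucD[OF U Suc.prems]
  show ?case
    by (rule Ck_on_SucI[OF U has_derivative_compose[OF f(1) has_derivative_inverse'[OF nz]]],
        assumption+, intro Ck_on_linear[OF U bounded_linear_minus[OF bounded_linear_ident]] Ck_on_mult U
        Suc.IH f)
qed (simp add: continuous_on_inverse nz)

text \<open>For \<open>exp\<close> and \<open>sqrt\<close>, \<open>d\<close> is covered by the induction hypothesis.\<close>

lemma Ck_on_real_comp_Suc:
  fixes f :: "'a::real_normed_vector \<Rightarrow> real"
  assumes U: "open U" and f: "Ck_on (Suc k) U f"
    and d: "\<And>x. x \<in> U \<Longrightarrow> (F has_real_derivative d x) (at (f x))" and k: "Ck_on k U d"
  shows "Ck_on (Suc k) U (\<lambda>x. F (f x))"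
proof (rule Ck_on_SucI[OF U])
  note f = Ck_on_SucD[OF U f]
  show "((\<lambda>x. F (f x)) has_derivative (\<lambda>v. d x * pd v f x)) (at x)" if "x \<in> U" for x
    using has_derivative_compose[OF f(1)[OF that], of F "\<lambda>v. d x * v"] d[OF that]
    by (simp add: has_field_derivative_def)
  show "Ck_on k U (\<lambda>x. d x * pd v f x)" for v by (rule Ck_on_mult[OF U k f(2)])
qed

lemma Ck_on_sqrt:
  fixes f :: "'a::real_normed_vector \<Rightarrow> real"
  assumes U: "open U" and pos: "\<And>x. x \<in> U \<Longrightarrow> f x > 0"
  shows "Ck_on k U f \<Longrightarrow> Ck_on k U (\<lambda>x. sqrt (f x))"
proof (induction k)
  case (Suc k)
  have "Ck_on k U (\<lambda>x. inverse (sqrt (f x)) * (1 / 2))"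
    using Suc.IH[OF Ck_on_mono1[OF Suc.prems]] pos
    by (intro Ck_on_mult U Ck_on_inverse Ck_on_const) (auto simp: less_imp_neq[symmetric])
  then show ?case
    by (rule Ck_on_real_comp_Suc[OF U Suc.prems, rotated])
       (use DERIV_real_sqrt[OF pos] in \<open>simp add: field_simps\<close>)
qed (simp add: continuous_on_real_sqrt)

lemma Ck_on_exp:
  fixes f :: "'a::real_normed_vector \<Rightarrow> real"
  assumes U: "open U"
  shows "Ck_on k U f \<Longrightarrow> Ck_on k U (\<lambda>x. exp (f x))"
proof (induction k)
  case (Suc k)
  show ?case by (rule Ck_on_real_comp_Suc[OF U Suc.prems DERIV_exp Suc.IH[OF Ck_on_mono1[OF Suc.prems]]])
qed (simp add: continuous_on_exp)

lemma smooth_on_differentiable: "open U \<Longrightarrow> smooth_on U f \<Longrightarrow> x \<in> U \<Longrightarrow> f differentiable (at x)"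
  unfolding smooth_on_def using Ck_on_differentiable by blast

lemma smooth_on_continuous: "smooth_on U f \<Longrightarrow> continuous_on U f"
  unfolding smooth_on_def using Ck_on.simps(1) by (auto dest: spec[of _ 0])

lemma smooth_on_pd: "smooth_on U f \<Longrightarrow> smooth_on U (pd v f)"
  unfolding smooth_on_def using Ck_on_Suc_pd by blast

lemma smooth_on_cong: "open U \<Longrightarrow> smooth_on U f \<Longrightarrow> (\<And>x. x \<in> U \<Longrightarrow> f x = g x) \<Longrightarrow> smooth_on U g"
  unfolding smooth_on_def by (auto intro: Ck_on_cong)

lemma smooth_on_subset: "smooth_on U f \<Longrightarrow> V \<subseteq> U \<Longrightarrow> smooth_on V f"
  unfolding smooth_on_def using Ck_on_subset by blast

lemma smooth_on_const: "smooth_on U (\<lambda>_. c)"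
  by (simp add: smooth_on_def Ck_on_const)

lemma smooth_on_id: "smooth_on U (\<lambda>x. x)"
  by (simp add: smooth_on_def Ck_on_id)

lemma smooth_on_linear:
  "open U \<Longrightarrow> bounded_linear L \<Longrightarrow> smooth_on U f \<Longrightarrow> smooth_on U (\<lambda>x. L (f x))"
  by (simp add: smooth_on_def Ck_on_linear)

lemma smooth_on_add:
  "open U \<Longrightarrow> smooth_on U f \<Longrightarrow> smooth_on U g \<Longrightarrow> smooth_on U (\<lambda>x. f x + g x)"
  by (simp add: smooth_on_def Ck_on_add)

lemma smooth_on_minus: "open U \<Longrightarrow> smooth_on U f \<Longrightarrow> smooth_on U (\<lambda>x. - f x)"
  by (rule smooth_on_linear[OF _ bounded_linear_minus[OF bounded_linear_ident]])

lemma smooth_on_diff: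
  "open U \<Longrightarrow> smooth_on U f \<Longrightarrow> smooth_on U g \<Longrightarrow> smooth_on U (\<lambda>x. f x - g x)"
  using smooth_on_add[of U f "\<lambda>x. - g x"] smooth_on_minus[of U g] by simp

lemma smooth_on_bilinear:
  "open U \<Longrightarrow> bounded_bilinear B \<Longrightarrow> smooth_on U f \<Longrightarrow> smooth_on U g \<Longrightarrow>
     smooth_on U (\<lambda>x. B (f x) (g x))"
  by (simp add: smooth_on_def Ck_on_bilinear)

lemmas smooth_on_mult = smooth_on_bilinear[OF _ bounded_bilinear_mult]
lemmas smooth_on_scaleR = smooth_on_bilinear[OF _ bounded_bilinear_scaleR]
lemmas smooth_on_inner = smooth_on_bilinear[OF _ bounded_bilinear_inner]

lemma smooth_on_inverse:
  fixes f :: "'a::real_normed_vector \<Rightarrow> 'b::real_normed_field"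
  shows "open U \<Longrightarrow> smooth_on U f \<Longrightarrow> (\<And>x. x \<in> U \<Longrightarrow> f x \<noteq> 0) \<Longrightarrow> smooth_on U (\<lambda>x. inverse (f x))"
  by (simp add: smooth_on_def Ck_on_inverse)

lemma smooth_on_divide:
  fixes f :: "'a::real_normed_vector \<Rightarrow> 'b::real_normed_field"
  shows "open U \<Longrightarrow> smooth_on U f \<Longrightarrow> smooth_on U g \<Longrightarrow> (\<And>x. x \<in> U \<Longrightarrow> g x \<noteq> 0) \<Longrightarrow>
    smooth_on U (\<lambda>x. f x / g x)"
  unfolding divide_inverse by (intro smooth_on_mult smooth_on_inverse)

lemma smooth_on_sqrt:
  fixes f :: "'a::real_normed_vector \<Rightarrow> real"
  shows "open U \<Longrightarrow> smooth_on U f \<Longrightarrow> (\<And>x. x \<in> U \<Longrightarrow> f x > 0) \<Longrightarrow> smooth_on U (\<lambda>x. sqrt (f x))"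
  by (simp add: smooth_on_def Ck_on_sqrt)

lemma smooth_on_exp:
  fixes f :: "'a::real_normed_vector \<Rightarrow> real"
  shows "open U \<Longrightarrow> smooth_on U f \<Longrightarrow> smooth_on U (\<lambda>x. exp (f x))"
  by (simp add: smooth_on_def Ck_on_exp)

lemma smooth_on_of_real:
  "open U \<Longrightarrow> smooth_on U f \<Longrightarrow> smooth_on U (\<lambda>x. complex_of_real (f x))"
  by (rule smooth_on_linear[OF _ bounded_linear_of_real])

lemma smooth_on_cnj: "open U \<Longrightarrow> smooth_on U f \<Longrightarrow> smooth_on U (\<lambda>x. cnj (f x))"
  by (rule smooth_on_linear[OF _ bounded_linear_cnj])

lemma smooth_on_power:
  fixes f :: "'a::real_normed_vector \<Rightarrow> 'b::real_normed_field"
  shows "open U \<Longrightarrow> smooth_on U f \<Longrightarrow> smooth_on U (\<lambda>x. f x ^ n)"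
  by (induction n) (simp_all add: smooth_on_const smooth_on_mult)

lemma smooth_on_vec_nth:
  fixes f :: "'a::real_normed_vector \<Rightarrow> real^'n"
  shows "open U \<Longrightarrow> smooth_on U f \<Longrightarrow> smooth_on U (\<lambda>x. f x $ i)"
  by (rule smooth_on_linear[OF _ bounded_linear_vec_nth])

lemmas smooth_intros = smooth_on_const smooth_on_id smooth_on_add smooth_on_minus smooth_on_diff
  smooth_on_mult smooth_on_scaleR smooth_on_inner smooth_on_inverse smooth_on_divide smooth_on_sqrt
  smooth_on_exp smooth_on_of_real smooth_on_cnj smooth_on_power smooth_on_pd smooth_on_vec_nth

lemma line_has_real_derivative:
  fixes f :: "'a::real_normed_vector \<Rightarrow> real"
  assumes "f differentiable (at (x + t *\<^sub>R u))"
  shows "((\<lambda>s. f (x + s *\<^sub>R u)) has_real_derivative pd u f (x + t *\<^sub>R u)) (at t)"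
proof -
  have "((\<lambda>s. x + s *\<^sub>R u) has_derivative (\<lambda>s. s *\<^sub>R u)) (at t)"
    by (auto intro!: derivative_eq_intros)
  from has_derivative_compose[OF this has_derivative_pd[OF assms]]
  have "((\<lambda>s. f (x + s *\<^sub>R u)) has_derivative (\<lambda>s. pd (s *\<^sub>R u) f (x + t *\<^sub>R u))) (at t)" .
  moreover have "(\<lambda>s. pd (s *\<^sub>R u) f (x + t *\<^sub>R u)) = (*) (pd u f (x + t *\<^sub>R u))"
    by (simp add: pd_scaleR_dir[OF assms] fun_eq_iff)
  ultimately show ?thesis by (simp add: has_field_derivative_def)
qed

text \<open>The second mixed difference over a parallelogram, written as a difference in the direction
  \<open>u\<close> of differences in the direction \<open>v\<close>, yields to the mean value theorem in each direction.\<close>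

lemma mixed_difference_mvt:
  fixes f :: "'a::real_normed_vector \<Rightarrow> real"
  assumes U: "open U" and f: "smooth_on U f" and r: "r > 0"
    and sub: "\<And>s t. 0 \<le> s \<Longrightarrow> s \<le> r \<Longrightarrow> 0 \<le> t \<Longrightarrow> t \<le> r \<Longrightarrow> x + s *\<^sub>R u + t *\<^sub>R v \<in> U"
  shows "\<exists>s t. 0 \<le> s \<and> s \<le> r \<and> 0 \<le> t \<and> t \<le> r \<and>
    f (x + r *\<^sub>R u + r *\<^sub>R v) - f (x + r *\<^sub>R u) - f (x + r *\<^sub>R v) + f x
      = r * r * pd v (pd u f) (x + s *\<^sub>R u + t *\<^sub>R v)"
proof -
  define g where "g s = f (x + r *\<^sub>R v + s *\<^sub>R u) - f (x + s *\<^sub>R u)" for s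
  have in1: "x + s *\<^sub>R u \<in> U" if "0 \<le> s" "s \<le> r" for s using sub[OF that, of 0] r by simp
  have in2: "x + r *\<^sub>R v + s *\<^sub>R u \<in> U" if "0 \<le> s" "s \<le> r" for s
    using sub[OF that, of r] r by (simp add: algebra_simps)
  have g': "(g has_real_derivative pd u f (x + r *\<^sub>R v + s *\<^sub>R u) - pd u f (x + s *\<^sub>R u)) (at s)"
    if "0 \<le> s" "s \<le> r" for s
    unfolding g_def
    by (intro DERIV_diff line_has_real_derivative smooth_on_differentiable[OF U f] in1 in2 that)
  obtain s where s: "0 < s" "s < r"
    "g r - g 0 = (r - 0) * (pd u f (x + r *\<^sub>R v + s *\<^sub>R u) - pd u f (x + s *\<^sub>R u))"
    using MVT2[OF r g'] by auto
  have k': "((\<lambda>t. pd u f (x + s *\<^sub>R u + t *\<^sub>R v)) has_real_derivative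
      pd v (pd u f) (x + s *\<^sub>R u + t *\<^sub>R v)) (at t)" if "0 \<le> t" "t \<le> r" for t
    by (intro line_has_real_derivative smooth_on_differentiable[OF U smooth_on_pd[OF f]] sub)
       (use s that in auto)
  obtain t where t: "0 < t" "t < r"
    "pd u f (x + s *\<^sub>R u + r *\<^sub>R v) - pd u f (x + s *\<^sub>R u + 0 *\<^sub>R v)
       = (r - 0) * pd v (pd u f) (x + s *\<^sub>R u + t *\<^sub>R v)"
    using MVT2[OF r k'] by auto
  have "f (x + r *\<^sub>R u + r *\<^sub>R v) - f (x + r *\<^sub>R u) - f (x + r *\<^sub>R v) + f x = g r - g 0"
    unfolding g_def by (simp add: algebra_simps)
  also have "\<dots> = r * r * pd v (pd u f) (x + s *\<^sub>R u + t *\<^sub>R v)"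
    using s(3) t(3) by (simp add: algebra_simps)
  finally show ?thesis using s t by (intro exI[of _ s] exI[of _ t]) auto
qed

text \<open>The mixed difference does not depend on the order of the two directions, so by
  \<open>mixed_difference_mvt\<close> the two mixed derivatives agree at two points of every small
  parallelogram at \<open>x\<close>; continuity brings both points to \<open>x\<close>.\<close>

lemma pd_commute_real:
  fixes f :: "'a::real_normed_vector \<Rightarrow> real"
  assumes U: "open U" and f: "smooth_on U f" and x: "x \<in> U"
  shows "pd v (pd u f) x = pd u (pd v f) x"
proof (rule ccontr)
  assume ne: "\<not> ?thesis"
  define \<epsilon> where "\<epsilon> = \<bar>pd v (pd u f) x - pd u (pd v f) x\<bar> / 2"
  have \<epsilon>: "\<epsilon> > 0" using ne by (simp add: \<epsilon>_def)
  have close: "\<exists>d>0. \<forall>y. dist y x < d \<longrightarrow> \<bar>pd a (pd b f) y - pd a (pd b f) x\<bar> < \<epsilon>" for a b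
  proof -
    have "isCont (pd a (pd b f)) x"
      using smooth_on_continuous[OF smooth_on_pd[OF smooth_on_pd[OF f]]] U x
      by (auto simp: continuous_on_eq_continuous_at)
    then show ?thesis using \<epsilon> unfolding continuous_at_eps_delta dist_real_def by metis
  qed
  obtain d1 d2 d3 where d: "d1 > 0" "d2 > 0" "d3 > 0" "ball x d3 \<subseteq> U"
    and d1: "\<And>y. dist y x < d1 \<Longrightarrow> \<bar>pd v (pd u f) y - pd v (pd u f) x\<bar> < \<epsilon>"
    and d2: "\<And>y. dist y x < d2 \<Longrightarrow> \<bar>pd u (pd v f) y - pd u (pd v f) x\<bar> < \<epsilon>"
    using close[of v u] close[of u v] openE[OF U x] by metis
  define d where "d = min d1 (min d2 d3)"
  define r where "r = d / (2 * (norm u + norm v + 1))"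
  have r: "r > 0" using d by (simp add: d_def r_def add_nonneg_pos)
  have near: "dist (x + s *\<^sub>R a + t *\<^sub>R b) x < d"
    if "0 \<le> s" "s \<le> r" "0 \<le> t" "t \<le> r" "norm a + norm b = norm u + norm v" for s t a b
  proof -
    have "dist (x + s *\<^sub>R a + t *\<^sub>R b) x \<le> s * norm a + t * norm b"
      using norm_triangle_ineq[of "s *\<^sub>R a" "t *\<^sub>R b"] that by (simp add: dist_norm)
    also have "\<dots> \<le> r * norm a + r * norm b"
      using that by (intro add_mono mult_right_mono) auto
    also have "\<dots> = r * (norm u + norm v)" using that(5) by (metis distrib_left)
    also have "\<dots> < r * (2 * (norm u + norm v + 1))"
      using r by (intro mult_strict_left_mono) (auto simp: add_nonneg_pos add_strict_increasing2)
    also have "\<dots> = d" using add_nonneg_pos[of "norm u + norm v" 1] by (simp add: r_def)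
    finally show ?thesis .
  qed
  have mvt: "\<exists>y. dist y x < d \<and> f (x + r *\<^sub>R a + r *\<^sub>R b) - f (x + r *\<^sub>R a) - f (x + r *\<^sub>R b) + f x
      = r * r * pd b (pd a f) y" if n: "norm a + norm b = norm u + norm v" for a b
  proof -
    have "x + s *\<^sub>R a + t *\<^sub>R b \<in> U" if "0 \<le> s" "s \<le> r" "0 \<le> t" "t \<le> r" for s t
      using near[OF that n] d(4) unfolding d_def by (auto simp: dist_commute subset_iff)
    then show ?thesis using mixed_difference_mvt[OF U f r, of x a b] near[OF _ _ _ _ n] by metis
  qed
  obtain y y' where y: "dist y x < d" "dist y' x < d" and "pd v (pd u f) y = pd u (pd v f) y'"
    using mvt[of u v] mvt[of v u] r by (auto simp: algebra_simps)
  moreover have "dist y x < d1" "dist y' x < d2" using y unfolding d_def by auto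
  ultimately have "\<bar>pd v (pd u f) x - pd u (pd v f) x\<bar> < \<epsilon> + \<epsilon>"
    using d1[of y] d2[of y'] by linarith
  then show False by (simp add: \<epsilon>_def)
qed

lemma pd_commute:
  fixes f :: "'a::real_normed_vector \<Rightarrow> 'b::euclidean_space"
  assumes U: "open U" and f: "smooth_on U f" and x: "x \<in> U"
  shows "pd v (pd u f) x = pd u (pd v f) x"
proof (rule euclidean_eqI)
  fix b :: 'b assume "b \<in> Basis"
  have L: "bounded_linear (\<lambda>y::'b. y \<bullet> b)" by (rule bounded_linear_inner_left)
  have s: "smooth_on U (\<lambda>y. f y \<bullet> b)" using smooth_on_linear[OF U L f] .
  have 1: "pd w (pd w' (\<lambda>y. f y \<bullet> b)) x = pd w (pd w' f) x \<bullet> b" for w w'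
  proof -
    have "pd w (pd w' (\<lambda>y. f y \<bullet> b)) x = pd w (\<lambda>y. pd w' f y \<bullet> b) x"
      by (rule pd_transform[OF U x, of "\<lambda>y. pd w' f y \<bullet> b"])
         (use pd_linear[OF L smooth_on_differentiable[OF U f]] smooth_on_differentiable[OF U _ x]
           smooth_on_linear[OF U L smooth_on_pd[OF f]] in auto)
    also have "\<dots> = pd w (pd w' f) x \<bullet> b"
      using pd_linear[OF L smooth_on_differentiable[OF U smooth_on_pd[OF f] x]] .
    finally show ?thesis .
  qed
  show "pd v (pd u f) x \<bullet> b = pd u (pd v f) x \<bullet> b"
    using pd_commute_real[OF U s x, of v u] by (simp add: 1)
qed


section \<open>Unique continuation\<close>

text \<open>Take a point close to the boundary of \<open>closure V\<close> but outside it and inflate a ball around it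
  until it meets \<open>closure V\<close>.\<close>

lemma touching_ball:
  fixes V :: "'a::euclidean_space set"
  assumes "open Q" "connected Q" "V \<inter> Q \<noteq> {}" "open B" "B \<noteq> {}" "B \<subseteq> Q" "B \<inter> V = {}"
  obtains p r x0 where "r > 0" "x0 \<in> Q" "dist p x0 = r" "ball p r \<inter> V = {}"
    "\<And>e. e > 0 \<Longrightarrow> \<exists>y\<in>V. dist y x0 < e"
proof -
  define T where "T = - closure V"
  have "open T" unfolding T_def by (simp add: open_Compl)
  have "B \<inter> closure V = {}" using assms(4,7) open_Int_closure_eq_empty by blast
  then have "Q \<inter> T \<noteq> {}" using assms(5,6) unfolding T_def by blast
  moreover have "Q - T \<noteq> {}" using assms(3) closure_subset unfolding T_def by blast
  ultimately have "Q \<inter> frontier T \<noteq> {}" using connected_Int_frontier[OF assms(2)] by blast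
  then obtain y where y: "y \<in> Q" "y \<in> closure T" "y \<notin> T"
    using \<open>open T\<close> by (auto simp: frontier_def interior_open)
  have yV: "y \<in> closure V" using y(3) by (simp add: T_def)
  obtain e where e: "e > 0" "ball y e \<subseteq> Q" using assms(1) y(1) openE by blast
  obtain p where p: "p \<in> T" "dist p y < e / 3"
    using y(2) e(1) closure_approachable[of y T] by (meson divide_pos_pos zero_less_numeral)
  have ne: "closure V \<noteq> {}" using yV by auto
  obtain x0 where x0: "x0 \<in> closure V" "\<And>z. z \<in> closure V \<Longrightarrow> dist p x0 \<le> dist p z"
    by (rule distance_attains_inf[OF closed_closure ne, of p]) blast
  have "dist p x0 > 0" using x0(1) p(1) unfolding T_def by auto
  moreover have "x0 \<in> Q"
  proof -
    have "dist y x0 \<le> dist p y + dist p x0" by (metis dist_commute dist_triangle)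
    also have "\<dots> < e" using x0(2)[OF yV] p(2) e(1) by linarith
    finally show ?thesis using e(2) by auto
  qed
  moreover have "ball p (dist p x0) \<inter> V = {}"
    using x0(2) closure_subset by (force simp: not_less)
  moreover have "\<exists>y\<in>V. dist y x0 < e" if "e > 0" for e
    using x0(1) that closure_approachable by blast
  ultimately show thesis using that by blast
qed

lemma diff_midpoint:
  fixes p x0 :: "'a::real_vector"
  shows "x0 - midpoint p x0 = (x0 - p) /\<^sub>R 2"
  unfolding midpoint_def by (simp add: algebra_simps) (simp flip: scaleR_add_left)

text \<open>The ball with diameter from \<open>p\<close> to \<open>x0\<close> touches the sphere around \<open>p\<close> through \<open>x0\<close> from inside,
  only at \<open>x0\<close>. Functions of the distance from its centre can thus separate \<open>x0\<close> from all other
  points outside the big ball.\<close>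

lemma outside_inner_tangent_ball:
  fixes p x0 y :: "'a::real_inner"
  assumes "dist p x0 \<le> dist p y" "y \<noteq> x0"
  shows "(dist x0 (midpoint p x0))\<^sup>2 < (dist y (midpoint p x0))\<^sup>2"
proof -
  define a where "a = y - p"
  define b where "b = x0 - p"
  have 1: "y - midpoint p x0 = a - b /\<^sub>R 2" "x0 - midpoint p x0 = b /\<^sub>R 2"
    unfolding a_def b_def midpoint_def by (simp_all add: algebra_simps) (simp_all flip: scaleR_add_left)
  have "norm b \<le> norm a" using assms(1) unfolding a_def b_def by (simp add: dist_norm norm_minus_commute)
  then have "b \<bullet> b \<le> a \<bullet> a" by (simp add: norm_le)
  moreover have "(a - b) \<bullet> (a - b) > 0" using assms(2) unfolding a_def b_def by simp
  ultimately have "a \<bullet> a > a \<bullet> b" by (simp add: inner_diff_left inner_diff_right inner_commute)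
  then show ?thesis
    unfolding dist_norm 1 power2_norm_eq_inner
    by (simp add: inner_diff_left inner_diff_right inner_commute algebra_simps)
qed

text \<open>The factor \<open>exp (N * g)\<close> prefers points near \<open>x0\<close>: on the part of the sphere \<open>sphere x0 \<rho>\<close> where
  \<open>m\<close> may be nonzero, \<open>g\<close> stays below \<open>g x0\<close>, so for large \<open>N\<close> a single point near \<open>x0\<close> with \<open>m > 0\<close>
  beats that whole part, and the maximum over the closed ball is interior.\<close>

lemma weighted_interior_max:
  fixes x0 p :: "'a::euclidean_space" and m g :: "'a \<Rightarrow> real"
  assumes \<rho>: "\<rho> > 0" and m: "continuous_on (cball x0 \<rho>) m" and g: "continuous_on (cball x0 \<rho>) g"
    and nonneg: "\<And>y. y \<in> cball x0 \<rho> \<Longrightarrow> m y \<ge> 0"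
    and zero: "\<And>y. y \<in> cball x0 \<rho> \<Longrightarrow> dist p y < dist p x0 \<Longrightarrow> m y = 0"
    and near: "\<And>e. e > 0 \<Longrightarrow> \<exists>y\<in>cball x0 \<rho>. dist y x0 < e \<and> m y > 0"
    and glt: "\<And>y. dist p y \<ge> dist p x0 \<Longrightarrow> y \<noteq> x0 \<Longrightarrow> g y < g x0"
  obtains N x where "N \<ge> N0" "x \<in> ball x0 \<rho>" "m x > 0"
    "\<And>y. y \<in> ball x0 \<rho> \<Longrightarrow> m y * exp (N * g y) \<le> m x * exp (N * g x)"
proof -
  define K where "K = sphere x0 \<rho> - ball p (dist p x0)"
  have K: "compact K" "K \<subseteq> cball x0 \<rho>" unfolding K_def by (auto intro: compact_diff)
  have "\<exists>s < g x0. \<forall>y\<in>K. g y \<le> s"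
  proof (cases "K = {}")
    case True
    then show ?thesis by (auto intro: exI[of _ "g x0 - 1"])
  next
    case False
    obtain y where "y \<in> K" "\<And>z. z \<in> K \<Longrightarrow> g z \<le> g y"
      using continuous_attains_sup[OF K(1) False continuous_on_subset[OF g K(2)]] by blast
    moreover have "y \<noteq> x0" "dist p y \<ge> dist p x0" using \<open>y \<in> K\<close> \<rho> by (auto simp: K_def)
    ultimately show ?thesis using glt by blast
  qed
  then obtain s where s: "s < g x0" "\<And>y. y \<in> K \<Longrightarrow> g y \<le> s" by blast
  define s' where "s' = (s + g x0) / 2"
  have s': "s < s'" "s' < g x0" using s by (auto simp: s'_def)
  have "x0 \<in> cball x0 \<rho>" using \<rho> by simp
  then obtain e where e: "e > 0" "\<And>y. y \<in> cball x0 \<rho> \<Longrightarrow> dist y x0 < e \<Longrightarrow> \<bar>g y - g x0\<bar> < g x0 - s'"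
    using g s'(2) unfolding continuous_on_iff dist_real_def by (metis diff_gt_0_iff_gt)
  obtain q where q: "q \<in> cball x0 \<rho>" "dist q x0 < e" "m q > 0" using near[OF e(1)] by blast
  have gq: "g q > s'" using e(2)[OF q(1,2)] by linarith
  have ne: "cball x0 \<rho> \<noteq> {}" using q(1) by blast
  obtain M where M: "\<And>y. y \<in> cball x0 \<rho> \<Longrightarrow> m y \<le> M"
    using continuous_attains_sup[OF compact_cball ne m] by blast
  \<comment> \<open>this size gives \<open>exp (N * (s' - s)) > M / m q\<close>, since \<open>exp t > t\<close>\<close>
  define N where "N = max N0 (M / m q / (s' - s))"
  have "M > 0" using M[OF q(1)] q(3) by linarith
  then have "M / m q / (s' - s) > 0" using q(3) s' by simp
  then have N: "N > 0" "N \<ge> N0" by (auto simp: N_def less_max_iff_disj)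
  have big: "M * exp (N * s) < m q * exp (N * g q)"
  proof -
    have "M / m q \<le> N * (s' - s)" using s' by (simp add: N_def pos_divide_le_eq[symmetric])
    also have "\<dots> < exp (N * (s' - s))" using exp_ge_add_one_self[of "N * (s' - s)"] by linarith
    finally have "M < m q * exp (N * (s' - s))" using q(3) by (simp add: field_simps)
    then have "M * exp (N * s) < m q * exp (N * (s' - s)) * exp (N * s)" by simp
    also have "\<dots> = m q * exp (N * s')" by (simp add: mult_exp_exp algebra_simps)
    also have "\<dots> \<le> m q * exp (N * g q)" using q(3) N gq by simp
    finally show ?thesis .
  qed
  have c: "continuous_on (cball x0 \<rho>) (\<lambda>y. m y * exp (N * g y))"
    by (intro continuous_intros m g)
  obtain x where x: "x \<in> cball x0 \<rho>"
    "\<And>y. y \<in> cball x0 \<rho> \<Longrightarrow> m y * exp (N * g y) \<le> m x * exp (N * g x)"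
    using continuous_attains_sup[OF compact_cball ne c] by blast
  have gt: "M * exp (N * s) < m x * exp (N * g x)" using big x(2)[OF q(1)] by linarith
  have M0: "M > 0" using M[OF q(1)] q(3) by linarith
  have pos: "m x > 0"
  proof (rule ccontr)
    assume "\<not> m x > 0"
    then have "m x * exp (N * g x) \<le> 0" by (simp add: mult_le_0_iff)
    moreover have "M * exp (N * s) > 0" using M0 by simp
    ultimately show False using gt by linarith
  qed
  have "x \<notin> sphere x0 \<rho>"
  proof
    assume "x \<in> sphere x0 \<rho>"
    moreover have "x \<notin> ball p (dist p x0)" using zero[OF x(1)] pos by auto
    ultimately have "x \<in> K" by (simp add: K_def)
    then have "m x * exp (N * g x) \<le> M * exp (N * s)"
      using s(2) M[OF x(1)] N M0 by (intro mult_mono) auto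
    then show False using gt by linarith
  qed
  then have "x \<in> ball x0 \<rho>" using x(1) by auto
  then show thesis using that[OF N(2) _ pos] x(2) by (meson ball_subset_cball subsetD)
qed

lemma pd_zero_at_max:
  fixes f :: "'a::euclidean_space \<Rightarrow> real"
  assumes "open U" "x \<in> U" "f differentiable (at x)" "\<And>y. y \<in> U \<Longrightarrow> f y \<le> f x"
  shows "pd u f x = 0"
  using differential_zero_maxmin[OF assms(2,1) has_derivative_pd[OF assms(3)]] assms(4)
  by (auto dest: fun_cong)

lemma pd2_nonpos_at_max:
  fixes f :: "'a::euclidean_space \<Rightarrow> real"
  assumes U: "open U" and x: "x \<in> U" and f: "smooth_on U f" and max: "\<And>y. y \<in> U \<Longrightarrow> f y \<le> f x"
  shows "pd u (pd u f) x \<le> 0"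
proof (rule ccontr)
  assume "\<not> ?thesis"
  then have pos: "pd u (pd u f) x > 0" by simp
  have d0: "pd u f x = 0"
    using pd_zero_at_max[OF U x smooth_on_differentiable[OF U f x]] max by blast
  have "((\<lambda>t. pd u f (x + t *\<^sub>R u)) has_real_derivative pd u (pd u f) (x + 0 *\<^sub>R u)) (at 0)"
    by (rule line_has_real_derivative) (simp add: smooth_on_differentiable[OF U smooth_on_pd[OF f] x])
  from DERIV_pos_inc_right[OF this] pos obtain d where d: "d > 0"
    "\<And>t. 0 < t \<Longrightarrow> t < d \<Longrightarrow> 0 < pd u f (x + t *\<^sub>R u)"
    using d0 by auto
  obtain e where e: "e > 0" "ball x e \<subseteq> U" using U x openE by blast
  define r where "r = min (d / 2) (e / (2 * (norm u + 1)))"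
  have "e / (2 * (norm u + 1)) > 0" using e(1) by (simp add: add_nonneg_pos)
  then have r: "r > 0" "r < d" using d(1) unfolding r_def by (auto simp: min_less_iff_disj)
  have inU: "x + t *\<^sub>R u \<in> U" if "0 \<le> t" "t \<le> r" for t
  proof -
    have "norm (t *\<^sub>R u) \<le> (e / (2 * (norm u + 1))) * norm u"
      using that mult_right_mono[of t "e / (2 * (norm u + 1))" "norm u"] by (simp add: r_def)
    also have "\<dots> = e * (norm u / (2 * (norm u + 1)))" by simp
    also have "\<dots> < e * 1" using e(1)
      by (intro mult_strict_left_mono) (auto simp: divide_less_eq add_nonneg_pos add_strict_increasing2)
    finally show ?thesis using e(2) by (auto simp: dist_norm)
  qed
  have D: "((\<lambda>t. f (x + t *\<^sub>R u)) has_real_derivative pd u f (x + t *\<^sub>R u)) (at t)"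
    if "0 \<le> t" "t \<le> r" for t
    using line_has_real_derivative smooth_on_differentiable[OF U f inU[OF that]] by blast
  obtain t where t: "0 < t" "t < r" "f (x + r *\<^sub>R u) - f (x + 0 *\<^sub>R u) = (r - 0) * pd u f (x + t *\<^sub>R u)"
    using MVT2[OF r(1), of "\<lambda>t. f (x + t *\<^sub>R u)" "\<lambda>t. pd u f (x + t *\<^sub>R u)"] D by auto
  have "pd u f (x + t *\<^sub>R u) > 0" using d(2) t r by auto
  then have "r * pd u f (x + t *\<^sub>R u) > 0" using r(1) by simp
  then have "f (x + r *\<^sub>R u) > f x" using t(3) by simp
  moreover have "f (x + r *\<^sub>R u) \<le> f x" using max inU[of r] r by simp
  ultimately show False by simp
qed

lemma pd_inner_self:
  fixes c :: "'a::euclidean_space"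
  shows "pd u (\<lambda>y. K - (y - c) \<bullet> (y - c)) y = - 2 * ((y - c) \<bullet> u)"
  by (rule pd_eqI[where f' = "\<lambda>u. - 2 * ((y - c) \<bullet> u)"])
     (auto intro!: derivative_eq_intros simp: inner_commute)

lemma smooth_on_inner_self:
  "open U \<Longrightarrow> smooth_on U (\<lambda>y::'a::euclidean_space. K - (y - c) \<bullet> (y - c))"
  by (intro smooth_intros)

lemma cball_inside_avoiding:
  fixes x0 :: "'a::euclidean_space" and f :: "'a \<Rightarrow> real"
  assumes "open U" "x0 \<in> U" "continuous_on U f" "f x0 > 0"
  obtains \<rho> \<eta> where "\<rho> > 0" "\<eta> > 0" "cball x0 \<rho> \<subseteq> U" "\<And>y. y \<in> cball x0 \<rho> \<Longrightarrow> f y \<ge> \<eta>"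
proof -
  have o: "open {y\<in>U. f y > f x0 / 2}"
  proof -
    have "{y\<in>U. f y > f x0 / 2} = U \<inter> f -` {f x0 / 2<..}" by auto
    then show ?thesis using continuous_open_preimage[OF assms(3,1), of "{f x0 / 2<..}"] by simp
  qed
  have "x0 \<in> {y\<in>U. f y > f x0 / 2}" using assms by simp
  then obtain \<rho> where "\<rho> > 0" "cball x0 \<rho> \<subseteq> {y\<in>U. f y > f x0 / 2}"
    using o open_contains_cball by blast
  then show thesis using that[of \<rho> "f x0 / 2"] assms(4) by force
qed

text \<open>At an interior maximum of \<open>w\<^sup>2 exp (N g)\<close> the equation for \<open>w\<close> forces \<open>2 a = - N (b g)\<close>. As \<open>b\<close> is
  transversal to the sphere at \<open>x0\<close>, the derivative \<open>b g\<close> is bounded away from \<open>0\<close> near \<open>x0\<close>, which is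
  impossible for large \<open>N\<close>.\<close>

lemma continuation_along_transversal_field:
  fixes w :: "real^2 \<Rightarrow> real" and b :: "real^2 \<Rightarrow> real^2"
  assumes U: "open U" and x0: "x0 \<in> U" and w: "smooth_on U w"
    and b: "continuous_on U b" and a: "continuous_on U a"
    and eq: "\<And>y. y \<in> U \<Longrightarrow> pd (b y) w y = a y * w y"
    and zero: "\<And>y. y \<in> U \<Longrightarrow> dist p y < dist p x0 \<Longrightarrow> w y = 0"
    and near: "\<And>e. e > 0 \<Longrightarrow> \<exists>y\<in>U. dist y x0 < e \<and> w y \<noteq> 0"
    and trans: "(x0 - p) \<bullet> b x0 \<noteq> 0"
  shows False
proof -
  define c where "c = midpoint p x0"
  define g where "g y = 0 - (y - c) \<bullet> (y - c)" for y
  have x0c: "x0 - c = (x0 - p) /\<^sub>R 2"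
    unfolding c_def by (rule diff_midpoint)
  have "continuous_on U (\<lambda>y. \<bar>(y - c) \<bullet> b y\<bar>)" by (intro continuous_intros b)
  moreover have "\<bar>(x0 - c) \<bullet> b x0\<bar> > 0" using trans by (simp add: x0c)
  ultimately obtain \<rho> \<eta> where \<rho>: "\<rho> > 0" "\<eta> > 0" "cball x0 \<rho> \<subseteq> U"
    "\<And>y. y \<in> cball x0 \<rho> \<Longrightarrow> \<bar>(y - c) \<bullet> b y\<bar> \<ge> \<eta>"
    using cball_inside_avoiding[OF U x0] by blast
  have "x0 \<in> cball x0 \<rho>" using \<rho> by simp
  then obtain A where A: "\<And>y. y \<in> cball x0 \<rho> \<Longrightarrow> \<bar>a y\<bar> \<le> A"
    using continuous_attains_sup[OF compact_cball _ continuous_on_rabs[OF continuous_on_subset[OF a \<rho>(3)]]]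
    by (metis empty_iff)
  have ball: "ball x0 \<rho> \<subseteq> U" using \<rho>(3) by auto
  have gs: "smooth_on U g" unfolding g_def by (rule smooth_on_inner_self[OF U])
  have glt: "g y < g x0" if "dist p y \<ge> dist p x0" "y \<noteq> x0" for y
    using outside_inner_tangent_ball[OF that]
    unfolding g_def c_def by (simp add: dist_norm power2_norm_eq_inner)
  obtain N x where N: "N \<ge> A / \<eta> + 1" and x: "x \<in> ball x0 \<rho>" "(w x)\<^sup>2 > 0"
    and max: "\<And>y. y \<in> ball x0 \<rho> \<Longrightarrow> (w y)\<^sup>2 * exp (N * g y) \<le> (w x)\<^sup>2 * exp (N * g x)"
  proof (rule weighted_interior_max[of \<rho> x0 "\<lambda>y. (w y)\<^sup>2" g p "A / \<eta> + 1"])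
    show "continuous_on (cball x0 \<rho>) (\<lambda>y. (w y)\<^sup>2)" "continuous_on (cball x0 \<rho>) g"
      using smooth_on_continuous[OF w, THEN continuous_on_subset, OF \<rho>(3)]
        smooth_on_continuous[OF gs, THEN continuous_on_subset, OF \<rho>(3)]
      by (auto intro!: continuous_on_power)
    show "\<exists>y\<in>cball x0 \<rho>. dist y x0 < e \<and> 0 < (w y)\<^sup>2" if "e > 0" for e
      using near[of "min e \<rho>"] that \<rho>(1) by (force simp: dist_commute)
  qed (use \<rho> zero glt in auto)
  have xU: "x \<in> U" using x(1) ball by blast
  have dw: "w differentiable (at x)" and dg: "g differentiable (at x)"
    using smooth_on_differentiable[OF U _ xU] w gs by auto
  define u where "u = b x"
  have "((\<lambda>y. (w y)\<^sup>2 * exp (N * g y)) has_derivative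
      (\<lambda>u. (w x)\<^sup>2 * (exp (N * g x) * (N * pd u g x)) + 2 * w x * pd u w x * exp (N * g x))) (at x)"
    using has_derivative_pd[OF dw] has_derivative_pd[OF dg]
    by (auto intro!: derivative_eq_intros simp: power2_eq_square algebra_simps)
  note D = this
  have "pd u (\<lambda>y. (w y)\<^sup>2 * exp (N * g y)) x = 0"
    using D by (intro pd_zero_at_max[OF open_ball x(1)] max) (auto simp: differentiable_def)
  then have "(w x)\<^sup>2 * (exp (N * g x) * (N * pd u g x)) + 2 * w x * pd u w x * exp (N * g x) = 0"
    using pd_eqI[OF D, of u] by simp
  moreover have "pd u g x = - 2 * ((x - c) \<bullet> u)" unfolding g_def by (rule pd_inner_self)
  moreover have "pd u w x = a x * w x" unfolding u_def using eq[OF xU] .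
  ultimately have "(w x)\<^sup>2 * exp (N * g x) * 2 * (a x - N * ((x - c) \<bullet> b x)) = 0"
    unfolding u_def by (simp add: algebra_simps power2_eq_square)
  then have "a x = N * ((x - c) \<bullet> b x)" using x(2) by simp
  then have "\<bar>a x\<bar> = \<bar>N\<bar> * \<bar>(x - c) \<bullet> b x\<bar>" by (simp add: abs_mult)
  moreover have xc: "x \<in> cball x0 \<rho>" using x(1) by auto
  have "0 \<le> A" using A[OF xc] by linarith
  have "\<bar>N\<bar> * \<bar>(x - c) \<bullet> b x\<bar> \<ge> (A / \<eta> + 1) * \<eta>"
    using \<rho>(2,4) xc N by (intro mult_mono) (auto simp: \<open>0 \<le> A\<close>)
  moreover have "(A / \<eta> + 1) * \<eta> > A" using \<rho>(2) by (simp add: field_simps)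
  ultimately show False using A[OF xc] by linarith
qed


text \<open>The derivative along the complex vector field \<open>b + \<zeta> a\<close>.\<close>

definition cderiv ::
  "(real^2 \<Rightarrow> complex) \<Rightarrow> real^2 \<Rightarrow> real^2 \<Rightarrow> (real^2 \<Rightarrow> complex) \<Rightarrow> real^2 \<Rightarrow> complex" where
  "cderiv \<zeta> a b u y = pd b u y + \<zeta> y * pd a u y"

lemma smooth_on_cderiv:
  "open U \<Longrightarrow> smooth_on U \<zeta> \<Longrightarrow> smooth_on U u \<Longrightarrow> smooth_on U (cderiv \<zeta> a b u)"
  unfolding cderiv_def by (intro smooth_intros)

lemma cderiv_mult:
  "u differentiable (at y) \<Longrightarrow> v differentiable (at y) \<Longrightarrow>
    cderiv \<zeta> a b (\<lambda>y. u y * v y) y = u y * cderiv \<zeta> a b v y + cderiv \<zeta> a b u y * v y"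
  by (simp add: cderiv_def pd_mult algebra_simps)

lemma cderiv_add:
  "u differentiable (at y) \<Longrightarrow> v differentiable (at y) \<Longrightarrow>
    cderiv \<zeta> a b (\<lambda>y. u y + v y) y = cderiv \<zeta> a b u y + cderiv \<zeta> a b v y"
  by (simp add: cderiv_def pd_add algebra_simps)

lemma cderiv_const [simp]: "cderiv \<zeta> a b (\<lambda>_. k) y = 0"
  by (simp add: cderiv_def)

lemma cderiv_transform:
  assumes "open U" "y \<in> U" "u differentiable (at y)" "\<And>z. z \<in> U \<Longrightarrow> u z = v z"
  shows "cderiv \<zeta> a b v y = cderiv \<zeta> a b u y"
  using pd_transform[OF assms] by (simp add: cderiv_def)

lemma cderiv_cnj:
  assumes "u differentiable (at y)"
  shows "cderiv (\<lambda>y. cnj (\<zeta> y)) a b (\<lambda>y. cnj (u y)) y = cnj (cderiv \<zeta> a b u y)"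
  by (simp add: cderiv_def pd_linear[OF bounded_linear_cnj assms])

lemma cderiv_commutator:
  assumes U: "open U" and y: "y \<in> U" and \<zeta>: "smooth_on U \<zeta>" and \<eta>: "smooth_on U \<eta>" and u: "smooth_on U u"
  shows "cderiv \<eta> a b (cderiv \<zeta> a b u) y - cderiv \<zeta> a b (cderiv \<eta> a b u) y
    = (cderiv \<eta> a b \<zeta> y - cderiv \<zeta> a b \<eta> y) * pd a u y"
proof -
  note d = smooth_on_differentiable[OF U _ y]
  note s = \<zeta> \<eta> smooth_on_pd[OF u]
  have 1: "pd c (cderiv \<theta> a b u) y = pd c (pd b u) y + (\<theta> y * pd c (pd a u) y + pd c \<theta> y * pd a u y)"
    if "smooth_on U \<theta>" for c \<theta>
  proof -
    have "pd c (cderiv \<theta> a b u) y = pd c (\<lambda>y. pd b u y + \<theta> y * pd a u y) y"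
      by (simp add: cderiv_def[abs_def])
    also have "\<dots> = pd c (pd b u) y + pd c (\<lambda>y. \<theta> y * pd a u y) y"
      by (intro pd_add d s smooth_on_mult U that)
    also have "pd c (\<lambda>y. \<theta> y * pd a u y) y = \<theta> y * pd c (pd a u) y + pd c \<theta> y * pd a u y"
      by (intro pd_mult d s that)
    finally show ?thesis .
  qed
  show ?thesis
    unfolding cderiv_def[of \<eta> a b "cderiv \<zeta> a b u"] cderiv_def[of \<zeta> a b "cderiv \<eta> a b u"]
      1[OF \<zeta>] 1[OF \<eta>] cderiv_def[of \<eta> a b \<zeta>] cderiv_def[of \<zeta> a b \<eta>]
    using pd_commute[OF U u y, of a b] by (simp add: algebra_simps)
qed

text \<open>At a critical point the second-order operator is the Hessian contracted with
  \<open>(b + \<zeta> a) (b + cnj \<zeta> a)\<close>, that is, the sum of its values on the real vectors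
  \<open>b + Re \<zeta> a\<close> and \<open>Im \<zeta> a\<close>.\<close>

lemma cderiv2_nonpos_at_max:
  fixes f :: "real^2 \<Rightarrow> real"
  assumes U: "open U" and x: "x \<in> U" and f: "smooth_on U f" and \<zeta>: "smooth_on U \<zeta>"
    and max: "\<And>y. y \<in> U \<Longrightarrow> f y \<le> f x"
  defines "F \<equiv> \<lambda>y. complex_of_real (f y)"
  shows "cderiv \<zeta> a b F x = 0"
    and "Re (cderiv \<zeta> a b (cderiv (\<lambda>y. cnj (\<zeta> y)) a b F) x) \<le> 0"
proof -
  have F: "smooth_on U F" unfolding F_def by (intro smooth_intros U f)
  note d = smooth_on_differentiable[OF U _ x]
  have z: "pd u f x = 0" for u
    using pd_zero_at_max[OF U x smooth_on_differentiable[OF U f x]] max by blast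
  have 1: "pd u F y = of_real (pd u f y)" if "y \<in> U" for u y
    unfolding F_def using pd_linear[OF bounded_linear_of_real smooth_on_differentiable[OF U f that]] .
  have zF: "pd u F x = 0" for u using 1[OF x] z by simp
  then show "cderiv \<zeta> a b F x = 0" by (simp add: cderiv_def)
  have 2: "pd v (pd u F) x = of_real (pd v (pd u f) x)" for u v
  proof -
    have "pd v (pd u F) x = pd v (\<lambda>y. of_real (pd u f y)) x"
      by (rule pd_transform[OF U x]) (auto simp: 1 intro!: d smooth_on_of_real U smooth_on_pd f)
    also have "\<dots> = of_real (pd v (pd u f) x)"
      by (rule pd_linear[OF bounded_linear_of_real d[OF smooth_on_pd[OF f]]])
    finally show ?thesis .
  qed
  have 3: "pd c (cderiv (\<lambda>y. cnj (\<zeta> y)) a b F) x = pd c (pd b F) x + cnj (\<zeta> x) * pd c (pd a F) x" for c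
  proof -
    have "pd c (cderiv (\<lambda>y. cnj (\<zeta> y)) a b F) x = pd c (\<lambda>y. pd b F y + cnj (\<zeta> y) * pd a F y) x"
      by (simp add: cderiv_def[abs_def])
    also have "\<dots> = pd c (pd b F) x + pd c (\<lambda>y. cnj (\<zeta> y) * pd a F y) x"
      by (intro pd_add d smooth_on_mult U smooth_on_pd smooth_on_cnj \<zeta> F)
    also have "pd c (\<lambda>y. cnj (\<zeta> y) * pd a F y) x = cnj (\<zeta> x) * pd c (pd a F) x"
      using zF by (subst pd_mult) (auto intro!: d U smooth_on_pd smooth_on_cnj \<zeta> F)
    finally show ?thesis .
  qed
  define h11 h12 h22 where "h11 = pd a (pd a f) x" and "h12 = pd a (pd b f) x" and "h22 = pd b (pd b f) x"
  have h12': "pd b (pd a f) x = h12" unfolding h12_def using pd_commute[OF U f x] .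
  have re: "Re (cderiv \<zeta> a b (cderiv (\<lambda>y. cnj (\<zeta> y)) a b F) x)
      = (h22 + 2 * Re (\<zeta> x) * h12 + (Re (\<zeta> x))\<^sup>2 * h11) + (Im (\<zeta> x))\<^sup>2 * h11"
    unfolding cderiv_def[of \<zeta>] 3 2 h12' h11_def[symmetric] h12_def[symmetric] h22_def[symmetric]
    by (simp add: power2_eq_square algebra_simps)
  define u where "u = b + Re (\<zeta> x) *\<^sub>R a"
  have 4: "pd u f y = pd b f y + Re (\<zeta> x) * pd a f y" if "y \<in> U" for y
    unfolding u_def using smooth_on_differentiable[OF U f that]
    by (simp add: pd_add_dir pd_scaleR_dir)
  have "pd u (pd u f) x = pd u (\<lambda>y. pd b f y + Re (\<zeta> x) * pd a f y) x"
    by (rule pd_transform[OF U x]) (auto simp: 4 intro!: d smooth_intros U f)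
  also have "\<dots> = pd u (pd b f) x + Re (\<zeta> x) * pd u (pd a f) x"
    by (subst pd_add) (auto simp: pd_mult d smooth_on_pd f smooth_on_const intro!: d smooth_intros U f)
  also have "\<dots> = h22 + 2 * Re (\<zeta> x) * h12 + (Re (\<zeta> x))\<^sup>2 * h11"
    unfolding u_def using d[OF smooth_on_pd[OF f]]
    by (simp add: pd_add_dir pd_scaleR_dir h11_def h12_def h22_def h12'[unfolded h12_def] power2_eq_square algebra_simps)
  finally have "h22 + 2 * Re (\<zeta> x) * h12 + (Re (\<zeta> x))\<^sup>2 * h11 \<le> 0"
    using pd2_nonpos_at_max[OF U x f, of u] max by simp
  moreover have "h11 \<le> 0" unfolding h11_def using pd2_nonpos_at_max[OF U x f, of a] max by simp
  then have "(Im (\<zeta> x))\<^sup>2 * h11 \<le> 0" by (simp add: mult_nonneg_nonpos)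
  ultimately show "Re (cderiv \<zeta> a b (cderiv (\<lambda>y. cnj (\<zeta> y)) a b F) x) \<le> 0" unfolding re by linarith
qed


lemma cderiv_real_exp:
  assumes "f differentiable (at y)"
  shows "cderiv \<zeta> a b (\<lambda>y. complex_of_real (exp (f y))) y
    = complex_of_real (exp (f y)) * cderiv \<zeta> a b (\<lambda>y. complex_of_real (f y)) y"
proof -
  have e: "((\<lambda>x. exp (f x)) has_derivative (\<lambda>v. exp (f y) * pd v f y)) (at y)"
    using has_derivative_pd[OF assms] by (auto intro!: derivative_eq_intros)
  have "(\<lambda>x. exp (f x)) differentiable (at y)" using e by (auto simp: differentiable_def)
  then have "pd u (\<lambda>y. complex_of_real (exp (f y))) y
      = complex_of_real (exp (f y)) * pd u (\<lambda>y. complex_of_real (f y)) y" for u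
    by (simp add: pd_linear[OF bounded_linear_of_real] assms pd_eqI[OF e])
  then show ?thesis by (simp add: cderiv_def algebra_simps)
qed

lemma compact_bound:
  fixes f :: "'a::euclidean_space \<Rightarrow> real"
  assumes "continuous_on U f" "cball x \<rho> \<subseteq> U"
  obtains B where "\<And>y. y \<in> cball x \<rho> \<Longrightarrow> \<bar>f y\<bar> \<le> B"
proof -
  have "bounded (f ` cball x \<rho>)"
    by (intro compact_imp_bounded compact_continuous_image continuous_on_subset[OF assms] compact_cball)
  then obtain B where "\<And>z. z \<in> f ` cball x \<rho> \<Longrightarrow> norm z \<le> B" by (auto simp: bounded_iff)
  then show thesis using that[of B] by auto
qed

text \<open>The operator \<open>D\<close> along \<open>b + cnj \<zeta> a\<close> plays the role of a Cauchy-Riemann operator and \<open>E\<close>, along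
  \<open>b + \<zeta> a\<close>, that of its conjugate. By the hypothesis on \<open>D \<zeta>\<close> their commutator is
  \<open>\<alpha> (E - D)\<close>, so \<open>L = E D - \<alpha> D\<close> is a real elliptic operator, and \<open>D w = 2 \<alpha> w\<close> makes
  \<open>L (log |w|\<^sup>2)\<close> equal to the smooth function \<open>F\<close> below where \<open>w \<noteq> 0\<close>. For the weight
  \<open>g = exp (k \<psi>)\<close> with large \<open>k\<close> the function \<open>L g\<close> has a positive lower bound near \<open>x0\<close>. Hence
  \<open>L (log |w|\<^sup>2 + N g) > 0\<close> for large \<open>N\<close>, which excludes the interior maximum that
  \<open>weighted_interior_max\<close> provides. The computation below avoids logarithms.\<close>

lemma continuation_along_complex_field:
  fixes w \<zeta> :: "real^2 \<Rightarrow> complex" and \<alpha> :: "real^2 \<Rightarrow> real"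
  assumes U: "open U" and x0: "x0 \<in> U" and w: "smooth_on U w" and \<zeta>: "smooth_on U \<zeta>" and \<alpha>: "smooth_on U \<alpha>"
    and indep: "\<And>n. n \<bullet> a = 0 \<Longrightarrow> n \<bullet> b = 0 \<Longrightarrow> n = 0"
    and Im: "\<And>y. y \<in> U \<Longrightarrow> Im (\<zeta> y) \<noteq> 0"
    and D\<zeta>: "\<And>y. y \<in> U \<Longrightarrow> cderiv (\<lambda>y. cnj (\<zeta> y)) a b \<zeta> y - cnj (cderiv (\<lambda>y. cnj (\<zeta> y)) a b \<zeta> y)
        = \<alpha> y * (\<zeta> y - cnj (\<zeta> y))"
    and Dw: "\<And>y. y \<in> U \<Longrightarrow> cderiv (\<lambda>y. cnj (\<zeta> y)) a b w y = 2 * \<alpha> y * w y"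
    and zero: "\<And>y. y \<in> U \<Longrightarrow> dist p y < dist p x0 \<Longrightarrow> w y = 0"
    and near: "\<And>e. e > 0 \<Longrightarrow> \<exists>y\<in>U. dist y x0 < e \<and> w y \<noteq> 0"
    and ne: "p \<noteq> x0"
  shows False
proof -
  define \<zeta>c where "\<zeta>c y = cnj (\<zeta> y)" for y
  have \<zeta>c: "smooth_on U \<zeta>c" unfolding \<zeta>c_def by (intro smooth_intros U \<zeta>)
  let ?D = "cderiv \<zeta>c a b" and ?E = "cderiv \<zeta> a b"
  define A where "A y = complex_of_real (\<alpha> y)" for y
  have A: "smooth_on U A" unfolding A_def by (intro smooth_intros U \<alpha>)
  define wc where "wc y = cnj (w y)" for y
  have wc: "smooth_on U wc" unfolding wc_def by (intro smooth_intros U w)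
  note diff = smooth_on_differentiable[OF U]
  note sD = smooth_on_cderiv[OF U]
  have Dw': "?D w y = 2 * (A y * w y)" if "y \<in> U" for y
    using Dw[OF that] unfolding \<zeta>c_def[abs_def] A_def by simp
  have Ewc: "?E wc y = 2 * (A y * wc y)" if "y \<in> U" for y
    using cderiv_cnj[OF diff[OF w that], of \<zeta>c a b] Dw'[OF that]
    unfolding \<zeta>c_def wc_def[abs_def] A_def by simp
  have comm: "?D (?E u) y - ?E (?D u) y = A y * (?E u y - ?D u y)" if "smooth_on U u" "y \<in> U" for u y
  proof -
    have "?E \<zeta>c y = cnj (?D \<zeta> y)"
      using cderiv_cnj[OF diff[OF \<zeta> that(2)], of \<zeta>c a b] unfolding \<zeta>c_def[abs_def] by simp
    then have "?D \<zeta> y - ?E \<zeta>c y = A y * (\<zeta> y - \<zeta>c y)"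
      using D\<zeta>[OF that(2)] unfolding \<zeta>c_def[abs_def] A_def by simp
    then have "?D (?E u) y - ?E (?D u) y = A y * (\<zeta> y - \<zeta>c y) * pd a u y"
      using cderiv_commutator[OF U that(2) \<zeta> \<zeta>c that(1), of a b] by simp
    moreover have "?E u y - ?D u y = (\<zeta> y - \<zeta>c y) * pd a u y"
      by (simp add: cderiv_def algebra_simps)
    ultimately show ?thesis by simp
  qed
  define c where "c = midpoint p x0"
  have x0c: "x0 - c = (x0 - p) /\<^sub>R 2"
    unfolding c_def by (rule diff_midpoint)
  define K where "K = (x0 - c) \<bullet> (x0 - c)"
  define \<psi> where "\<psi> y = K - (y - c) \<bullet> (y - c)" for y
  have \<psi>: "smooth_on U \<psi>" unfolding \<psi>_def by (rule smooth_on_inner_self[OF U])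
  define \<Psi> where "\<Psi> y = complex_of_real (\<psi> y)" for y
  have \<Psi>: "smooth_on U \<Psi>" unfolding \<Psi>_def by (intro smooth_intros U \<psi>)
  have E\<Psi>: "?E \<Psi> y = cnj (?D \<Psi> y)" if "y \<in> U" for y
    using cderiv_cnj[OF diff[OF \<Psi> that], of \<zeta>c a b] unfolding \<zeta>c_def \<Psi>_def[abs_def] by simp
  define P where "P y = (cmod (?D \<Psi> y))\<^sup>2" for y
  define Q where "Q y = Re (?E (?D \<Psi>) y - A y * ?D \<Psi> y)" for y
  define F where "F y = Re (2 * ?E A y + 2 * ?D A y) - 4 * (\<alpha> y)\<^sup>2" for y
  have cont: "continuous_on U P" "continuous_on U Q" "continuous_on U F" "continuous_on U \<psi>"
    unfolding P_def Q_def F_def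
    by (intro continuous_intros smooth_on_continuous sD \<zeta> \<zeta>c A \<Psi> \<alpha> \<psi>)+
  \<comment> \<open>the gradient of \<open>\<psi>\<close> at \<open>x0\<close> is a nonzero real vector, which \<open>D\<close> cannot annihilate as \<open>Im \<zeta> \<noteq> 0\<close>\<close>
  have "P x0 > 0"
  proof (rule ccontr)
    assume "\<not> P x0 > 0"
    then have "?D \<Psi> x0 = 0" by (simp add: P_def)
    moreover have "pd u \<Psi> x0 = of_real (- ((x0 - p) \<bullet> u))" for u
    proof -
      have "pd u \<Psi> x0 = of_real (pd u \<psi> x0)"
        unfolding \<Psi>_def by (rule pd_linear[OF bounded_linear_of_real diff[OF \<psi> x0]])
      also have "pd u \<psi> x0 = - 2 * ((x0 - c) \<bullet> u)" unfolding \<psi>_def by (rule pd_inner_self)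
      finally show ?thesis by (simp add: x0c)
    qed
    ultimately have "of_real ((x0 - p) \<bullet> b) + cnj (\<zeta> x0) * of_real ((x0 - p) \<bullet> a) = 0"
      by (simp add: cderiv_def \<zeta>c_def algebra_simps neg_eq_iff_add_eq_0)
    then have "(x0 - p) \<bullet> b + Re (\<zeta> x0) * ((x0 - p) \<bullet> a) = 0" "Im (\<zeta> x0) * ((x0 - p) \<bullet> a) = 0"
      by (auto simp: complex_eq_iff)
    then have "x0 - p = 0" using Im[OF x0] by (intro indep) auto
    then show False using ne by simp
  qed
  then obtain \<rho> \<eta> where \<rho>: "\<rho> > 0" "\<eta> > 0" "cball x0 \<rho> \<subseteq> U" "\<And>y. y \<in> cball x0 \<rho> \<Longrightarrow> P y \<ge> \<eta>"
    using cball_inside_avoiding[OF U x0 cont(1)] by blast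
  obtain B where B: "\<And>y. y \<in> cball x0 \<rho> \<Longrightarrow> \<bar>Q y\<bar> \<le> B" by (rule compact_bound[OF cont(2) \<rho>(3)]) blast
  obtain B' where B': "\<And>y. y \<in> cball x0 \<rho> \<Longrightarrow> \<bar>F y\<bar> \<le> B'" by (rule compact_bound[OF cont(3) \<rho>(3)]) blast
  obtain M where M: "\<And>y. y \<in> cball x0 \<rho> \<Longrightarrow> \<bar>\<psi> y\<bar> \<le> M" by (rule compact_bound[OF cont(4) \<rho>(3)]) blast
  \<comment> \<open>then \<open>L g = k g (Q + k P)\<close> with \<open>Q + k P \<ge> 1\<close>, the term \<open>k P\<close> dominating\<close>
  define k where "k = max 1 ((B + 1) / \<eta>)"
  have k: "k \<ge> 1" "k * \<eta> \<ge> B + 1"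
    using \<rho>(2) by (auto simp: k_def pos_divide_le_eq[symmetric])
  define g0 where "g0 = exp (- k * M)"
  have g0: "g0 > 0" by (simp add: g0_def)
  define g where "g y = exp (k * \<psi> y)" for y
  have g: "smooth_on U g" unfolding g_def by (intro smooth_intros U \<psi>)
  have glt: "g y < g x0" if "dist p y \<ge> dist p x0" "y \<noteq> x0" for y
  proof -
    have "\<psi> y < \<psi> x0"
      using outside_inner_tangent_ball[OF that]
      unfolding c_def \<psi>_def by (simp add: dist_norm power2_norm_eq_inner)
    then show ?thesis using k(1) by (simp add: g_def)
  qed
  obtain N x where N: "N \<ge> (B' + 1) / g0" and x: "x \<in> ball x0 \<rho>" "(cmod (w x))\<^sup>2 > 0"
    and max: "\<And>y. y \<in> ball x0 \<rho> \<Longrightarrow> (cmod (w y))\<^sup>2 * exp (N * g y) \<le> (cmod (w x))\<^sup>2 * exp (N * g x)"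
  proof (rule weighted_interior_max[of \<rho> x0 "\<lambda>y. (cmod (w y))\<^sup>2" g p "(B' + 1) / g0"])
    show "continuous_on (cball x0 \<rho>) (\<lambda>y. (cmod (w y))\<^sup>2)" "continuous_on (cball x0 \<rho>) g"
      using smooth_on_continuous[OF w, THEN continuous_on_subset, OF \<rho>(3)]
        smooth_on_continuous[OF g, THEN continuous_on_subset, OF \<rho>(3)]
      by (auto intro!: continuous_on_power continuous_on_norm)
    show "\<exists>y\<in>cball x0 \<rho>. dist y x0 < e \<and> 0 < (cmod (w y))\<^sup>2" if "e > 0" for e
      using near[of "min e \<rho>"] that \<rho>(1) by (force simp: dist_commute)
  qed (use \<rho> zero glt in auto)
  have xc: "x \<in> cball x0 \<rho>" using x(1) by auto
  then have xU: "x \<in> U" using \<rho>(3) by blast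
  have ballU: "ball x0 \<rho> \<subseteq> U" using \<rho>(3) by auto
  define G where "G y = complex_of_real (g y)" for y
  have G: "smooth_on U G" unfolding G_def by (intro smooth_intros U g)
  define X where "X y = complex_of_real (exp (N * g y))" for y
  have X: "smooth_on U X" unfolding X_def by (intro smooth_intros U g)
  define \<Phi> where "\<Phi> y = w y * wc y * X y" for y
  have \<Phi>: "smooth_on U \<Phi>" unfolding \<Phi>_def by (intro smooth_on_mult U w wc X)
  have \<Phi>_real: "\<Phi> = (\<lambda>y. complex_of_real ((cmod (w y))\<^sup>2 * exp (N * g y)))"
    unfolding \<Phi>_def X_def wc_def by (rule ext) (simp add: complex_norm_square[symmetric])
  have rs: "smooth_on U (\<lambda>y. (cmod (w y))\<^sup>2 * exp (N * g y))"
  proof -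
    have "smooth_on U (\<lambda>y. w y \<bullet> w y * exp (N * g y))" by (intro smooth_intros U w g)
    then show ?thesis by (simp add: power2_norm_eq_inner)
  qed
  note sub = smooth_on_subset[OF _ ballU]
  have crit: "?E \<Phi> x = 0" "?D \<Phi> x = 0" "Re (?E (?D \<Phi>) x) \<le> 0"
    using cderiv2_nonpos_at_max[OF open_ball x(1) sub[OF rs] sub[OF \<zeta>] max, of a b]
      cderiv2_nonpos_at_max[OF open_ball x(1) sub[OF rs] sub[OF \<zeta>c] max, of a b]
    unfolding \<Phi>_real \<zeta>c_def[abs_def] by auto
  have cX: "cderiv \<theta> a b X y = X y * (of_real N * cderiv \<theta> a b G y)" if "y \<in> U" for \<theta> y
  proof -
    have dg: "(\<lambda>y. N * g y) differentiable (at y)"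
      by (intro diff[OF _ that] smooth_on_mult U smooth_on_const g)
    show ?thesis unfolding X_def[abs_def] cderiv_real_exp[OF dg]
      using cderiv_mult[OF differentiable_const diff[OF G that], of \<theta> a b "of_real N"]
      unfolding G_def[abs_def] by simp
  qed
  have cG: "cderiv \<theta> a b G y = G y * (of_real k * cderiv \<theta> a b \<Psi> y)" if "y \<in> U" for \<theta> y
  proof -
    have dg: "(\<lambda>y. k * \<psi> y) differentiable (at y)"
      by (intro diff[OF _ that] smooth_on_mult U smooth_on_const \<psi>)
    show ?thesis unfolding G_def[abs_def] g_def cderiv_real_exp[OF dg]
      using cderiv_mult[OF differentiable_const diff[OF \<Psi> that], of \<theta> a b "of_real k"]
      unfolding \<Psi>_def[abs_def] by simp
  qed
  note cderiv_rules = cderiv_mult cderiv_add differentiable_mult differentiable_add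
  note dd = diff[OF w] diff[OF wc] diff[OF A] diff[OF X] diff[OF G] diff[OF \<Phi>]
    diff[OF sD[OF \<zeta>c G]] diff[OF sD[OF \<zeta>c wc]] diff[OF sD[OF \<zeta>c \<Psi>]]
  have EDG: "?E (?D G) x = G x * of_real k * ?E (?D \<Psi>) x + G x * of_real k * ?E \<Psi> x * (of_real k * ?D \<Psi> x)"
  proof -
    have "?E (?D G) x = ?E (\<lambda>y. G y * (of_real k * ?D \<Psi> y)) x"
      by (rule cderiv_transform[OF U xU]) (simp_all add: cG dd[OF xU])
    then show ?thesis by (simp add: cderiv_rules dd[OF xU] cG[OF xU])
  qed
  have D\<Phi>: "?D \<Phi> y = 2 * (A y * \<Phi> y) + w y * ?D wc y * X y + of_real N * (\<Phi> y * ?D G y)" if "y \<in> U" for y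
    unfolding \<Phi>_def[abs_def]
    by (simp add: cderiv_rules dd[OF that] Dw'[OF that] cX[OF that] algebra_simps)
  have E\<Phi>: "?E \<Phi> x = w x * wc x * X x * (of_real N * ?E G x) + (w x * (2 * (A x * wc x)) + ?E w x * wc x) * X x"
    unfolding \<Phi>_def[abs_def]
    by (simp add: cderiv_rules dd[OF xU] Ewc[OF xU] cX[OF xU] algebra_simps)
  have nz: "w x \<noteq> 0" "wc x \<noteq> 0" "X x \<noteq> 0" using x(2) by (auto simp: wc_def X_def)
  \<comment> \<open>criticality determines the derivatives of \<open>w\<close> and its conjugate that the equation leaves free\<close>
  have s1: "?D wc x = - (2 * A x + of_real N * ?D G x) * wc x"
  proof -
    have "(2 * A x * wc x + ?D wc x + of_real N * ?D G x * wc x) * (w x * X x) = 0"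
      using D\<Phi>[OF xU] crit(2) by (simp add: \<Phi>_def algebra_simps)
    then have "2 * A x * wc x + ?D wc x + of_real N * ?D G x * wc x = 0" using nz by simp
    then show ?thesis by (simp add: algebra_simps eq_neg_iff_add_eq_0)
  qed
  have s2: "?E w x = - (2 * A x + of_real N * ?E G x) * w x"
  proof -
    have "(2 * A x * w x + ?E w x + of_real N * ?E G x * w x) * (wc x * X x) = 0"
      using E\<Phi> crit(1) by (simp add: algebra_simps)
    then have "2 * A x * w x + ?E w x + of_real N * ?E G x * w x = 0" using nz by simp
    then show ?thesis by (simp add: algebra_simps eq_neg_iff_add_eq_0)
  qed
  have "?D (?E wc) x = ?D (\<lambda>y. 2 * (A y * wc y)) x"
    by (rule cderiv_transform[OF U xU]) (simp_all add: Ewc dd[OF xU])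
  then have DEwc: "?D (?E wc) x = 2 * (A x * ?D wc x + ?D A x * wc x)"
    by (simp add: cderiv_rules dd[OF xU])
  have s3: "?E (?D wc) x = 2 * (A x * ?D wc x + ?D A x * wc x) - A x * (2 * (A x * wc x) - ?D wc x)"
    using comm[OF wc xU] DEwc Ewc[OF xU] by (simp add: algebra_simps)
  have "?E (?D \<Phi>) x = ?E (\<lambda>y. 2 * (A y * \<Phi> y) + w y * ?D wc y * X y + of_real N * (\<Phi> y * ?D G y)) x"
    by (rule cderiv_transform[OF U xU]) (simp_all add: D\<Phi> dd[OF xU])
  also have "\<dots> = 2 * (?E A x * \<Phi> x) + (w x * ?D wc x * ?E X x + (w x * ?E (?D wc) x + ?E w x * ?D wc x) * X x)
      + of_real N * (\<Phi> x * ?E (?D G) x)"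
    by (simp add: cderiv_rules dd[OF xU] crit(1))
  also have "2 * (?E A x * \<Phi> x) + (w x * ?D wc x * ?E X x + (w x * ?E (?D wc) x + ?E w x * ?D wc x) * X x)
      + of_real N * (\<Phi> x * ?E (?D G) x)
      = \<Phi> x * (2 * ?E A x + 2 * ?D A x - 4 * (A x)\<^sup>2 + of_real N * (?E (?D G) x - A x * ?D G x))"
    unfolding s3 s1 s2 cX[OF xU] \<Phi>_def by (simp add: algebra_simps power2_eq_square)
  also have "\<dots> = \<Phi> x * (2 * ?E A x + 2 * ?D A x - 4 * (A x)\<^sup>2
      + of_real (N * k * g x) * (?E (?D \<Psi>) x - A x * ?D \<Psi> x + of_real k * (?D \<Psi> x * cnj (?D \<Psi> x))))"
    unfolding EDG cG[OF xU] E\<Psi>[OF xU] G_def by (simp add: algebra_simps)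
  finally have "?E (?D \<Phi>) x = \<Phi> x * (2 * ?E A x + 2 * ?D A x - 4 * (A x)\<^sup>2
      + of_real (N * k * g x) * (?E (?D \<Psi>) x - A x * ?D \<Psi> x + of_real (k * P x)))"
    by (simp add: P_def complex_norm_square[symmetric])
  note eq = this
  have "Re (?E (?D \<Phi>) x) = (cmod (w x))\<^sup>2 * exp (N * g x) * (F x + N * k * g x * (Q x + k * P x))"
  proof -
    have gen: "Re (of_real r * (z + of_real s * z')) = r * (Re z + s * Re z')" for r s z z'
      by simp
    have ReF: "Re (2 * ?E A x + 2 * ?D A x - 4 * (A x)\<^sup>2) = F x"
      by (simp add: F_def A_def power2_eq_square)
    have ReQ: "Re (?E (?D \<Psi>) x - A x * ?D \<Psi> x + of_real (k * P x)) = Q x + k * P x"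
      by (simp add: Q_def)
    have "\<Phi> x = of_real ((cmod (w x))\<^sup>2 * exp (N * g x))" by (simp only: \<Phi>_real)
    then show ?thesis by (simp only: eq gen ReF ReQ)
  qed
  moreover have "F x + N * k * g x * (Q x + k * P x) > 0"
  proof -
    have "k * P x \<ge> k * \<eta>" using \<rho>(4)[OF xc] k(1) by simp
    then have 1: "Q x + k * P x \<ge> 1" using k(2) B[OF xc] by linarith
    have "- M \<le> \<psi> x" using M[OF xc] by linarith
    then have "k * (- M) \<le> k * \<psi> x" using k(1) by (intro mult_left_mono) auto
    then have 2: "g x \<ge> g0" by (simp add: g_def g0_def)
    have "B' \<ge> 0" using B'[OF xc] by linarith
    then have "(B' + 1) / g0 \<ge> 0" using g0 by simp
    then have N0: "N \<ge> 0" "N * g0 \<ge> B' + 1"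
      using N g0 by (linarith, simp add: pos_divide_le_eq)
    have "N * g0 * 1 \<le> N * k * g x * (Q x + k * P x)"
    proof (rule mult_mono)
      have "N * g0 * 1 \<le> N * g x * k" using N0(1) 2 k(1) g0 by (intro mult_mono) auto
      then show "N * g0 \<le> N * k * g x" by (simp add: algebra_simps)
    qed (use 1 2 N0(1) k(1) g0 in auto)
    then show ?thesis using N0(2) B'[OF xc] by linarith
  qed
  ultimately have "Re (?E (?D \<Phi>) x) > 0" using x(2) by simp
  then show False using crit(3) by linarith
qed


section \<open>The structure equations in a chart\<close>

abbreviation e1 :: "real^2" where "e1 \<equiv> axis 1 1"
abbreviation e2 :: "real^2" where "e2 \<equiv> axis 2 1"

lemma vec2_expand: "v = v $ 1 *\<^sub>R e1 + v $ 2 *\<^sub>R e2" for v :: "real^2"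
  by (simp add: vec_eq_iff forall_2 axis_def)

lemma pd_expand:
  fixes W :: "real^2 \<Rightarrow> 'b::real_normed_vector"
  assumes "W differentiable (at y)"
  shows "pd v W y = v $ 1 *\<^sub>R pd e1 W y + v $ 2 *\<^sub>R pd e2 W y"
  using pd_add_dir[OF assms] pd_scaleR_dir[OF assms] by (metis vec2_expand)

lemma smooth_on_vec2:
  fixes f :: "'a::real_normed_vector \<Rightarrow> real^2"
  assumes "open U" "smooth_on U (\<lambda>y. f y $ 1)" "smooth_on U (\<lambda>y. f y $ 2)"
  shows "smooth_on U f"
proof -
  have "smooth_on U (\<lambda>y. f y $ 1 *\<^sub>R e1 + f y $ 2 *\<^sub>R e2)"
    by (intro smooth_intros assms)
  then show ?thesis by (rule smooth_on_cong[OF assms(1)]) (use vec2_expand in metis)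
qed

lemma smooth_on_pd_along:
  fixes W :: "real^2 \<Rightarrow> 'b::real_normed_vector"
  assumes U: "open U" and W: "smooth_on U W" and Y: "smooth_on U Y"
  shows "smooth_on U (\<lambda>y. pd (Y y) W y)"
  by (rule smooth_on_cong[OF U, of "\<lambda>y. Y y $ 1 *\<^sub>R pd e1 W y + Y y $ 2 *\<^sub>R pd e2 W y"])
     (intro smooth_intros U W Y, metis pd_expand smooth_on_differentiable[OF U W])

lemma pd_pd_along:
  fixes W :: "real^2 \<Rightarrow> 'b::real_normed_vector"
  assumes U: "open U" and W: "smooth_on U W" and Y: "smooth_on U Y" and x: "x \<in> U"
  shows "pd u (\<lambda>y. pd (Y y) W y) x = pd u (pd (Y x) W) x + pd (pd u Y x) W x"
proof -
  note d = smooth_on_differentiable[OF U _ x]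
  have ex: "pd (Z y) W y = Z y $ 1 *\<^sub>R pd e1 W y + Z y $ 2 *\<^sub>R pd e2 W y" if "y \<in> U" for Z y
    using pd_expand[OF smooth_on_differentiable[OF U W that]] .
  have gen: "pd u (\<lambda>y. pd (Z y) W y) x = Z x $ 1 *\<^sub>R pd u (pd e1 W) x + Z x $ 2 *\<^sub>R pd u (pd e2 W) x
      + pd (pd u Z x) W x" if Z: "smooth_on U Z" for Z :: "real^2 \<Rightarrow> real^2"
  proof -
    have "pd u (\<lambda>y. pd (Z y) W y) x = pd u (\<lambda>y. Z y $ 1 *\<^sub>R pd e1 W y + Z y $ 2 *\<^sub>R pd e2 W y) x"
      by (rule pd_transform[OF U x]) (auto simp: ex intro!: d smooth_intros U W Z)
    also have "\<dots> = pd u (\<lambda>y. Z y $ 1 *\<^sub>R pd e1 W y) x + pd u (\<lambda>y. Z y $ 2 *\<^sub>R pd e2 W y) x"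
      by (intro pd_add d smooth_intros U W Z)
    also have "pd u (\<lambda>y. Z y $ 1 *\<^sub>R pd e1 W y) x = Z x $ 1 *\<^sub>R pd u (pd e1 W) x + pd u Z x $ 1 *\<^sub>R pd e1 W x"
      by (subst pd_scaleR) (auto simp: pd_linear[OF bounded_linear_vec_nth] d Z intro!: d smooth_intros U W Z)
    also have "pd u (\<lambda>y. Z y $ 2 *\<^sub>R pd e2 W y) x = Z x $ 2 *\<^sub>R pd u (pd e2 W) x + pd u Z x $ 2 *\<^sub>R pd e2 W x"
      by (subst pd_scaleR) (auto simp: pd_linear[OF bounded_linear_vec_nth] d Z intro!: d smooth_intros U W Z)
    finally show ?thesis using pd_expand[OF d[OF W], of "pd u Z x"] by (simp add: algebra_simps)
  qed
  have "pd u (pd (Y x) W) x = Y x $ 1 *\<^sub>R pd u (pd e1 W) x + Y x $ 2 *\<^sub>R pd u (pd e2 W) x"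
    using gen[OF smooth_on_const, of "Y x"] pd_zero_dir[OF d[OF W]] by simp
  then show ?thesis using gen[OF Y] by simp
qed

text \<open>The second derivatives of \<open>W\<close> cancel, being symmetric.\<close>

lemma pd_bracket:
  fixes W :: "real^2 \<Rightarrow> 'b::euclidean_space"
  assumes U: "open U" and W: "smooth_on U W" and X: "smooth_on U X" and Y: "smooth_on U Y" and x: "x \<in> U"
  shows "pd (X x) (\<lambda>y. pd (Y y) W y) x - pd (Y x) (\<lambda>y. pd (X y) W y) x = pd (bracket X Y x) W x"
  using pd_pd_along[OF U W Y x, of "X x"] pd_pd_along[OF U W X x, of "Y x"]
    pd_commute[OF U W x, of "X x" "Y x"]
    linear_diff[OF linear_pd[OF smooth_on_differentiable[OF U W x]], of "pd (X x) Y x" "pd (Y x) X x"]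
  by (simp add: bracket_def dir_deriv_def pd_def)

lemma smooth_on_bracket:
  "open U \<Longrightarrow> smooth_on U X \<Longrightarrow> smooth_on U Y \<Longrightarrow> smooth_on U (bracket X Y)"
  using smooth_on_diff[of U "\<lambda>y. pd (X y) Y y" "\<lambda>y. pd (Y y) X y"] smooth_on_pd_along[of U Y X] smooth_on_pd_along[of U X Y]
  by (simp add: bracket_def[abs_def] dir_deriv_def pd_def)

lemma bilinear_expand:
  fixes b :: "real^2 \<Rightarrow> real^2 \<Rightarrow> 'b::real_vector"
  assumes "bilinear b"
  shows "b v w = (v$1 * w$1) *\<^sub>R b e1 e1 + (v$1 * w$2) *\<^sub>R b e1 e2 + (v$2 * w$1) *\<^sub>R b e2 e1 + (v$2 * w$2) *\<^sub>R b e2 e2"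
proof -
  have "b v w = b (v $ 1 *\<^sub>R e1 + v $ 2 *\<^sub>R e2) (w $ 1 *\<^sub>R e1 + w $ 2 *\<^sub>R e2)"
    by (metis vec2_expand)
  also have "\<dots> = (v$1 * w$1) *\<^sub>R b e1 e1 + (v$1 * w$2) *\<^sub>R b e1 e2 + (v$2 * w$1) *\<^sub>R b e2 e1 + (v$2 * w$2) *\<^sub>R b e2 e2"
    by (simp add: bilinear_ladd[OF assms] bilinear_radd[OF assms] bilinear_lmul[OF assms] bilinear_rmul[OF assms] algebra_simps)
  finally show ?thesis .
qed

lemma smooth_on_bilinear_field:
  fixes b :: "real^2 \<Rightarrow> real^2 \<Rightarrow> real^2 \<Rightarrow> real"
  assumes U: "open U" and b: "\<And>y. y \<in> U \<Longrightarrow> bilinear (b y)" and s: "\<And>v w. smooth_on U (\<lambda>y. b y v w)"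
    and Y: "smooth_on U Y" and Z: "smooth_on U Z"
  shows "smooth_on U (\<lambda>y. b y (Y y) (Z y))"
proof -
  have "smooth_on U (\<lambda>y. (Y y$1 * Z y$1) *\<^sub>R b y e1 e1 + (Y y$1 * Z y$2) *\<^sub>R b y e1 e2
      + (Y y$2 * Z y$1) *\<^sub>R b y e2 e1 + (Y y$2 * Z y$2) *\<^sub>R b y e2 e2)"
    by (intro smooth_intros U s Y Z)
  then show ?thesis by (rule smooth_on_cong[OF U]) (rule bilinear_expand[OF b, symmetric])
qed

lemma pd_bilinear_field:
  fixes b :: "real^2 \<Rightarrow> real^2 \<Rightarrow> real^2 \<Rightarrow> real"
  assumes U: "open U" and b: "\<And>y. y \<in> U \<Longrightarrow> bilinear (b y)" and s: "\<And>v w. smooth_on U (\<lambda>y. b y v w)"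
    and Y: "smooth_on U Y" and Z: "smooth_on U Z" and x: "x \<in> U"
  shows "pd u (\<lambda>y. b y (Y y) (Z y)) x
    = pd u (\<lambda>y. b y (Y x) (Z x)) x + b x (pd u Y x) (Z x) + b x (Y x) (pd u Z x)"
proof -
  note d = smooth_on_differentiable[OF U _ x]
  have nth: "pd u (\<lambda>y. Y y $ i) x = pd u Y x $ i" if "smooth_on U Y" for Y :: "real^2 \<Rightarrow> real^2" and i
    by (rule pd_linear[OF bounded_linear_vec_nth d[OF that]])
  have one: "pd u (\<lambda>y. (Y y$i * Z y$j) *\<^sub>R b y v w) x
      = (Y x$i * Z x$j) * pd u (\<lambda>y. b y v w) x + (pd u Y x$i * Z x$j + Y x$i * pd u Z x$j) * b x v w"
    if Y: "smooth_on U Y" and Z: "smooth_on U Z" for i j v w and Y Z :: "real^2 \<Rightarrow> real^2"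
  proof -
    have "pd u (\<lambda>y. (Y y$i * Z y$j) *\<^sub>R b y v w) x
        = (Y x$i * Z x$j) *\<^sub>R pd u (\<lambda>y. b y v w) x + pd u (\<lambda>y. Y y$i * Z y$j) x *\<^sub>R b x v w"
      by (intro pd_scaleR d smooth_intros U s Y Z)
    also have "pd u (\<lambda>y. Y y$i * Z y$j) x = Y x$i * pd u Z x$j + pd u Y x$i * Z x$j"
      by (subst pd_mult) (auto simp: nth Y Z intro!: d smooth_intros U Y Z)
    finally show ?thesis by (simp add: algebra_simps)
  qed
  have gen: "pd u (\<lambda>y. b y (Y y) (Z y)) x =
      (Y x$1 * Z x$1) * pd u (\<lambda>y. b y e1 e1) x + (Y x$1 * Z x$2) * pd u (\<lambda>y. b y e1 e2) x
      + (Y x$2 * Z x$1) * pd u (\<lambda>y. b y e2 e1) x + (Y x$2 * Z x$2) * pd u (\<lambda>y. b y e2 e2) x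
      + b x (pd u Y x) (Z x) + b x (Y x) (pd u Z x)"
    if Y: "smooth_on U Y" and Z: "smooth_on U Z" for Y Z :: "real^2 \<Rightarrow> real^2"
  proof -
    have dd: "(\<lambda>y. (Y y$i * Z y$j) *\<^sub>R b y v w) differentiable (at x)" for i j v w
      by (intro d smooth_intros U s Y Z)
    have "pd u (\<lambda>y. b y (Y y) (Z y)) x = pd u (\<lambda>y. ((Y y$1 * Z y$1) *\<^sub>R b y e1 e1 + (Y y$1 * Z y$2) *\<^sub>R b y e1 e2
      + (Y y$2 * Z y$1) *\<^sub>R b y e2 e1) + (Y y$2 * Z y$2) *\<^sub>R b y e2 e2) x"
      by (rule pd_transform[OF U x]) (auto simp: bilinear_expand[OF b, of _ "Y _" "Z _"] intro!: d smooth_intros U s Y Z)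
    also have "\<dots> = pd u (\<lambda>y. (Y y$1 * Z y$1) *\<^sub>R b y e1 e1) x + pd u (\<lambda>y. (Y y$1 * Z y$2) *\<^sub>R b y e1 e2) x
      + pd u (\<lambda>y. (Y y$2 * Z y$1) *\<^sub>R b y e2 e1) x + pd u (\<lambda>y. (Y y$2 * Z y$2) *\<^sub>R b y e2 e2) x"
      by (simp only: pd_add differentiable_add dd)
    also have "\<dots> = (Y x$1 * Z x$1) * pd u (\<lambda>y. b y e1 e1) x + (Y x$1 * Z x$2) * pd u (\<lambda>y. b y e1 e2) x
      + (Y x$2 * Z x$1) * pd u (\<lambda>y. b y e2 e1) x + (Y x$2 * Z x$2) * pd u (\<lambda>y. b y e2 e2) x
      + b x (pd u Y x) (Z x) + b x (Y x) (pd u Z x)"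
      unfolding one[OF Y Z] bilinear_expand[OF b[OF x], of "pd u Y x"] bilinear_expand[OF b[OF x], of _ "pd u Z x"]
      by (simp add: algebra_simps)
    finally show ?thesis .
  qed
  show ?thesis
    using gen[OF Y Z] gen[OF smooth_on_const smooth_on_const, of "Y x" "Z x"]
      bilinear_lzero[OF b[OF x]] bilinear_rzero[OF b[OF x]] by simp
qed

lemma trace_matrix_2: "trace (matrix f) = f e1 $ 1 + f e2 $ 2" for f :: "real^2 \<Rightarrow> real^2"
  by (simp add: trace_def sum_2 matrix_def)

lemma det_matrix_2: "det (matrix f) = f e1 $ 1 * f e2 $ 2 - f e2 $ 1 * f e1 $ 2" for f :: "real^2 \<Rightarrow> real^2"
  by (simp add: det_2 matrix_def)

text \<open>The data of the theorem in one chart: the coordinate expressions \<open>F\<close>, \<open>\<xi>\<close> of the immersion and of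
  the affine normal, and the formulas of Gauss and Weingarten for vector fields on \<open>U\<close>.\<close>

locale blaschke_chart =
  fixes U :: "(real^2) set" and F \<xi> :: "real^2 \<Rightarrow> real^3"
    and nabla :: connection and h :: metric and S :: endo_field and \<tau> :: real
  assumes U: "open U"
    and F: "smooth_on U F" and \<xi>: "smooth_on U \<xi>"
    and immersed: "x \<in> U \<Longrightarrow> inj (\<lambda>v. pd v F x)"
    and transversal: "x \<in> U \<Longrightarrow> \<xi> x \<notin> range (\<lambda>v. pd v F x)"
    and h_bilinear: "x \<in> U \<Longrightarrow> bilinear (h x)"
    and S_linear: "x \<in> U \<Longrightarrow> linear (S x)"
    and gauss: "smooth_on U X \<Longrightarrow> smooth_on U Y \<Longrightarrow> x \<in> U \<Longrightarrow>
      pd (X x) (\<lambda>y. pd (Y y) F y) x = pd (nabla X Y x) F x + h x (X x) (Y x) *\<^sub>R \<xi> x"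
    and weingarten: "x \<in> U \<Longrightarrow> pd v \<xi> x = - pd (S x v) F x"
    and nondeg: "x \<in> U \<Longrightarrow> v \<noteq> 0 \<Longrightarrow> \<exists>w. h x v w \<noteq> 0"
    and apolarity: "apolar U nabla h"
    and proj_flat: "projectively_flat U nabla"
    and det_S: "x \<in> U \<Longrightarrow> det (matrix (S x)) = \<tau>"
    and C_diag: "x \<in> U \<Longrightarrow> C_diagonalizable (S x)"
begin

lemmas diff = smooth_on_differentiable[OF U]

lemma linear_push: "x \<in> U \<Longrightarrow> linear (\<lambda>v. pd v F x)"
  using linear_pd[OF diff[OF F]] .

lemmas push_simps = linear_add[OF linear_push] linear_cmul[OF linear_push] linear_diff[OF linear_push]
  linear_neg[OF linear_push] linear_0[OF linear_push]

lemma frame_unique: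
  assumes x: "x \<in> U" and eq: "pd u F x + a *\<^sub>R \<xi> x = pd v F x + b *\<^sub>R \<xi> x"
  shows "u = v \<and> a = b"
proof -
  have d: "pd (u - v) F x = (b - a) *\<^sub>R \<xi> x"
    using eq by (simp add: push_simps[OF x] algebra_simps)
  have "a = b"
  proof (rule ccontr)
    assume "a \<noteq> b"
    then have "pd ((1 / (b - a)) *\<^sub>R (u - v)) F x = \<xi> x"
      using d by (simp only: push_simps(2)[OF x]) simp
    then show False using transversal[OF x] by (metis rangeI)
  qed
  then show ?thesis using eq immersed[OF x] by (auto dest: injD)
qed

lemma frame_unique0: "x \<in> U \<Longrightarrow> pd u F x + a *\<^sub>R \<xi> x = 0 \<Longrightarrow> u = 0 \<and> a = 0"
  using frame_unique[of x u a 0 0] by (simp add: push_simps)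

lemma frame_det: 
  assumes x: "x \<in> U"
  shows "pd e1 F x \<bullet> cross3 (pd e2 F x) (\<xi> x) \<noteq> 0"
proof -
  define f where "f v = v $ 1 *\<^sub>R pd e1 F x + v $ 2 *\<^sub>R pd e2 F x + v $ 3 *\<^sub>R \<xi> x" for v :: "real^3"
  have lf: "linear f" unfolding f_def by (rule linearI) (auto simp: algebra_simps)
  have "inj f"
  proof (rule linear_injective_0[OF lf, THEN iffD2], intro allI impI)
    fix v assume "f v = 0"
    define u where "u = v $ 1 *\<^sub>R e1 + v $ 2 *\<^sub>R e2"
    have "pd u F x + v $ 3 *\<^sub>R \<xi> x = 0" using \<open>f v = 0\<close> unfolding u_def f_def by (simp add: push_simps[OF x])
    then have "u = 0" "v $ 3 = 0" using frame_unique0[OF x] by auto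
    then show "v = 0" unfolding u_def by (simp add: vec_eq_iff forall_2 forall_3 axis_def)
  qed
  then have "det (matrix f) \<noteq> 0" using det_nz_iff_inj[OF lf] by blast
  moreover have "det (matrix f) = pd e1 F x \<bullet> cross3 (pd e2 F x) (\<xi> x)"
    by (simp add: matrix_def f_def det_3 cross3_simps axis_def)
  ultimately show ?thesis by simp
qed

text \<open>Cramer's rule for the frame \<open>F\<^sub>1, F\<^sub>2, \<xi>\<close>. It expresses the induced objects through derivatives of
  \<open>F\<close> and \<open>\<xi>\<close> and is the source of their smoothness.\<close>

lemma frame_coefficients:
  assumes x: "x \<in> U" and V: "V = pd a F x + c *\<^sub>R \<xi> x"
  defines "\<delta> \<equiv> pd e1 F x \<bullet> cross3 (pd e2 F x) (\<xi> x)"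
  shows "a $ 1 = (V \<bullet> cross3 (pd e2 F x) (\<xi> x)) / \<delta>" "a $ 2 = (V \<bullet> cross3 (\<xi> x) (pd e1 F x)) / \<delta>"
    "c = (V \<bullet> cross3 (pd e1 F x) (pd e2 F x)) / \<delta>"
proof -
  have \<delta>: "\<delta> \<noteq> 0" unfolding \<delta>_def using frame_det[OF x] .
  have V': "V = a $ 1 *\<^sub>R pd e1 F x + a $ 2 *\<^sub>R pd e2 F x + c *\<^sub>R \<xi> x"
    unfolding V using pd_expand[OF diff[OF F x]] by metis
  have rot: "pd e2 F x \<bullet> cross3 (\<xi> x) (pd e1 F x) = \<delta>" "\<xi> x \<bullet> cross3 (pd e1 F x) (pd e2 F x) = \<delta>"
    unfolding \<delta>_def by (simp_all add: cross3_simps)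
  show "a $ 1 = (V \<bullet> cross3 (pd e2 F x) (\<xi> x)) / \<delta>" "a $ 2 = (V \<bullet> cross3 (\<xi> x) (pd e1 F x)) / \<delta>"
    "c = (V \<bullet> cross3 (pd e1 F x) (pd e2 F x)) / \<delta>"
    using \<delta> rot by (simp_all add: V' inner_add_left dot_cross_self \<delta>_def)
qed

lemma smooth_on_frame_coefficients:
  assumes V: "smooth_on U V" and eq: "\<And>y. y \<in> U \<Longrightarrow> V y = pd (a y) F y + c y *\<^sub>R \<xi> y"
  shows "smooth_on U a" "smooth_on U c"
proof -
  define \<delta> where "\<delta> x = pd e1 F x \<bullet> cross3 (pd e2 F x) (\<xi> x)" for x
  have cr: "bounded_bilinear cross3" using bilinear_conv_bounded_bilinear bilinear_cross by blast
  note cross = smooth_on_bilinear[OF U cr]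
  have \<delta>: "smooth_on U \<delta>" unfolding \<delta>_def by (intro smooth_on_inner cross smooth_intros U F \<xi>)
  have \<delta>0: "\<delta> x \<noteq> 0" if "x \<in> U" for x unfolding \<delta>_def using frame_det[OF that] .
  note co = frame_coefficients[OF _ eq]
  have 1: "smooth_on U (\<lambda>y. a y $ 1)"
    by (rule smooth_on_cong[OF U, of "\<lambda>x. (V x \<bullet> cross3 (pd e2 F x) (\<xi> x)) / \<delta> x"])
       (auto simp: co(1) \<delta>0 \<delta>_def[symmetric] intro!: smooth_on_divide smooth_on_inner cross smooth_on_pd U F \<xi> V \<delta>)
  have 2: "smooth_on U (\<lambda>y. a y $ 2)"
    by (rule smooth_on_cong[OF U, of "\<lambda>x. (V x \<bullet> cross3 (\<xi> x) (pd e1 F x)) / \<delta> x"])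
       (auto simp: co(2) \<delta>0 \<delta>_def[symmetric] intro!: smooth_on_divide smooth_on_inner cross smooth_on_pd U F \<xi> V \<delta>)
  show "smooth_on U a" by (rule smooth_on_vec2[OF U 1 2])
  show "smooth_on U c"
    by (rule smooth_on_cong[OF U, of "\<lambda>x. (V x \<bullet> cross3 (pd e1 F x) (pd e2 F x)) / \<delta> x"])
       (auto simp: co(3) \<delta>0 \<delta>_def[symmetric] intro!: smooth_on_divide smooth_on_inner cross smooth_on_pd U F \<xi> V \<delta>)
qed

lemma smooth_nabla:
  assumes X: "smooth_on U X" and Y: "smooth_on U Y"
  shows "smooth_on U (nabla X Y)" "smooth_on U (\<lambda>y. h y (X y) (Y y))"
proof -
  have "smooth_on U (\<lambda>x. pd (X x) (\<lambda>y. pd (Y y) F y) x)"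
    by (intro smooth_on_pd_along U F X Y)
  then show "smooth_on U (nabla X Y)" "smooth_on U (\<lambda>y. h y (X y) (Y y))"
    by (rule smooth_on_frame_coefficients, use gauss[OF X Y] in blast)+
qed

lemma smooth_h: "smooth_on U (\<lambda>y. h y v w)"
  using smooth_nabla(2)[OF smooth_on_const smooth_on_const] .

lemma smooth_S:
  assumes Y: "smooth_on U Y"
  shows "smooth_on U (\<lambda>y. S y (Y y))"
proof (rule smooth_on_frame_coefficients(1)[where c = "\<lambda>_. 0"])
  show "smooth_on U (\<lambda>y. - pd (Y y) \<xi> y)"
    by (intro smooth_on_minus smooth_on_pd_along U \<xi> Y)
  show "- pd (Y y) \<xi> y = pd (S y (Y y)) F y + 0 *\<^sub>R \<xi> y" if "y \<in> U" for y
    using weingarten[OF that] by simp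
qed

text \<open>The Christoffel symbols, as a bilinear map.\<close>

definition \<Gamma> :: "real^2 \<Rightarrow> real^2 \<Rightarrow> real^2 \<Rightarrow> real^2" where
  "\<Gamma> x u v = nabla (\<lambda>_. u) (\<lambda>_. v) x"

lemma smooth_\<Gamma>: "smooth_on U (\<lambda>y. \<Gamma> y u v)"
  unfolding \<Gamma>_def using smooth_nabla(1)[OF smooth_on_const smooth_on_const] .

lemma gauss_const: "x \<in> U \<Longrightarrow> pd u (pd v F) x = pd (\<Gamma> x u v) F x + h x u v *\<^sub>R \<xi> x"
  using gauss[OF smooth_on_const smooth_on_const, of x u v] by (simp add: \<Gamma>_def)

lemma nabla_eq:
  assumes X: "smooth_on U X" and Y: "smooth_on U Y" and x: "x \<in> U"
  shows "nabla X Y x = pd (X x) Y x + \<Gamma> x (X x) (Y x)"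
proof -
  have "pd (pd (X x) Y x + \<Gamma> x (X x) (Y x)) F x + h x (X x) (Y x) *\<^sub>R \<xi> x
      = pd (nabla X Y x) F x + h x (X x) (Y x) *\<^sub>R \<xi> x"
    using gauss[OF X Y x] pd_pd_along[OF U F Y x, of "X x"] gauss_const[OF x, of "X x" "Y x"]
    by (simp add: push_simps[OF x] add.commute)
  then show ?thesis using frame_unique[OF x] by metis
qed

lemma h_sym: "x \<in> U \<Longrightarrow> h x u v = h x v u" and \<Gamma>_sym: "x \<in> U \<Longrightarrow> \<Gamma> x u v = \<Gamma> x v u"
  using pd_commute[OF U F, of x u v] gauss_const[of x u v] gauss_const[of x v u] frame_unique by metis+

lemma \<Gamma>_linear: "x \<in> U \<Longrightarrow> linear (\<lambda>u. \<Gamma> x u v)"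
proof (rule linearI)
  assume x: "x \<in> U"
  note d = diff[OF smooth_on_pd[OF F] x]
  show "\<Gamma> x (u + u') v = \<Gamma> x u v + \<Gamma> x u' v" for u u'
  proof -
    have "pd (\<Gamma> x (u + u') v) F x + h x (u + u') v *\<^sub>R \<xi> x
        = pd (\<Gamma> x u v + \<Gamma> x u' v) F x + (h x u v + h x u' v) *\<^sub>R \<xi> x"
      using pd_add_dir[OF d, of u u' v] unfolding gauss_const[OF x] by (simp add: push_simps[OF x] algebra_simps)
    then show ?thesis using frame_unique[OF x] by blast
  qed
  show "\<Gamma> x (r *\<^sub>R u) v = r *\<^sub>R \<Gamma> x u v" for r u
  proof -
    have "pd (\<Gamma> x (r *\<^sub>R u) v) F x + h x (r *\<^sub>R u) v *\<^sub>R \<xi> x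
        = pd (r *\<^sub>R \<Gamma> x u v) F x + (r * h x u v) *\<^sub>R \<xi> x"
      using pd_scaleR_dir[OF d, of r u v] unfolding gauss_const[OF x] by (simp add: push_simps[OF x] algebra_simps)
    then show ?thesis using frame_unique[OF x] by blast
  qed
qed

lemma \<Gamma>_bilinear: "x \<in> U \<Longrightarrow> bilinear (\<Gamma> x)"
  unfolding bilinear_def using \<Gamma>_linear[of x] \<Gamma>_sym[of x] by (simp add: eta_contract_eq)

text \<open>Both equations are components of the commutation of second derivatives of \<open>f\<^sub>* Z\<close>: the tangential
  part is the Gauss equation, the \<open>\<xi>\<close>-part the Codazzi equation for \<open>h\<close>.\<close>

lemma gauss_codazzi:
  assumes X: "smooth_on U X" and Y: "smooth_on U Y" and Z: "smooth_on U Z" and x: "x \<in> U"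
  shows "curvature nabla X Y Z x = h x (Y x) (Z x) *\<^sub>R S x (X x) - h x (X x) (Z x) *\<^sub>R S x (Y x)"
    and "pd (X x) (\<lambda>y. h y (Y y) (Z y)) x + h x (X x) (nabla Y Z x)
      - pd (Y x) (\<lambda>y. h y (X y) (Z y)) x - h x (Y x) (nabla X Z x) = h x (bracket X Y x) (Z x)"
proof -
  note d = smooth_on_differentiable[OF U _ x]
  define V where "V y = pd (Z y) F y" for y
  have V: "smooth_on U V" unfolding V_def by (intro smooth_on_pd_along U F Z)
  have one: "pd (X x) (\<lambda>y. pd (Y y) V y) x
      = pd (nabla X (nabla Y Z) x - h x (Y x) (Z x) *\<^sub>R S x (X x)) F x
        + (pd (X x) (\<lambda>y. h y (Y y) (Z y)) x + h x (X x) (nabla Y Z x)) *\<^sub>R \<xi> x"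
    if X: "smooth_on U X" and Y: "smooth_on U Y" for X Y
  proof -
    note N = smooth_nabla[OF Y Z]
    have "pd (X x) (\<lambda>y. pd (Y y) V y) x
        = pd (X x) (\<lambda>y. pd (nabla Y Z y) F y + h y (Y y) (Z y) *\<^sub>R \<xi> y) x"
      by (rule pd_transform[OF U x])
         (auto simp: gauss[OF Y Z, folded V_def] intro!: d smooth_on_add smooth_on_scaleR smooth_on_pd_along U F \<xi> N)
    also have "\<dots> = pd (X x) (\<lambda>y. pd (nabla Y Z y) F y) x + pd (X x) (\<lambda>y. h y (Y y) (Z y) *\<^sub>R \<xi> y) x"
      by (intro pd_add d smooth_on_scaleR smooth_on_pd_along U F \<xi> N)
    also have "pd (X x) (\<lambda>y. h y (Y y) (Z y) *\<^sub>R \<xi> y) x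
        = h x (Y x) (Z x) *\<^sub>R pd (X x) \<xi> x + pd (X x) (\<lambda>y. h y (Y y) (Z y)) x *\<^sub>R \<xi> x"
      by (intro pd_scaleR d \<xi> N)
    finally show ?thesis
      using gauss[OF X N(1) x] weingarten[OF x, of "X x"] by (simp add: push_simps[OF x] algebra_simps)
  qed
  have B: "smooth_on U (bracket X Y)" by (rule smooth_on_bracket[OF U X Y])
  have "pd (bracket X Y x) V x = pd (nabla (bracket X Y) Z x) F x + h x (bracket X Y x) (Z x) *\<^sub>R \<xi> x"
    using gauss[OF B Z x] by (simp add: V_def[abs_def])
  then have "pd (nabla X (nabla Y Z) x - h x (Y x) (Z x) *\<^sub>R S x (X x)
        - (nabla Y (nabla X Z) x - h x (X x) (Z x) *\<^sub>R S x (Y x))) F x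
      + (pd (X x) (\<lambda>y. h y (Y y) (Z y)) x + h x (X x) (nabla Y Z x)
        - (pd (Y x) (\<lambda>y. h y (X y) (Z y)) x + h x (Y x) (nabla X Z x))) *\<^sub>R \<xi> x
      = pd (nabla (bracket X Y) Z x) F x + h x (bracket X Y x) (Z x) *\<^sub>R \<xi> x"
    using pd_bracket[OF U V X Y x] one[OF X Y] one[OF Y X]
    by (simp add: push_simps[OF x] algebra_simps)
  from frame_unique[OF x this]
  show "curvature nabla X Y Z x = h x (Y x) (Z x) *\<^sub>R S x (X x) - h x (X x) (Z x) *\<^sub>R S x (Y x)"
    and "pd (X x) (\<lambda>y. h y (Y y) (Z y)) x + h x (X x) (nabla Y Z x)
      - pd (Y x) (\<lambda>y. h y (X y) (Z y)) x - h x (Y x) (nabla X Z x) = h x (bracket X Y x) (Z x)"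
    by (auto simp: curvature_def algebra_simps)
qed

text \<open>The cubic form \<open>\<nabla>h\<close>.\<close>

definition C :: "real^2 \<Rightarrow> real^2 \<Rightarrow> real^2 \<Rightarrow> real^2 \<Rightarrow> real" where
  "C x u v w = pd u (\<lambda>y. h y v w) x - h x (\<Gamma> x u v) w - h x v (\<Gamma> x u w)"

lemma bracket_const [simp]: "bracket (\<lambda>_. u) (\<lambda>_. v) x = 0"
  by (simp add: bracket_def dir_deriv_def pd_def[symmetric])

lemma C_swap12: "x \<in> U \<Longrightarrow> C x u v w = C x v u w"
  using gauss_codazzi(2)[OF smooth_on_const smooth_on_const smooth_on_const, of x u v w]
    h_sym[of x] \<Gamma>_sym[of x u v] bilinear_lzero[OF h_bilinear]
  by (simp add: C_def \<Gamma>_def[symmetric])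

lemma C_swap23: "x \<in> U \<Longrightarrow> C x u v w = C x u w v"
proof -
  assume x: "x \<in> U"
  have "pd u (\<lambda>y. h y w v) x = pd u (\<lambda>y. h y v w) x"
    by (rule pd_transform[OF U x diff[OF smooth_h x]]) (rule h_sym)
  then show ?thesis using h_sym[OF x] by (simp add: C_def)
qed

text \<open>The covariant derivative \<open>(\<nabla>\<^sub>u S) v\<close>.\<close>

definition N :: "real^2 \<Rightarrow> real^2 \<Rightarrow> real^2 \<Rightarrow> real^2" where
  "N x u v = pd u (\<lambda>y. S y v) x + \<Gamma> x u (S x v) - S x (\<Gamma> x u v)"

text \<open>The same commutation as in \<open>gauss_codazzi\<close>, applied to \<open>\<xi>\<close>: the \<open>\<xi>\<close>-part is the Ricci equation.\<close>

lemma S_codazzi: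
  assumes x: "x \<in> U"
  shows "N x u v = N x v u" and "h x (S x u) v = h x u (S x v)"
proof -
  have one: "pd u (pd v \<xi>) x = - (pd (pd u (\<lambda>y. S y v) x + \<Gamma> x u (S x v)) F x + h x u (S x v) *\<^sub>R \<xi> x)" for u v
  proof -
    note sS = smooth_S[OF smooth_on_const, of v]
    have "pd u (pd v \<xi>) x = pd u (\<lambda>y. - pd (S y v) F y) x"
      by (rule pd_transform[OF U x]) (auto simp: weingarten intro!: diff[OF _ x] smooth_on_minus smooth_on_pd_along U F sS)
    also have "\<dots> = - pd u (\<lambda>y. pd (S y v) F y) x"
      by (intro pd_minus diff[OF _ x] smooth_on_pd_along U F sS)
    finally show ?thesis
      using gauss[OF smooth_on_const sS x, of u] nabla_eq[OF smooth_on_const sS x, of u] by simp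
  qed
  have "pd (pd u (\<lambda>y. S y v) x + \<Gamma> x u (S x v)) F x + h x u (S x v) *\<^sub>R \<xi> x
      = pd (pd v (\<lambda>y. S y u) x + \<Gamma> x v (S x u)) F x + h x v (S x u) *\<^sub>R \<xi> x"
    using pd_commute[OF U \<xi> x, of u v] unfolding one by (simp only: neg_equal_iff_equal)
  from frame_unique[OF x this]
  show "N x u v = N x v u" and "h x (S x u) v = h x u (S x v)"
    using \<Gamma>_sym[OF x, of u v] h_sym[OF x] by (auto simp: N_def)
qed

definition tr :: "real^2 \<Rightarrow> real" where
  "tr x = S x e1 $ 1 + S x e2 $ 2"

text \<open>By the Gauss equation this is the value of \<open>\<gamma>\<close> at \<open>x\<close>; see \<open>gamma_eq\<close>.\<close>

definition gm :: "real^2 \<Rightarrow> real^2 \<Rightarrow> real^2 \<Rightarrow> real" where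
  "gm x v w = tr x * h x v w - h x (S x v) w"

lemma smooth_tr: "smooth_on U tr"
  unfolding tr_def by (intro smooth_intros smooth_S U)

lemma smooth_gm: "smooth_on U (\<lambda>y. gm y v w)"
  unfolding gm_def
  by (intro smooth_intros U smooth_tr smooth_h smooth_on_bilinear_field[OF U h_bilinear smooth_h] smooth_S)

lemma gm_bilinear:
  assumes x: "x \<in> U" shows "bilinear (gm x)"
  unfolding bilinear_def gm_def
  by (auto intro!: linearI simp: bilinear_ladd[OF h_bilinear[OF x]] bilinear_radd[OF h_bilinear[OF x]]
      bilinear_lmul[OF h_bilinear[OF x]] bilinear_rmul[OF h_bilinear[OF x]]
      linear_add[OF S_linear[OF x]] linear_cmul[OF S_linear[OF x]] algebra_simps)

lemma gm_sym: "x \<in> U \<Longrightarrow> gm x v w = gm x w v"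
  using S_codazzi(2)[of x v w] h_sym[of x v w] h_sym[of x v "S x w"] by (simp add: gm_def)

lemma gamma_eq:
  assumes Y: "smooth_on U Y" and Z: "smooth_on U Z" and x: "x \<in> U"
  shows "gamma nabla Y Z x = gm x (Y x) (Z x)"
proof -
  have "h x (S x (Y x)) (Z x) = S x (Y x) $ 1 * h x e1 (Z x) + S x (Y x) $ 2 * h x e2 (Z x)"
    using linear_add[of "\<lambda>v. h x v (Z x)"] linear_cmul[of "\<lambda>v. h x v (Z x)"] h_bilinear[OF x]
      vec2_expand[of "S x (Y x)"] unfolding bilinear_def by (metis real_scaleR_def)
  then show ?thesis
    by (simp add: gamma_def gauss_codazzi(1)[OF smooth_on_const Y Z x] trace_matrix_2 gm_def tr_def algebra_simps)
qed

text \<open>The covariant derivative \<open>\<nabla>\<gamma>\<close>.\<close>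

definition G :: "real^2 \<Rightarrow> real^2 \<Rightarrow> real^2 \<Rightarrow> real^2 \<Rightarrow> real" where
  "G x u v w = pd u (\<lambda>y. gm y v w) x - gm x (\<Gamma> x u v) w - gm x v (\<Gamma> x u w)"

lemma cov_gamma_eq:
  assumes X: "smooth_on U X" and Y: "smooth_on U Y" and Z: "smooth_on U Z" and x: "x \<in> U"
  shows "cov_gamma nabla X Y Z x = G x (X x) (Y x) (Z x)"
proof -
  have "dir_deriv X (gamma nabla Y Z) x = pd (X x) (gamma nabla Y Z) x"
    by (simp add: dir_deriv_def pd_def)
  also have "\<dots> = pd (X x) (\<lambda>y. gm y (Y y) (Z y)) x"
    by (rule pd_transform[OF U x])
       (auto simp: gamma_eq[OF Y Z] intro!: diff[OF _ x] smooth_on_bilinear_field[OF U gm_bilinear smooth_gm] Y Z)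
  also have "\<dots> = pd (X x) (\<lambda>y. gm y (Y x) (Z x)) x + gm x (pd (X x) Y x) (Z x) + gm x (Y x) (pd (X x) Z x)"
    by (rule pd_bilinear_field[OF U gm_bilinear smooth_gm Y Z x])
  finally show ?thesis
    unfolding cov_gamma_def gamma_eq[OF smooth_nabla(1)[OF X Y] Z x] gamma_eq[OF Y smooth_nabla(1)[OF X Z] x]
      nabla_eq[OF X Y x] nabla_eq[OF X Z x] G_def
    by (simp add: bilinear_ladd[OF gm_bilinear[OF x]] bilinear_radd[OF gm_bilinear[OF x]])
qed

lemma G_swap12: "x \<in> U \<Longrightarrow> G x u v w = G x v u w"
  using proj_flat cov_gamma_eq[OF smooth_on_const smooth_on_const smooth_on_const]
  unfolding projectively_flat_def vfields_def
  by (metis (mono_tags, lifting) mem_Collect_eq smooth_on_const)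

lemma G_swap23: "x \<in> U \<Longrightarrow> G x u v w = G x u w v"
proof -
  assume x: "x \<in> U"
  have "pd u (\<lambda>y. gm y w v) x = pd u (\<lambda>y. gm y v w) x"
    by (rule pd_transform[OF U x diff[OF smooth_gm x]]) (rule gm_sym)
  then show ?thesis using gm_sym[OF x] by (simp add: G_def)
qed

lemma smooth_G: "smooth_on U (\<lambda>y. G y u v w)"
  unfolding G_def
  by (intro smooth_intros U smooth_on_pd[OF smooth_gm] smooth_on_bilinear_field[OF U gm_bilinear smooth_gm] smooth_\<Gamma>)

text \<open>Projective flatness expresses \<open>R\<close> through \<open>\<gamma>\<close> and the identity alone, so \<open>R\<close> is parallel with \<open>\<gamma>\<close>.\<close>

lemma parallel_curvature_if:
  assumes G0: "\<And>x u v w. x \<in> U \<Longrightarrow> G x u v w = 0"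
  shows "parallel_curvature U nabla"
  unfolding parallel_curvature_def
proof (intro ballI)
  fix W X Y Z x assume "W \<in> vfields U" "X \<in> vfields U" "Y \<in> vfields U" "Z \<in> vfields U" and x: "x \<in> U"
  then have W: "smooth_on U W" and X: "smooth_on U X" and Y: "smooth_on U Y" and Z: "smooth_on U Z"
    by (auto simp: vfields_def)
  have R: "curvature nabla X Y Z y = gm y (Y y) (Z y) *\<^sub>R X y - gm y (X y) (Z y) *\<^sub>R Y y"
    if "smooth_on U X" "smooth_on U Y" "smooth_on U Z" "y \<in> U" for X Y Z y
    using proj_flat that gamma_eq by (simp add: projectively_flat_def vfields_def)
  note sg = smooth_on_bilinear_field[OF U gm_bilinear smooth_gm]
  have sR: "smooth_on U (\<lambda>y. gm y (Y y) (Z y) *\<^sub>R X y - gm y (X y) (Z y) *\<^sub>R Y y)"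
    by (intro smooth_intros sg U X Y Z)
  have sR': "smooth_on U (curvature nabla X Y Z)"
    by (rule smooth_on_cong[OF U sR]) (simp add: R[OF X Y Z])
  have "pd (W x) (curvature nabla X Y Z) x
      = pd (W x) (\<lambda>y. gm y (Y y) (Z y) *\<^sub>R X y - gm y (X y) (Z y) *\<^sub>R Y y) x"
    by (rule pd_transform[OF U x]) (auto simp: R[OF X Y Z] intro!: diff[OF sR x])
  also have "\<dots> = pd (W x) (\<lambda>y. gm y (Y y) (Z y) *\<^sub>R X y) x - pd (W x) (\<lambda>y. gm y (X y) (Z y) *\<^sub>R Y y) x"
    by (intro pd_diff diff[OF _ x] smooth_intros sg U X Y Z)
  also have "pd (W x) (\<lambda>y. gm y (Y y) (Z y) *\<^sub>R X y) x
      = gm x (Y x) (Z x) *\<^sub>R pd (W x) X x + pd (W x) (\<lambda>y. gm y (Y y) (Z y)) x *\<^sub>R X x"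
    by (intro pd_scaleR diff[OF _ x] sg X Y Z)
  also have "pd (W x) (\<lambda>y. gm y (X y) (Z y) *\<^sub>R Y y) x
      = gm x (X x) (Z x) *\<^sub>R pd (W x) Y x + pd (W x) (\<lambda>y. gm y (X y) (Z y)) x *\<^sub>R Y x"
    by (intro pd_scaleR diff[OF _ x] sg X Y Z)
  finally have dR: "pd (W x) (curvature nabla X Y Z) x
      = gm x (Y x) (Z x) *\<^sub>R pd (W x) X x + pd (W x) (\<lambda>y. gm y (Y y) (Z y)) x *\<^sub>R X x
        - (gm x (X x) (Z x) *\<^sub>R pd (W x) Y x + pd (W x) (\<lambda>y. gm y (X y) (Z y)) x *\<^sub>R Y x)" .
  have b: "pd (W x) (\<lambda>y. gm y (Y y) (Z y)) x = pd (W x) (\<lambda>y. gm y (Y x) (Z x)) x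
      + gm x (pd (W x) Y x) (Z x) + gm x (Y x) (pd (W x) Z x)" if "smooth_on U Y" for Y
    by (rule pd_bilinear_field[OF U gm_bilinear smooth_gm that Z x])
  have g: "pd (W x) (\<lambda>y. gm y v w) x = gm x (\<Gamma> x (W x) v) w + gm x v (\<Gamma> x (W x) w)" for v w
    using G0[OF x, of "W x" v w] by (simp add: G_def)
  show "cov_curvature nabla W X Y Z x = 0"
    unfolding cov_curvature_def nabla_eq[OF W sR' x] dR
      b[OF Y] b[OF X] g
      R[OF smooth_nabla(1)[OF W X] Y Z x] R[OF X smooth_nabla(1)[OF W Y] Z x] R[OF X Y smooth_nabla(1)[OF W Z] x]
      R[OF X Y Z x] nabla_eq[OF W X x] nabla_eq[OF W Y x] nabla_eq[OF W Z x]
    by (simp add: bilinear_ladd[OF gm_bilinear[OF x]] bilinear_radd[OF gm_bilinear[OF x]]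
        bilinear_rsub[OF \<Gamma>_bilinear[OF x]] bilinear_rmul[OF \<Gamma>_bilinear[OF x]] algebra_simps)
qed

end


section \<open>The traces of the covariant derivatives\<close>

lemma axis_nth2: "e1 $ 1 = 1" "e1 $ 2 = 0" "e2 $ 1 = 0" "e2 $ 2 = 1"
  by (simp_all add: axis_def)

text \<open>Up to the factor \<open>det a\<close>, the trace of \<open>b\<close> with respect to \<open>a\<close>, computed in the basis \<open>v, w\<close>.
  Clearing the denominator keeps it a polynomial, also for degenerate \<open>a\<close>.\<close>

definition tr2 :: "(real^2 \<Rightarrow> real^2 \<Rightarrow> real) \<Rightarrow> (real^2 \<Rightarrow> real^2 \<Rightarrow> real) \<Rightarrow> real^2 \<Rightarrow> real^2 \<Rightarrow> real" where
  "tr2 a b v w = a w w * b v v - 2 * a v w * b v w + a v v * b w w"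

lemma tr2_basis:
  assumes "bilinear a" "bilinear b" "a e1 e2 = a e2 e1" "b e1 e2 = b e2 e1"
  shows "tr2 a b v w = (v$1 * w$2 - v$2 * w$1)\<^sup>2 * tr2 a b e1 e2"
  unfolding tr2_def bilinear_expand[OF assms(1), of v w] bilinear_expand[OF assms(1), of v v]
    bilinear_expand[OF assms(1), of w w] bilinear_expand[OF assms(2), of v w]
    bilinear_expand[OF assms(2), of v v] bilinear_expand[OF assms(2), of w w] assms(3,4)
  by (simp add: power2_eq_square) algebra

lemma matrix_inv_works:
  assumes "invertible A"
  shows "A ** matrix_inv A = mat 1" "matrix_inv A ** A = mat 1"
  using assms unfolding invertible_def matrix_inv_def by (metis (mono_tags, lifting) someI_ex)+

lemma matrix_inv_2:
  fixes a b c d :: real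
  assumes "a * d - b * c \<noteq> 0"
  shows "matrix_inv (vector [vector [a, b], vector [c, d]] :: real^2^2)
    = vector [vector [d / (a * d - b * c), - b / (a * d - b * c)],
        vector [- c / (a * d - b * c), a / (a * d - b * c)]]" (is "matrix_inv ?M = ?B")
proof -
  have "?M ** ?B = mat 1" "?B ** ?M = mat 1"
    using assms by (simp_all add: vec_eq_iff forall_2 matrix_matrix_mult_def sum_2 mat_def
        diff_divide_distrib[symmetric] mult.commute)
  then have inv: "invertible ?M" unfolding invertible_def by blast
  have "matrix_inv ?M = matrix_inv ?M ** (?M ** ?B)" using \<open>?M ** ?B = mat 1\<close> by simp
  also have "\<dots> = ?B" unfolding matrix_mul_assoc matrix_inv_works(2)[OF inv] by simp
  finally show ?thesis .
qed

lemma linear_expand2: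
  fixes f :: "real^2 \<Rightarrow> 'b::real_vector"
  assumes "linear f"
  shows "f v = v$1 *\<^sub>R f e1 + v$2 *\<^sub>R f e2"
  by (metis vec2_expand linear_add[OF assms] linear_cmul[OF assms])

text \<open>The coefficients \<open>g1, \<dots>, g4\<close> of the cubic form solve a homogeneous linear system whose
  determinant is the resultant of the two quadratic forms, that is, the discriminant of the
  pencil that they span.\<close>

lemma common_apolar_cubic_zero:
  fixes A B C A' B' C' g1 g2 g3 g4 :: real
  assumes 1: "A * g1 - 2 * B * g2 + C * g3 = 0" and 2: "A * g2 - 2 * B * g3 + C * g4 = 0"
    and 3: "A' * g1 - 2 * B' * g2 + C' * g3 = 0" and 4: "A' * g2 - 2 * B' * g3 + C' * g4 = 0"
    and res: "(A * C' + C * A' - 2 * B * B')\<^sup>2 \<noteq> 4 * (A * C - B\<^sup>2) * (A' * C' - B'\<^sup>2)"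
  shows "g1 = 0" "g2 = 0" "g3 = 0" "g4 = 0"
proof -
  \<comment> \<open>the minors \<open>m, n, l\<close> of the two forms give the resultant as \<open>m\<^sup>2 + n l\<close>\<close>
  define m where "m = A * C' - C * A'"
  define n where "n = 2 * (B * C' - C * B')"
  define l where "l = 2 * (B * A' - A * B')"
  have R: "m\<^sup>2 + n * l \<noteq> 0" using res unfolding m_def n_def l_def by (simp add: power2_eq_square algebra_simps)
  have e1: "m * g1 = n * g2" using 1 3 unfolding m_def n_def by algebra
  have e2: "m * g2 = n * g3" using 2 4 unfolding m_def n_def by algebra
  have e3: "m * g3 = - l * g2" using 1 3 unfolding m_def l_def by algebra
  have e4: "m * g4 = - l * g3" using 2 4 unfolding m_def l_def by algebra
  have "(m\<^sup>2 + n * l) * g2 = 0" using e2 e3 by algebra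
  then show g2: "g2 = 0" using R by simp
  have "(m\<^sup>2 + n * l) * g3 = 0" using e2 e3 by algebra
  then show g3: "g3 = 0" using R by simp
  have h: "A * g1 = 0" "A' * g1 = 0" "C * g4 = 0" "C' * g4 = 0" using 1 2 3 4 g2 g3 by auto
  show "g1 = 0"
  proof (rule ccontr)
    assume "g1 \<noteq> 0"
    then have "A = 0" "A' = 0" using h by auto
    then show False using R unfolding m_def l_def by simp
  qed
  show "g4 = 0"
  proof (rule ccontr)
    assume "g4 \<noteq> 0"
    then have "C = 0" "C' = 0" using h by auto
    then show False using R unfolding m_def n_def by simp
  qed
qed

text \<open>Equal eigenvalues make the diagonal matrix scalar, and conjugation does not change scalars.\<close>

lemma C_diagonalizable_scalar:
  assumes lin: "linear T" and diag: "C_diagonalizable T"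
    and disc: "(trace (matrix T))\<^sup>2 = 4 * det (matrix T)"
  shows "T v = (trace (matrix T) / 2) *\<^sub>R v"
proof -
  obtain P D :: "complex^2^2" where P: "invertible P" and D: "\<And>i j. i \<noteq> j \<Longrightarrow> D $ i $ j = 0"
    and eq: "(\<chi> i j. complex_of_real (matrix T $ i $ j)) = P ** D ** matrix_inv P"
    using diag unfolding C_diagonalizable_def by blast
  define M :: "complex^2^2" where "M = (\<chi> i j. complex_of_real (matrix T $ i $ j))"
  have PI: "P ** matrix_inv P = mat 1" "matrix_inv P ** P = mat 1"
    using matrix_inv_works[OF P] by blast+
  have "trace M = trace (matrix_inv P ** (P ** D))"
    unfolding M_def eq by (rule trace_mul_sym)
  then have trM: "trace M = trace D" by (simp add: matrix_mul_assoc PI)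
  have "det M = det P * det D * det (matrix_inv P)"
    unfolding M_def eq by (simp add: det_mul)
  also have "\<dots> = det D * det (P ** matrix_inv P)" by (simp add: det_mul)
  finally have detM: "det M = det D" by (simp add: PI)
  have "trace M = of_real (trace (matrix T))" "det M = of_real (det (matrix T))"
    by (simp_all add: M_def trace_def sum_2 det_2)
  then have "(trace D)\<^sup>2 = 4 * det D"
    using disc trM detM by (metis of_real_mult of_real_numeral of_real_power)
  then have "(D$1$1 - D$2$2)\<^sup>2 = 0"
    using D[of 1 2] D[of 2 1] by (simp add: trace_def sum_2 det_2 power2_eq_square algebra_simps)
  then have "D = mat (D$1$1)" using D by (simp add: vec_eq_iff forall_2 mat_def)
  moreover have "P ** mat (D$1$1) = mat (D$1$1) ** P"
    by (simp add: vec_eq_iff forall_2 matrix_matrix_mult_def sum_2 mat_def)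
  ultimately have "M = mat (D$1$1) ** (P ** matrix_inv P)"
    unfolding M_def eq by (metis matrix_mul_assoc)
  then have M: "M = mat (D$1$1)" by (simp add: PI)
  have "complex_of_real (T (axis j 1) $ i) = mat (D$1$1) $ i $ j" for i j
    using M unfolding M_def matrix_def by (simp add: vec_eq_iff)
  from this[of 1 1] this[of 1 2] this[of 2 1] this[of 2 2]
  have t: "T e2 $ 1 = 0" "T e1 $ 2 = 0" "complex_of_real (T e1 $ 1) = complex_of_real (T e2 $ 2)"
    by (simp_all add: mat_def)
  have t': "T e1 $ 1 = T e2 $ 2" using t(3) by (simp only: of_real_eq_iff)
  show ?thesis
    unfolding linear_expand2[OF lin, of v] trace_matrix_2
    by (simp add: vec_eq_iff forall_2 t t' axis_nth2)
qed

context blaschke_chart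
begin

text \<open>If the Gram determinant vanished, a vector read off from a row of the matrix would be
  \<open>h\<close>-orthogonal to everything.\<close>

lemma det_h_nonzero:
  assumes x: "x \<in> U"
  shows "h x e1 e1 * h x e2 e2 - (h x e1 e2)\<^sup>2 \<noteq> 0"
proof
  assume z: "h x e1 e1 * h x e2 e2 - (h x e1 e2)\<^sup>2 = 0"
  note bl = h_bilinear[OF x]
  define v where "v = (if h x e1 e1 = 0 \<and> h x e1 e2 = 0 then e1 else h x e1 e2 *\<^sub>R e1 - h x e1 e1 *\<^sub>R e2)"
  have "v \<noteq> 0" unfolding v_def by (auto simp: vec_eq_iff forall_2 axis_def)
  moreover have "h x v e1 = 0" "h x v e2 = 0"
    using z h_sym[OF x, of e1 e2] unfolding v_def
    by (auto simp: bilinear_lsub[OF bl] bilinear_lmul[OF bl] power2_eq_square)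
  then have "h x v w = 0" for w
    using linear_expand2[of "h x v" w] bl unfolding bilinear_def by auto
  ultimately show False using nondeg[OF x] by blast
qed

lemma C_linear: "x \<in> U \<Longrightarrow> linear (C x u v)" and G_linear: "x \<in> U \<Longrightarrow> linear (G x u v)"
proof -
  assume x: "x \<in> U"
  have gen: "linear (\<lambda>w. pd u (\<lambda>y. b y v w) x)"
    if b: "\<And>y. y \<in> U \<Longrightarrow> bilinear (b y)" and s: "\<And>v w. smooth_on U (\<lambda>y. b y v w)"
    for b :: "real^2 \<Rightarrow> real^2 \<Rightarrow> real^2 \<Rightarrow> real"
  proof (rule linearI)
    note d = diff[OF s x]
    show "pd u (\<lambda>y. b y v (w + w')) x = pd u (\<lambda>y. b y v w) x + pd u (\<lambda>y. b y v w') x" for w w'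
      unfolding pd_add[OF d d, symmetric]
      by (rule pd_transform[OF U x]) (auto simp: bilinear_radd[OF b] intro!: differentiable_add d)
    show "pd u (\<lambda>y. b y v (r *\<^sub>R w)) x = r *\<^sub>R pd u (\<lambda>y. b y v w) x" for r w
      unfolding pd_linear[OF bounded_linear_scaleR_right d, symmetric]
      by (rule pd_transform[OF U x]) (auto simp: bilinear_rmul[OF b] intro!: differentiable_linear[OF bounded_linear_mult_right] d)
  qed
  show "linear (C x u v)" unfolding C_def[abs_def]
    using linear_add[OF gen[OF h_bilinear smooth_h]] linear_cmul[OF gen[OF h_bilinear smooth_h]]
    by (intro linearI) (simp_all add: bilinear_radd[OF h_bilinear[OF x]] bilinear_rmul[OF h_bilinear[OF x]]
      bilinear_radd[OF \<Gamma>_bilinear[OF x]] bilinear_rmul[OF \<Gamma>_bilinear[OF x]] algebra_simps)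
  show "linear (G x u v)" unfolding G_def[abs_def]
    using linear_add[OF gen[OF gm_bilinear smooth_gm]] linear_cmul[OF gen[OF gm_bilinear smooth_gm]]
    by (intro linearI) (simp_all add: bilinear_radd[OF gm_bilinear[OF x]] bilinear_rmul[OF gm_bilinear[OF x]]
      bilinear_radd[OF \<Gamma>_bilinear[OF x]] bilinear_rmul[OF \<Gamma>_bilinear[OF x]] algebra_simps)
qed

lemma C_bilinear: "x \<in> U \<Longrightarrow> bilinear (C x u)" and G_bilinear: "x \<in> U \<Longrightarrow> bilinear (G x u)"
  unfolding bilinear_def using C_linear[of x u] G_linear[of x u] C_swap23[of x u] G_swap23[of x u]
  by (simp_all add: eta_contract_eq)

text \<open>With \<open>K\<close> the difference of \<open>\<nabla>\<close> and the Levi-Civita connection, \<open>C(u, v, w) = - h(K(u, v), w) - h(v, K(u, w))\<close>.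
  Symmetry of \<open>C\<close> and \<open>K\<close> makes \<open>h(K(u, v), w)\<close> totally symmetric, hence \<open>C = - 2 h(K, \<cdot>)\<close>, and
  apolarity says that the \<open>h\<close>-trace of \<open>K\<close> is zero.\<close>

lemma tr_C:
  assumes x: "x \<in> U"
  shows "tr2 (h x) (C x u) v w = 0"
proof -
  define d where "d = h x e1 e1 * h x e2 e2 - h x e1 e2 * h x e2 e1"
  have d: "d \<noteq> 0" using det_h_nonzero[OF x] h_sym[OF x, of e1 e2] by (simp add: d_def power2_eq_square)
  note bl = h_bilinear[OF x]
  obtain nh where nh: "levi_civita U h nh"
    "(\<Sum>i\<in>UNIV. \<Sum>j\<in>UNIV.
        matrix_inv (gram (h x) (axis 1 1) (axis 2 1)) $ i $ j *\<^sub>R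
          (nabla (\<lambda>_. axis i 1) (\<lambda>_. axis j 1) x
           - nh (\<lambda>_. axis i 1) (\<lambda>_. axis j 1) x)) = (0::real^2)"
    using apolarity x unfolding apolar_def by blast
  define K where "K u v = \<Gamma> x u v - nh (\<lambda>_. u) (\<lambda>_. v) x" for u v
  have c: "(\<lambda>_. u) \<in> vfields U" for u by (simp add: vfields_def smooth_on_const)
  have K_sym: "K u v = K v u" for u v
    using nh(1) c x \<Gamma>_sym[OF x, of u v] bracket_const[of u v x] unfolding levi_civita_def K_def
    by (metis (no_types, lifting) eq_iff_diff_eq_0)
  have met: "pd u (\<lambda>y. h y v w) x = h x (nh (\<lambda>_. u) (\<lambda>_. v) x) w + h x v (nh (\<lambda>_. u) (\<lambda>_. w) x)" for u v w
  proof -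
    have "dir_deriv X (\<lambda>y. h y (Y y) (Z y)) x = h x (nh X Y x) (Z x) + h x (Y x) (nh X Z x)"
      if "X \<in> vfields U" "Y \<in> vfields U" "Z \<in> vfields U" for X Y Z
      using nh(1) x that unfolding levi_civita_def by blast
    from this[OF c c c, of u v w] show ?thesis by (simp add: dir_deriv_def pd_def)
  qed
  have CK: "C x u v w = - h x (K u v) w - h x (K u w) v" for u v w
    unfolding C_def met K_def bilinear_lsub[OF bl] using h_sym[OF x] by simp
  have K3: "h x (K w u) v = h x (K w v) u" for u v w
    using C_swap12[OF x, of u v w] K_sym[of u v] K_sym[of u w] K_sym[of v w] unfolding CK by simp
  have CK2: "C x u v w = - 2 * h x (K u v) w" for u v w
    using CK[of u v w] K3[of u v w] by simp
  have M: "matrix_inv (gram (h x) e1 e2) = vector [vector [h x e2 e2 / d, - h x e1 e2 / d],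
        vector [- h x e2 e1 / d, h x e1 e1 / d]]"
    unfolding gram_def d_def by (rule matrix_inv_2) (use d in \<open>simp add: d_def\<close>)
  have "(h x e2 e2 / d) *\<^sub>R K e1 e1 + (- h x e1 e2 / d) *\<^sub>R K e1 e2 + ((- h x e2 e1 / d) *\<^sub>R K e2 e1
      + (h x e1 e1 / d) *\<^sub>R K e2 e2) = 0"
    using nh(2) unfolding M sum_2 K_def \<Gamma>_def by simp
  then have "h x ((h x e2 e2 / d) *\<^sub>R K e1 e1 + (- h x e1 e2 / d) *\<^sub>R K e1 e2 + ((- h x e2 e1 / d) *\<^sub>R K e2 e1
      + (h x e1 e1 / d) *\<^sub>R K e2 e2)) u = h x 0 u" by simp
  then have "(h x e2 e2 / d) * h x (K e1 e1) u + (- h x e1 e2 / d) * h x (K e1 e2) u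
      + ((- h x e2 e1 / d) * h x (K e2 e1) u + (h x e1 e1 / d) * h x (K e2 e2) u) = 0"
    by (simp only: bilinear_ladd[OF bl] bilinear_lmul[OF bl] bilinear_lzero[OF bl] real_scaleR_def)
  then have "(h x e2 e2 * h x (K e1 e1) u - 2 * h x e1 e2 * h x (K e1 e2) u + h x e1 e1 * h x (K e2 e2) u) / d = 0"
    using K_sym[of e1 e2] h_sym[OF x, of e1 e2] by (simp add: diff_divide_distrib add_divide_distrib algebra_simps)
  then have "h x e2 e2 * h x (K e1 e1) u - 2 * h x e1 e2 * h x (K e1 e2) u + h x e1 e1 * h x (K e2 e2) u = 0"
    using d by simp
  moreover have "C x u v w = - 2 * h x (K v w) u" for v w
    using CK2[of v w u] C_swap12[OF x, of u v w] C_swap23[OF x, of v u w] by simp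
  ultimately have "tr2 (h x) (C x u) e1 e2 = 0"
    unfolding tr2_def by (simp add: algebra_simps)
  then show ?thesis
    by (subst tr2_basis[OF bl C_bilinear[OF x] h_sym[OF x] C_swap23[OF x]]) simp
qed

lemma G_eq:
  assumes x: "x \<in> U"
  shows "G x u v w = pd u tr x * h x v w + tr x * C x u v w - C x u (S x v) w - h x (N x u v) w"
proof -
  note bl = h_bilinear[OF x]
  note sS = smooth_S[OF smooth_on_const, of v]
  note hS = smooth_on_bilinear_field[OF U h_bilinear smooth_h sS smooth_on_const]
  have "pd u (\<lambda>y. gm y v w) x = pd u (\<lambda>y. tr y * h y v w) x - pd u (\<lambda>y. h y (S y v) w) x"
    unfolding gm_def by (intro pd_diff diff[OF _ x] smooth_on_mult U smooth_tr smooth_h hS)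
  also have "pd u (\<lambda>y. tr y * h y v w) x = tr x * pd u (\<lambda>y. h y v w) x + pd u tr x * h x v w"
    by (intro pd_mult diff[OF _ x] smooth_tr smooth_h)
  also have "pd u (\<lambda>y. h y (S y v) w) x = pd u (\<lambda>y. h y (S x v) w) x + h x (pd u (\<lambda>y. S y v) x) w"
    using pd_bilinear_field[OF U h_bilinear smooth_h sS smooth_on_const x, of u w] bilinear_rzero[OF bl] by simp
  finally show ?thesis
    unfolding G_def C_def N_def gm_def
    by (simp add: bilinear_ladd[OF bl] bilinear_lsub[OF bl] algebra_simps)
qed

lemma tr_N:
  assumes x: "x \<in> U"
  shows "N x u e1 $ 1 + N x u e2 $ 2 = pd u tr x"
proof -
  note sS = smooth_S[OF smooth_on_const]
  have "pd u tr x = pd u (\<lambda>y. S y e1 $ 1) x + pd u (\<lambda>y. S y e2 $ 2) x"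
    unfolding tr_def by (intro pd_add diff[OF _ x] smooth_on_vec_nth U sS)
  then have 1: "pd u tr x = pd u (\<lambda>y. S y e1) x $ 1 + pd u (\<lambda>y. S y e2) x $ 2"
    using pd_linear[OF bounded_linear_vec_nth diff[OF sS x]] by simp
  have l: "linear (\<Gamma> x u)" using \<Gamma>_bilinear[OF x] by (simp add: bilinear_def)
  show ?thesis
    unfolding N_def 1 linear_expand2[OF l, of "S x e1"] linear_expand2[OF l, of "S x e2"]
      linear_expand2[OF S_linear[OF x], of "\<Gamma> x u e1"] linear_expand2[OF S_linear[OF x], of "\<Gamma> x u e2"]
    by (simp add: algebra_simps)
qed

text \<open>Tracing \<open>G_eq\<close> over \<open>v, w\<close> gives \<open>2 u(tr S) - u(tr S)\<close> minus the trace of \<open>C(u, S\<cdot>, \<cdot>)\<close>, by \<open>tr_C\<close>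
  and \<open>tr_N\<close>. Subtracting \<open>G_eq\<close> from itself with the first two slots exchanged, where \<open>N\<close> cancels by
  the Codazzi equation for \<open>S\<close>, and tracing again, shows that \<open>u(tr S)\<close> is that trace.\<close>

lemma tr_G:
  assumes x: "x \<in> U"
  shows "tr2 (h x) (G x u) v w = 0"
proof -
  note bl = h_bilinear[OF x]
  define d where "d = h x e1 e1 * h x e2 e2 - h x e1 e2 * h x e1 e2"
  have hs: "h x e2 e1 = h x e1 e2" by (rule h_sym[OF x])
  have hN: "h x e2 e2 * h x (N x u e1) e1 - h x e1 e2 * h x (N x u e1) e2
      - h x e1 e2 * h x (N x u e2) e1 + h x e1 e1 * h x (N x u e2) e2 = d * pd u tr x" for u
    unfolding bilinear_expand[OF bl, of "N x u e1"] bilinear_expand[OF bl, of "N x u e2"] tr_N[OF x, of u, symmetric]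
    by (simp add: axis_nth2 hs d_def algebra_simps)
  have CS: "h x e2 e2 * C x e1 (S x v) e1 - h x e1 e2 * C x e1 (S x v) e2
      - h x e1 e2 * C x e2 (S x v) e1 + h x e1 e1 * C x e2 (S x v) e2 = 0" for v
    using tr_C[OF x, of "S x v" e1 e2] C_swap12[OF x, of "S x v"] C_swap23[OF x, of "S x v" e1 e2]
    by (simp add: tr2_def)
  have C0: "h x e2 e2 * C x u e1 e1 - h x e1 e2 * C x u e1 e2
      - h x e1 e2 * C x u e2 e1 + h x e1 e1 * C x u e2 e2 = 0" for u
    using tr_C[OF x, of u e1 e2] C_swap23[OF x, of u e1 e2] by (simp add: tr2_def)
  have split: "tr2 (h x) (G x u) e1 e2 = h x e2 e2 * G x u e1 e1 - h x e1 e2 * G x u e1 e2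
      - h x e1 e2 * G x u e2 e1 + h x e1 e1 * G x u e2 e2" for u
    using G_swap23[OF x, of u e1 e2] by (simp add: tr2_def)
  have pf: "G x e1 e2 w = G x e2 e1 w" for w by (rule G_swap12[OF x])
  have Nc: "N x e1 e2 = N x e2 e1" by (rule S_codazzi[OF x])
  have Cc: "C x e1 e2 w = C x e2 e1 w" for w by (rule C_swap12[OF x])
  have t1: "tr2 (h x) (G x e1) e1 e2 = 0"
  proof -
    have "h x e1 e1 * (G x e1 e2 e2 - G x e2 e1 e2) - h x e1 e2 * (G x e1 e2 e1 - G x e2 e1 e1) = 0"
      by (simp add: pf)
    then have "d * pd e1 tr x = h x e1 e1 * (C x e1 (S x e2) e2 - C x e2 (S x e1) e2)
        - h x e1 e2 * (C x e1 (S x e2) e1 - C x e2 (S x e1) e1)"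
      unfolding G_eq[OF x] Nc Cc hs d_def by (simp add: algebra_simps)
    then show ?thesis
      unfolding split G_eq[OF x] hs using hN[of e1] CS[of e1] C0[of e1] unfolding d_def by algebra
  qed
  have t2: "tr2 (h x) (G x e2) e1 e2 = 0"
  proof -
    have "h x e2 e2 * (G x e2 e1 e1 - G x e1 e2 e1) - h x e1 e2 * (G x e2 e1 e2 - G x e1 e2 e2) = 0"
      by (simp add: pf)
    then have "d * pd e2 tr x = h x e2 e2 * (C x e2 (S x e1) e1 - C x e1 (S x e2) e1)
        - h x e1 e2 * (C x e2 (S x e1) e2 - C x e1 (S x e2) e2)"
      unfolding G_eq[OF x] Nc Cc hs d_def by (simp add: algebra_simps)
    then show ?thesis
      unfolding split G_eq[OF x] hs using hN[of e2] CS[of e2] C0[of e2] unfolding d_def by algebra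
  qed
  have lin: "linear (\<lambda>u. G x u v w)" for v w
  proof -
    have "(\<lambda>u. G x u v w) = G x v w" by (rule ext, rule trans[OF G_swap12[OF x] G_swap23[OF x]])
    then show ?thesis using G_linear[OF x] by simp
  qed
  have "tr2 (h x) (G x u) e1 e2 = u$1 * tr2 (h x) (G x e1) e1 e2 + u$2 * tr2 (h x) (G x e2) e1 e2"
    unfolding tr2_def linear_expand2[OF lin, of u] by (simp add: algebra_simps)
  then show ?thesis
    by (subst tr2_basis[OF bl G_bilinear[OF x] h_sym[OF x] G_swap23[OF x]]) (simp add: t1 t2)
qed

lemma det_S': "x \<in> U \<Longrightarrow> S x e1 $ 1 * S x e2 $ 2 - S x e2 $ 1 * S x e1 $ 2 = \<tau>"
  using det_S by (simp add: det_matrix_2)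

lemma tr2_gm:
  assumes x: "x \<in> U"
  shows "tr2 (h x) (gm x) v w = tr x * (h x v v * h x w w - (h x v w)\<^sup>2)"
    and "gm x v v * gm x w w - (gm x v w)\<^sup>2 = \<tau> * (h x v v * h x w w - (h x v w)\<^sup>2)"
proof -
  note bl = h_bilinear[OF x] and bg = gm_bilinear[OF x]
  have hs: "h x e2 e1 = h x e1 e2" by (rule h_sym[OF x])
  have sa: "h x (S x e2) e1 = h x (S x e1) e2" using S_codazzi(2)[OF x, of e2 e1] h_sym[OF x] by simp
  have hS: "h x (S x v) w = S x v $ 1 * h x e1 w + S x v $ 2 * h x e2 w" for v w
    using linear_expand2[of "\<lambda>v. h x v w" "S x v"] bl unfolding bilinear_def by simp
  define D where "D = h x e1 e1 * h x e2 e2 - (h x e1 e2)\<^sup>2"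
  have a: "2 * (h x v v * h x w w - (h x v w)\<^sup>2) = (v$1 * w$2 - v$2 * w$1)\<^sup>2 * (2 * D)" for v w
    using tr2_basis[OF bl bl hs[symmetric] hs[symmetric], of v w]
    unfolding tr2_def D_def by (simp add: power2_eq_square algebra_simps)
  have "tr2 (h x) (gm x) e1 e2 = tr x * D"
    using sa unfolding tr2_def gm_def D_def tr_def hS hs by algebra
  then show "tr2 (h x) (gm x) v w = tr x * (h x v v * h x w w - (h x v w)\<^sup>2)"
    using tr2_basis[OF bl bg hs[symmetric] gm_sym[OF x], of v w] a[of v w] by algebra
  have "gm x e1 e1 * gm x e2 e2 - (gm x e1 e2)\<^sup>2 = \<tau> * D"
    using sa unfolding det_S'[OF x, symmetric] gm_def D_def tr_def hS hs by algebra
  then have "tr2 (gm x) (gm x) e1 e2 = 2 * (\<tau> * D)" by (simp add: tr2_def power2_eq_square)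
  then have "tr2 (gm x) (gm x) v w = 2 * (\<tau> * (h x v v * h x w w - (h x v w)\<^sup>2))"
    using tr2_basis[OF bg bg gm_sym[OF x] gm_sym[OF x], of v w] a[of v w] by algebra
  then show "gm x v v * gm x w w - (gm x v w)\<^sup>2 = \<tau> * (h x v v * h x w w - (h x v w)\<^sup>2)"
    by (simp add: tr2_def power2_eq_square)
qed

text \<open>Differentiate \<open>det \<gamma> = \<tau> det h\<close>. The connection terms are \<open>2 tr \<Gamma>\<^sub>u\<close> times either side and
  cancel, and the term with \<open>C\<close> vanishes by \<open>tr_C\<close>.\<close>

lemma tr_gm_G:
  assumes x: "x \<in> U"
  shows "tr2 (gm x) (G x u) e1 e2 = 0"
proof -
  note bl = h_bilinear[OF x] and bg = gm_bilinear[OF x]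
  have quad: "pd u (\<lambda>y. b y e1 e1 * b y e2 e2 - b y e1 e2 * b y e1 e2) x
      = b x e1 e1 * pd u (\<lambda>y. b y e2 e2) x + pd u (\<lambda>y. b y e1 e1) x * b x e2 e2
        - 2 * b x e1 e2 * pd u (\<lambda>y. b y e1 e2) x"
    if s: "\<And>v w. smooth_on U (\<lambda>y. b y v w)" for b :: "real^2 \<Rightarrow> real^2 \<Rightarrow> real^2 \<Rightarrow> real"
    by (subst pd_diff, (intro diff[OF _ x] smooth_on_mult U s)+, (subst pd_mult, (intro diff[OF _ x] s)+)+) simp
  have "pd u (\<lambda>y. gm y e1 e1 * gm y e2 e2 - gm y e1 e2 * gm y e1 e2) x
      = pd u (\<lambda>y. \<tau> * (h y e1 e1 * h y e2 e2 - h y e1 e2 * h y e1 e2)) x"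
    by (rule pd_transform[OF U x])
       (use tr2_gm(2) in \<open>auto simp: power2_eq_square intro!: diff[OF _ x] smooth_intros U smooth_h\<close>)
  also have "\<dots> = \<tau> * pd u (\<lambda>y. h y e1 e1 * h y e2 e2 - h y e1 e2 * h y e1 e2) x"
    by (intro pd_linear[OF bounded_linear_mult_right] diff[OF _ x] smooth_intros U smooth_h)
  finally have e: "gm x e1 e1 * pd u (\<lambda>y. gm y e2 e2) x + pd u (\<lambda>y. gm y e1 e1) x * gm x e2 e2
        - 2 * gm x e1 e2 * pd u (\<lambda>y. gm y e1 e2) x
      = \<tau> * (h x e1 e1 * pd u (\<lambda>y. h y e2 e2) x + pd u (\<lambda>y. h y e1 e1) x * h x e2 e2
        - 2 * h x e1 e2 * pd u (\<lambda>y. h y e1 e2) x)"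
    unfolding quad[of gm, OF smooth_gm] quad[of h, OF smooth_h] .
  have hp: "pd u (\<lambda>y. h y v w) x = C x u v w + h x (\<Gamma> x u v) w + h x v (\<Gamma> x u w)" for v w
    by (simp add: C_def)
  have gp: "pd u (\<lambda>y. gm y v w) x = G x u v w + gm x (\<Gamma> x u v) w + gm x v (\<Gamma> x u w)" for v w
    by (simp add: G_def)
  have ex1: "b v w = v$1 * b e1 w + v$2 * b e2 w" if "bilinear b" for b :: "real^2 \<Rightarrow> real^2 \<Rightarrow> real" and v w
    using that linear_expand2[of "\<lambda>v. b v w" v] unfolding bilinear_def by simp
  have ex2: "b w v = v$1 * b w e1 + v$2 * b w e2" if "bilinear b" for b :: "real^2 \<Rightarrow> real^2 \<Rightarrow> real" and v w
    using that linear_expand2[of "b w" v] unfolding bilinear_def by simp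
  note exs = ex1[OF bl, of "\<Gamma> x u _"] ex2[OF bl, of _ "\<Gamma> x u _"] ex1[OF bg, of "\<Gamma> x u _"] ex2[OF bg, of _ "\<Gamma> x u _"]
  have hs: "h x e2 e1 = h x e1 e2" and gs: "gm x e2 e1 = gm x e1 e2" by (rule h_sym[OF x], rule gm_sym[OF x])
  show ?thesis
    using e tr_C[OF x, of u e1 e2] tr2_gm(2)[OF x, of e1 e2]
    unfolding hp gp exs tr2_def hs gs by algebra
qed

text \<open>The discriminant of the characteristic polynomial of \<open>S\<close>.\<close>

definition disc :: "real^2 \<Rightarrow> real" where
  "disc x = (tr x)\<^sup>2 - 4 * \<tau>"

lemma G_zero_if_disc_nonzero:
  assumes x: "x \<in> U" and disc: "disc x \<noteq> 0"
  shows "G x u v w = 0"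
proof -
  have D: "h x e1 e1 * h x e2 e2 - (h x e1 e2)\<^sup>2 \<noteq> 0" by (rule det_h_nonzero[OF x])
  have s: "G x e1 e2 e1 = G x e1 e1 e2" "G x e2 e1 e1 = G x e1 e1 e2" "G x e2 e1 e2 = G x e1 e2 e2"
    "G x e2 e2 e1 = G x e1 e2 e2"
    using G_swap12[OF x] G_swap23[OF x] by metis+
  have res: "(h x e2 e2 * gm x e1 e1 + h x e1 e1 * gm x e2 e2 - 2 * h x e1 e2 * gm x e1 e2)\<^sup>2
      \<noteq> 4 * (h x e2 e2 * h x e1 e1 - (h x e1 e2)\<^sup>2) * (gm x e2 e2 * gm x e1 e1 - (gm x e1 e2)\<^sup>2)"
  proof -
    define d where "d = h x e1 e1 * h x e2 e2 - (h x e1 e2)\<^sup>2"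
    have 1: "h x e2 e2 * gm x e1 e1 + h x e1 e1 * gm x e2 e2 - 2 * h x e1 e2 * gm x e1 e2 = tr x * d"
      using tr2_gm(1)[OF x, of e1 e2] unfolding tr2_def d_def by simp
    have 2: "gm x e2 e2 * gm x e1 e1 - (gm x e1 e2)\<^sup>2 = \<tau> * d"
      using tr2_gm(2)[OF x, of e1 e2] unfolding d_def by (simp add: mult.commute)
    have 3: "h x e2 e2 * h x e1 e1 - (h x e1 e2)\<^sup>2 = d" unfolding d_def by simp
    have "(tr x * d)\<^sup>2 - 4 * d * (\<tau> * d) = d\<^sup>2 * disc x"
      unfolding disc_def by (simp add: power2_eq_square algebra_simps)
    moreover have "d\<^sup>2 * disc x \<noteq> 0" using D disc by (simp add: d_def)
    ultimately show ?thesis unfolding 1 2 3 by (metis right_minus_eq)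
  qed
  have t: "h x e2 e2 * G x e1 e1 e1 - 2 * h x e1 e2 * G x e1 e1 e2 + h x e1 e1 * G x e1 e2 e2 = 0"
    "h x e2 e2 * G x e1 e1 e2 - 2 * h x e1 e2 * G x e1 e2 e2 + h x e1 e1 * G x e2 e2 e2 = 0"
    "gm x e2 e2 * G x e1 e1 e1 - 2 * gm x e1 e2 * G x e1 e1 e2 + gm x e1 e1 * G x e1 e2 e2 = 0"
    "gm x e2 e2 * G x e1 e1 e2 - 2 * gm x e1 e2 * G x e1 e2 e2 + gm x e1 e1 * G x e2 e2 e2 = 0"
    using tr_G[OF x, of e1 e1 e2] tr_G[OF x, of e2 e1 e2] tr_gm_G[OF x, of e1] tr_gm_G[OF x, of e2]
    unfolding tr2_def s by simp_all
  note z = common_apolar_cubic_zero[OF t(1,2,3,4) res]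
  have "G x e1 v w = 0" "G x e2 v w = 0" for v w
    unfolding bilinear_expand[OF G_bilinear[OF x], of _ v w] s z by simp_all
  moreover have "G x u v w = u$1 *\<^sub>R G x v w e1 + u$2 *\<^sub>R G x v w e2"
    using linear_expand2[OF G_linear[OF x], of v w u] G_swap12[OF x] G_swap23[OF x] by metis
  ultimately show ?thesis using G_swap12[OF x] G_swap23[OF x] by (metis add.right_neutral scale_zero_right)
qed

lemma S_scalar_iff_disc_zero:
  assumes x: "x \<in> U"
  shows "disc x = 0 \<longleftrightarrow> (\<forall>v. S x v = (tr x / 2) *\<^sub>R v)"
proof
  assume "disc x = 0"
  then have "(trace (matrix (S x)))\<^sup>2 = 4 * det (matrix (S x))"
    by (simp add: disc_def trace_matrix_2 tr_def det_S x)
  from C_diagonalizable_scalar[OF S_linear[OF x] C_diag[OF x] this]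
  show "\<forall>v. S x v = (tr x / 2) *\<^sub>R v"
    unfolding trace_matrix_2 tr_def by blast
next
  assume "\<forall>v. S x v = (tr x / 2) *\<^sub>R v"
  then have "\<tau> = (tr x / 2) * (tr x / 2)" using det_S'[OF x] by (simp add: axis_nth2)
  then show "disc x = 0" by (simp add: disc_def power2_eq_square)
qed

end


section \<open>Null directions of the affine metric\<close>

text \<open>Put \<open>d = w + z v\<close> and \<open>d' = w + z' v\<close>, and let \<open>p\<^sub>i, q\<^sub>i\<close> be the \<open>v\<close>- and \<open>w\<close>-components of the
  Christoffel symbols, so that \<open>\<nabla>\<^bsub>d'\<^esub> d = (Dz + \<kappa>) v + \<alpha> w = \<alpha> d + (Dz + \<kappa> - \<alpha> z) v\<close>. The hypotheses on
  \<open>c\<^sub>i, d\<^sub>i\<close> say \<open>C(d', d, d) = 0\<close> and \<open>G(d', d, d) = 0\<close>. Differentiating \<open>h(d, d) = 0\<close> along \<open>d'\<close>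
  then leaves \<open>2 (Dz + \<kappa> - \<alpha> z) h(v, d) = 0\<close>, whence \<open>\<nabla>\<^bsub>d'\<^esub> d = \<alpha> d\<close>, and differentiating
  \<open>\<gamma>(d, d)\<close> gives \<open>2 \<alpha> \<gamma>(d, d)\<close>.\<close>

lemma null_direction_algebra:
  fixes z z' Dz :: "'a::field_char_0"
  assumes root: "h11 * z\<^sup>2 + 2 * h12 * z + h22 = 0" and nz: "h12 + z * h11 \<noteq> 0"
    and Cd: "c4 + (z + z') * c3 + z * z' * c2 + z * (c3 + (z + z') * c2 + z * z' * c1) = 0"
    and Gd: "d4 + (z + z') * d3 + z * z' * d2 + z * (d3 + (z + z') * d2 + z * z' * d1) = 0"
    and dh: "dh11 = (c2 + 2 * (p2 * h11 + q2 * h12)) + z' * (c1 + 2 * (p1 * h11 + q1 * h12))"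
      "dh12 = (c3 + (p2 * h12 + q2 * h22) + (p3 * h11 + q3 * h12))
        + z' * (c2 + (p1 * h12 + q1 * h22) + (p2 * h11 + q2 * h12))"
      "dh22 = (c4 + 2 * (p3 * h12 + q3 * h22)) + z' * (c3 + 2 * (p2 * h12 + q2 * h22))"
    and dg: "dg11 = (d2 + 2 * (p2 * g11 + q2 * g12)) + z' * (d1 + 2 * (p1 * g11 + q1 * g12))"
      "dg12 = (d3 + (p2 * g12 + q2 * g22) + (p3 * g11 + q3 * g12))
        + z' * (d2 + (p1 * g12 + q1 * g22) + (p2 * g11 + q2 * g12))"
      "dg22 = (d4 + 2 * (p3 * g12 + q3 * g22)) + z' * (d3 + 2 * (p2 * g12 + q2 * g22))"
    and droot: "dh11 * z\<^sup>2 + 2 * dh12 * z + dh22 + 2 * (h11 * z + h12) * Dz = 0"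
  defines "\<alpha> \<equiv> q3 + (z + z') * q2 + z * z' * q1" and "\<kappa> \<equiv> p3 + (z + z') * p2 + z * z' * p1"
  shows "Dz = \<alpha> * z - \<kappa>"
    and "dg11 * z\<^sup>2 + 2 * dg12 * z + dg22 + 2 * (g11 * z + g12) * Dz
      = 2 * \<alpha> * (g11 * z\<^sup>2 + 2 * g12 * z + g22)"
proof -
  have H: "dh11 * z\<^sup>2 + 2 * dh12 * z + dh22
      = (c4 + (z + z') * c3 + z * z' * c2 + z * (c3 + (z + z') * c2 + z * z' * c1))
        + 2 * (\<kappa> * (h12 + z * h11) + \<alpha> * (h22 + z * h12))"
    unfolding dh \<alpha>_def \<kappa>_def by (simp add: power2_eq_square algebra_simps)
  have Gg: "dg11 * z\<^sup>2 + 2 * dg12 * z + dg22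
      = (d4 + (z + z') * d3 + z * z' * d2 + z * (d3 + (z + z') * d2 + z * z' * d1))
        + 2 * (\<kappa> * (g12 + z * g11) + \<alpha> * (g22 + z * g12))"
    unfolding dg \<alpha>_def \<kappa>_def by (simp add: power2_eq_square algebra_simps)
  have "2 * (h12 + z * h11) * (Dz - (\<alpha> * z - \<kappa>)) + 2 * \<alpha> * (h11 * z\<^sup>2 + 2 * h12 * z + h22) = 0"
    using droot unfolding H Cd by (simp add: power2_eq_square algebra_simps)
  then have "2 * (h12 + z * h11) * (Dz - (\<alpha> * z - \<kappa>)) = 0" using root by simp
  then show D: "Dz = \<alpha> * z - \<kappa>"
    using nz by (metis mult_eq_0_iff zero_neq_numeral eq_iff_diff_eq_0)
  show "dg11 * z\<^sup>2 + 2 * dg12 * z + dg22 + 2 * (g11 * z + g12) * Dz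
      = 2 * \<alpha> * (g11 * z\<^sup>2 + 2 * g12 * z + g22)"
    unfolding Gg Gd D by (simp add: power2_eq_square algebra_simps)
qed

lemma pd_quadratic:
  fixes z :: "'b::real_normed_vector \<Rightarrow> 'a::real_normed_field" and b11 b12 b22 :: "'b \<Rightarrow> real"
  assumes "b11 differentiable (at x)" "b12 differentiable (at x)" "b22 differentiable (at x)" "z differentiable (at x)"
  shows "pd u (\<lambda>y. of_real (b11 y) * (z y)\<^sup>2 + 2 * of_real (b12 y) * z y + of_real (b22 y)) x
    = of_real (pd u b11 x) * (z x)\<^sup>2 + 2 * of_real (pd u b12 x) * z x + of_real (pd u b22 x)
      + 2 * (of_real (b11 x) * z x + of_real (b12 x)) * pd u z x"
proof (rule pd_eqI)
  show "((\<lambda>y. of_real (b11 y) * (z y)\<^sup>2 + 2 * of_real (b12 y) * z y + of_real (b22 y)) has_derivative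
    (\<lambda>u. of_real (pd u b11 x) * (z x)\<^sup>2 + 2 * of_real (pd u b12 x) * z x + of_real (pd u b22 x)
      + 2 * (of_real (b11 x) * z x + of_real (b12 x)) * pd u z x)) (at x)"
    using has_derivative_pd[OF assms(1)] has_derivative_pd[OF assms(2)] has_derivative_pd[OF assms(3)]
      has_derivative_pd[OF assms(4)]
    by (auto intro!: derivative_eq_intros simp: power2_eq_square algebra_simps)
qed

lemma open_superlevel:
  fixes f :: "'a::topological_space \<Rightarrow> real"
  assumes "open U" "continuous_on U f"
  shows "open {y\<in>U. f y > c}"
proof -
  have "{y\<in>U. f y > c} = U \<inter> f -` {c<..}" by auto
  then show ?thesis using continuous_open_preimage[OF assms(2,1), of "{c<..}"] by simp
qed

lemma near_in_neighbourhood: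
  fixes x :: "'a::metric_space" and e :: real
  assumes "open V" "x \<in> V" "\<And>e. e > 0 \<Longrightarrow> \<exists>y\<in>U. dist y x < e \<and> P y" "e > 0"
  shows "\<exists>y\<in>V. dist y x < e \<and> P y"
proof -
  obtain e' where e': "e' > 0" "ball x e' \<subseteq> V" using assms(1,2) openE by blast
  then show ?thesis using assms(3)[of "min e e'"] assms(4) by (auto simp: dist_commute subset_iff)
qed

text \<open>The left-hand side is the resultant of the two quadratic forms, written as a product over the
  roots of the first one.\<close>

lemma pencil_discriminant:
  fixes z z' :: "'a::field_char_0"
  assumes "h11 * (z + z') = - 2 * h12" "h11 * (z * z') = h22"
  shows "h11\<^sup>2 * ((g11 * z\<^sup>2 + 2 * g12 * z + g22) * (g11 * z'\<^sup>2 + 2 * g12 * z' + g22))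
    = (h11 * g22 + h22 * g11 - 2 * h12 * g12)\<^sup>2 - 4 * (h11 * h22 - h12\<^sup>2) * (g11 * g22 - g12\<^sup>2)"
proof -
  have a: "2 * h12 = - (h11 * (z + z'))" and b: "h22 = h11 * (z * z')"
    using assms by simp_all
  have "4 * h12\<^sup>2 = (2 * h12)\<^sup>2" by (simp add: power2_eq_square)
  then have a2: "4 * h12\<^sup>2 = (h11 * (z + z'))\<^sup>2" unfolding a by simp
  have "(h11 * g22 + h22 * g11 - 2 * h12 * g12)\<^sup>2 - 4 * (h11 * h22 - h12\<^sup>2) * (g11 * g22 - g12\<^sup>2)
      = (h11 * g22 + h22 * g11 - 2 * h12 * g12)\<^sup>2 - (4 * h11 * h22 - 4 * h12\<^sup>2) * (g11 * g22 - g12\<^sup>2)"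
    by (simp add: algebra_simps)
  also have "\<dots> = h11\<^sup>2 * ((g11 * z\<^sup>2 + 2 * g12 * z + g22) * (g11 * z'\<^sup>2 + 2 * g12 * z' + g22))"
    unfolding a a2 b by (simp add: power2_eq_square algebra_simps)
  finally show ?thesis by simp
qed

context blaschke_chart
begin

context
  fixes v w :: "real^2"
  assumes vw: "v$1 * w$2 - v$2 * w$1 \<noteq> 0"
begin

text \<open>The coordinates of a vector in the basis \<open>v, w\<close>.\<close>

definition cv :: "real^2 \<Rightarrow> real" where
  "cv X = (X$1 * w$2 - X$2 * w$1) / (v$1 * w$2 - v$2 * w$1)"
definition cw :: "real^2 \<Rightarrow> real" where
  "cw X = (v$1 * X$2 - v$2 * X$1) / (v$1 * w$2 - v$2 * w$1)"

lemma coordinates: "X = cv X *\<^sub>R v + cw X *\<^sub>R w"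
proof -
  have "(v$1 * w$2 - v$2 * w$1) *\<^sub>R X = (X$1 * w$2 - X$2 * w$1) *\<^sub>R v + (v$1 * X$2 - v$2 * X$1) *\<^sub>R w"
    by (simp add: vec_eq_iff forall_2 algebra_simps)
  then have "X = (1 / (v$1 * w$2 - v$2 * w$1)) *\<^sub>R ((X$1 * w$2 - X$2 * w$1) *\<^sub>R v + (v$1 * X$2 - v$2 * X$1) *\<^sub>R w)"
    using vw by (metis (no_types, lifting) divide_inverse inverse_eq_divide scaleR_scaleR scaleR_one nonzero_eq_divide_eq)
  then show ?thesis unfolding cv_def cw_def by (simp add: scaleR_add_right)
qed

lemma bilinear_coordinates:
  fixes b :: "real^2 \<Rightarrow> real^2 \<Rightarrow> real"
  assumes "bilinear b"
  shows "b X Y = cv X * b v Y + cw X * b w Y" "b Y X = cv X * b Y v + cw X * b Y w"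
proof -
  have "b X Y = b (cv X *\<^sub>R v + cw X *\<^sub>R w) Y" "b Y X = b Y (cv X *\<^sub>R v + cw X *\<^sub>R w)"
    using coordinates[of X] by simp_all
  then show "b X Y = cv X * b v Y + cw X * b w Y" "b Y X = cv X * b Y v + cw X * b Y w"
    by (simp_all add: bilinear_ladd[OF assms] bilinear_lmul[OF assms] bilinear_radd[OF assms] bilinear_rmul[OF assms])
qed

text \<open>The functions \<open>\<alpha>\<close> and \<open>\<kappa>\<close> of \<open>null_direction_algebra\<close>, with the sum and the product of the roots
  of \<open>h(w + z v, w + z v) = 0\<close> replaced by their values: they are real even if the roots are not.\<close>

definition conn_coeff :: "real^2 \<Rightarrow> real" where
  "conn_coeff y = cw (\<Gamma> y w w) + (- 2 * h y v w / h y v v) * cw (\<Gamma> y v w) + (h y w w / h y v v) * cw (\<Gamma> y v v)"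

definition conn_coeff' :: "real^2 \<Rightarrow> real" where
  "conn_coeff' y = cv (\<Gamma> y w w) + (- 2 * h y v w / h y v v) * cv (\<Gamma> y v w) + (h y w w / h y v v) * cv (\<Gamma> y v v)"

definition det_h :: "real^2 \<Rightarrow> real" where
  "det_h y = h y v v * h y w w - (h y v w)\<^sup>2"

text \<open>The value \<open>\<gamma>(w + z v, w + z v)\<close>.\<close>

definition null_gm :: "(real^2 \<Rightarrow> 'a::real_normed_field) \<Rightarrow> real^2 \<Rightarrow> 'a" where
  "null_gm z y = of_real (gm y v v) * (z y)\<^sup>2 + 2 * of_real (gm y v w) * z y + of_real (gm y w w)"

lemma smooth_conn_coeff:
  assumes "open O'" "O' \<subseteq> U" "\<And>y. y \<in> O' \<Longrightarrow> h y v v \<noteq> 0"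
  shows "smooth_on O' conn_coeff"
proof -
  have s: "smooth_on O' (\<lambda>y. h y a b)" "smooth_on O' (\<lambda>y. \<Gamma> y a b)" for a b
    using smooth_on_subset[OF smooth_h assms(2)] smooth_on_subset[OF smooth_\<Gamma> assms(2)] by auto
  show ?thesis unfolding conn_coeff_def cw_def
    by (intro smooth_intros assms s) (use assms vw in auto)
qed

lemma smooth_null_gm:
  assumes "open O'" "O' \<subseteq> U" "smooth_on O' z"
  shows "smooth_on O' (null_gm z)"
proof -
  have s: "smooth_on O' (\<lambda>y. gm y a b)" for a b
    using smooth_on_subset[OF smooth_gm assms(2)] by auto
  have "smooth_on O' (\<lambda>y. of_real (gm y a b) :: 'a)" for a b
    using smooth_on_linear[OF assms(1) bounded_linear_of_real s] .
  then show ?thesis unfolding null_gm_def by (intro smooth_intros assms)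
qed

lemma null_gm_product:
  fixes z z' :: "real^2 \<Rightarrow> 'a::real_normed_field"
  assumes x: "x \<in> U"
    and "of_real (h x v v) * (z x + z' x) = - 2 * of_real (h x v w)"
    and "of_real (h x v v) * (z x * z' x) = of_real (h x w w)"
  shows "(of_real (h x v v))\<^sup>2 * (null_gm z x * null_gm z' x) = of_real ((det_h x)\<^sup>2 * disc x)"
proof -
  have 1: "h x v v * gm x w w + h x w w * gm x v v - 2 * h x v w * gm x v w = tr x * det_h x"
    using tr2_gm(1)[OF x, of v w] unfolding tr2_def det_h_def by simp
  have 2: "gm x v v * gm x w w - (gm x v w)\<^sup>2 = \<tau> * det_h x"
    using tr2_gm(2)[OF x, of v w] unfolding det_h_def .
  have "(of_real (h x v v))\<^sup>2 * (null_gm z x * null_gm z' x)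
      = (of_real ((h x v v * gm x w w + h x w w * gm x v v - 2 * h x v w * gm x v w)\<^sup>2
          - 4 * (h x v v * h x w w - (h x v w)\<^sup>2) * (gm x v v * gm x w w - (gm x v w)\<^sup>2)) :: 'a)"
    unfolding null_gm_def pencil_discriminant[OF assms(2,3)] by simp
  also have "(h x v v * gm x w w + h x w w * gm x v v - 2 * h x v w * gm x v w)\<^sup>2
          - 4 * (h x v v * h x w w - (h x v w)\<^sup>2) * (gm x v v * gm x w w - (gm x v w)\<^sup>2)
      = (det_h x)\<^sup>2 * disc x"
    unfolding 1 2 det_h_def[symmetric] disc_def by (simp add: power2_eq_square algebra_simps)
  finally show ?thesis .
qed

text \<open>Since \<open>d\<close> and \<open>d'\<close> are the two null directions of \<open>h\<close>, the \<open>h\<close>-trace is a multiple of the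
  contraction with \<open>d, d'\<close>; so \<open>tr_C\<close> and \<open>tr_G\<close> supply the hypotheses of \<open>null_direction_algebra\<close>.\<close>

lemma null_direction_equations:
  fixes z z' :: "real^2 \<Rightarrow> 'a::real_normed_field"
  assumes O': "open O'" "O' \<subseteq> U" and x: "x \<in> O'" and z: "smooth_on O' z"
    and h11: "h x v v \<noteq> 0" and ne: "z x \<noteq> z' x"
    and sum: "\<And>y. y \<in> O' \<Longrightarrow> of_real (h y v v) * (z y + z' y) = - 2 * of_real (h y v w)"
    and prod: "\<And>y. y \<in> O' \<Longrightarrow> of_real (h y v v) * (z y * z' y) = of_real (h y w w)"
  shows "pd w z x + z' x * pd v z x = of_real (conn_coeff x) * z x - of_real (conn_coeff' x)"
    and "pd w (null_gm z) x + z' x * pd v (null_gm z) x = 2 * of_real (conn_coeff x) * null_gm z x"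
proof -
  have xU: "x \<in> U" using x O' by blast
  note bl = h_bilinear[OF xU] and bg = gm_bilinear[OF xU]
  have dz: "z differentiable (at x)" by (rule smooth_on_differentiable[OF O'(1) z x])
  note d = diff[OF smooth_h xU] diff[OF smooth_gm xU]
  let ?r = "of_real :: real \<Rightarrow> 'a"
  define H11 H12 H22 where "H11 = ?r (h x v v)" and "H12 = ?r (h x v w)"
    and "H22 = ?r (h x w w)"
  have H0: "H11 \<noteq> 0" using h11 by (simp add: H11_def)
  have sum': "z x + z' x = of_real (- 2 * h x v w / h x v v)"
    using sum[OF x] h11 by (simp add: field_simps)
  have prod': "z x * z' x = of_real (h x w w / h x v v)"
    using prod[OF x] h11 by (simp add: field_simps)
  have quad: "of_real (h y v v) * (z y)\<^sup>2 + 2 * of_real (h y v w) * z y + of_real (h y w w) = 0" if "y \<in> O'" for y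
    using sum[OF that] prod[OF that] by algebra
  have root: "H11 * (z x)\<^sup>2 + 2 * H12 * z x + H22 = 0"
    using quad[OF x] by (simp add: H11_def H12_def H22_def)
  have "2 * (H12 + z x * H11) = H11 * (z x - z' x)"
    using sum[OF x] unfolding H11_def H12_def by algebra
  then have nz: "H12 + z x * H11 \<noteq> 0" using H0 ne by (metis mult_eq_0_iff mult_zero_right eq_iff_diff_eq_0)
  have cubic: "of_real (T w w w) + (z x + z' x) * of_real (T v w w) + z x * z' x * of_real (T v v w)
      + z x * (of_real (T v w w) + (z x + z' x) * of_real (T v v w) + z x * z' x * of_real (T v v v)) = (0::'a)"
    if T: "\<And>u. tr2 (h x) (T u) v w = 0" and T1: "\<And>a b c. T a b c = T b a c" and T2: "\<And>a b c. T a b c = T a c b"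
    for T :: "real^2 \<Rightarrow> real^2 \<Rightarrow> real^2 \<Rightarrow> real"
  proof -
    have t: "T u w w + (- 2 * h x v w / h x v v) * T u v w + (h x w w / h x v v) * T u v v = 0" for u
      using T[of u] h11 unfolding tr2_def by (simp add: field_simps)
    have "of_real (T w w w) + (z x + z' x) * of_real (T v w w) + z x * z' x * of_real (T v v w)
      + z x * (of_real (T v w w) + (z x + z' x) * of_real (T v v w) + z x * z' x * of_real (T v v v))
      = of_real (T w w w + (- 2 * h x v w / h x v v) * T w v w + (h x w w / h x v v) * T w v v)
        + z x * of_real (T v w w + (- 2 * h x v w / h x v v) * T v v w + (h x w w / h x v v) * T v v v)"
      unfolding sum' prod' using T1[of w v] T2[of v w v] by simp
    then show ?thesis unfolding t by simp
  qed
  note Cd = cubic[of "C x", OF tr_C[OF xU] C_swap12[OF xU] C_swap23[OF xU]]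
  note Gd = cubic[of "G x", OF tr_G[OF xU] G_swap12[OF xU] G_swap23[OF xU]]
  have hp: "pd u (\<lambda>y. h y a b) x = C x u a b + (cv (\<Gamma> x u a) * h x v b + cw (\<Gamma> x u a) * h x w b)
      + (cv (\<Gamma> x u b) * h x a v + cw (\<Gamma> x u b) * h x a w)" for u a b
    using bilinear_coordinates(1)[OF bl, of "\<Gamma> x u a" b] bilinear_coordinates(2)[OF bl, of a "\<Gamma> x u b"]
    by (simp add: C_def)
  have gp: "pd u (\<lambda>y. gm y a b) x = G x u a b + (cv (\<Gamma> x u a) * gm x v b + cw (\<Gamma> x u a) * gm x w b)
      + (cv (\<Gamma> x u b) * gm x a v + cw (\<Gamma> x u b) * gm x a w)" for u a b
    using bilinear_coordinates(1)[OF bg, of "\<Gamma> x u a" b] bilinear_coordinates(2)[OF bg, of a "\<Gamma> x u b"]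
    by (simp add: G_def)
  let ?D = "\<lambda>f. of_real (pd w f x) + z' x * of_real (pd v f x) :: 'a"
  define c1 c2 c3 c4 where "c1 = ?r (C x v v v)" and "c2 = ?r (C x v v w)"
    and "c3 = ?r (C x v w w)" and "c4 = ?r (C x w w w)"
  define d1 d2 d3 d4 where "d1 = ?r (G x v v v)" and "d2 = ?r (G x v v w)"
    and "d3 = ?r (G x v w w)" and "d4 = ?r (G x w w w)"
  define p1 p2 p3 where "p1 = ?r (cv (\<Gamma> x v v))" and "p2 = ?r (cv (\<Gamma> x v w))"
    and "p3 = ?r (cv (\<Gamma> x w w))"
  define q1 q2 q3 where "q1 = ?r (cw (\<Gamma> x v v))" and "q2 = ?r (cw (\<Gamma> x v w))"
    and "q3 = ?r (cw (\<Gamma> x w w))"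
  define G11 G12 G22 where "G11 = ?r (gm x v v)" and "G12 = ?r (gm x v w)"
    and "G22 = ?r (gm x w w)"
  note defs = H11_def H12_def H22_def c1_def c2_def c3_def c4_def d1_def d2_def d3_def d4_def
    p1_def p2_def p3_def q1_def q2_def q3_def G11_def G12_def G22_def
  have Cs: "C x w v v = C x v v w" "C x w v w = C x v w w"
    and Gs: "G x w v v = G x v v w" "G x w v w = G x v w w"
    using C_swap12[OF xU] C_swap23[OF xU] G_swap12[OF xU] G_swap23[OF xU] by metis+
  have syms: "\<Gamma> x w v = \<Gamma> x v w" "h x w v = h x v w" "gm x w v = gm x v w"
    by (rule \<Gamma>_sym[OF xU], rule h_sym[OF xU], rule gm_sym[OF xU])
  have dh: "?D (\<lambda>y. h y v v) = (c2 + 2 * (p2 * H11 + q2 * H12)) + z' x * (c1 + 2 * (p1 * H11 + q1 * H12))"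
      "?D (\<lambda>y. h y v w) = (c3 + (p2 * H12 + q2 * H22) + (p3 * H11 + q3 * H12))
        + z' x * (c2 + (p1 * H12 + q1 * H22) + (p2 * H11 + q2 * H12))"
      "?D (\<lambda>y. h y w w) = (c4 + 2 * (p3 * H12 + q3 * H22)) + z' x * (c3 + 2 * (p2 * H12 + q2 * H22))"
    unfolding hp Cs syms defs by simp_all
  have dg: "?D (\<lambda>y. gm y v v) = (d2 + 2 * (p2 * G11 + q2 * G12)) + z' x * (d1 + 2 * (p1 * G11 + q1 * G12))"
      "?D (\<lambda>y. gm y v w) = (d3 + (p2 * G12 + q2 * G22) + (p3 * G11 + q3 * G12))
        + z' x * (d2 + (p1 * G12 + q1 * G22) + (p2 * G11 + q2 * G12))"
      "?D (\<lambda>y. gm y w w) = (d4 + 2 * (p3 * G12 + q3 * G22)) + z' x * (d3 + 2 * (p2 * G12 + q2 * G22))"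
    unfolding gp Gs syms defs by simp_all
  define Dz where "Dz = pd w z x + z' x * pd v z x"
  have pdq: "pd u (\<lambda>y. of_real (h y v v) * (z y)\<^sup>2 + 2 * of_real (h y v w) * z y + of_real (h y w w)) x = 0" for u
  proof -
    have "pd u (\<lambda>y. of_real (h y v v) * (z y)\<^sup>2 + 2 * of_real (h y v w) * z y + of_real (h y w w)) x
        = pd u (\<lambda>_. 0) x"
      by (rule pd_transform[OF O'(1) x]) (use quad in auto)
    then show ?thesis by simp
  qed
  have "?D (\<lambda>y. h y v v) * (z x)\<^sup>2 + 2 * ?D (\<lambda>y. h y v w) * z x + ?D (\<lambda>y. h y w w) + 2 * (H11 * z x + H12) * Dz
      = pd w (\<lambda>y. of_real (h y v v) * (z y)\<^sup>2 + 2 * of_real (h y v w) * z y + of_real (h y w w)) x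
        + z' x * pd v (\<lambda>y. of_real (h y v v) * (z y)\<^sup>2 + 2 * of_real (h y v w) * z y + of_real (h y w w)) x"
    unfolding pd_quadratic[OF d(1) d(1) d(1) dz] Dz_def H11_def H12_def by (simp add: algebra_simps)
  then have droot: "?D (\<lambda>y. h y v v) * (z x)\<^sup>2 + 2 * ?D (\<lambda>y. h y v w) * z x + ?D (\<lambda>y. h y w w)
      + 2 * (H11 * z x + H12) * Dz = 0" by (simp add: pdq)
  note res = null_direction_algebra[OF root nz Cd[folded c1_def c2_def c3_def c4_def] Gd[folded d1_def d2_def d3_def d4_def] dh dg droot]
  have \<alpha>: "q3 + (z x + z' x) * q2 + z x * z' x * q1 = of_real (conn_coeff x)"
    unfolding sum' prod' conn_coeff_def defs by simp
  have \<kappa>: "p3 + (z x + z' x) * p2 + z x * z' x * p1 = of_real (conn_coeff' x)"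
    unfolding sum' prod' conn_coeff'_def defs by simp
  show "pd w z x + z' x * pd v z x = of_real (conn_coeff x) * z x - of_real (conn_coeff' x)"
    using res(1) unfolding \<alpha> \<kappa> Dz_def .
  have "pd w (null_gm z) x + z' x * pd v (null_gm z) x
      = ?D (\<lambda>y. gm y v v) * (z x)\<^sup>2 + 2 * ?D (\<lambda>y. gm y v w) * z x + ?D (\<lambda>y. gm y w w) + 2 * (G11 * z x + G12) * Dz"
    unfolding null_gm_def[abs_def] pd_quadratic[OF d(2) d(2) d(2) dz] Dz_def G11_def G12_def by (simp add: algebra_simps)
  then show "pd w (null_gm z) x + z' x * pd v (null_gm z) x = 2 * of_real (conn_coeff x) * null_gm z x"
    using res(2) unfolding \<alpha> null_gm_def G11_def G12_def G22_def by simp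
qed

lemma det_h_smooth: "smooth_on U det_h"
  unfolding det_h_def by (intro smooth_intros U smooth_h)

text \<open>For a definite metric the two null directions are conjugate, and \<open>null_gm_product\<close> identifies
  \<open>|\<gamma>(d, d)|\<^sup>2\<close> with \<open>disc\<close> up to a positive factor.\<close>

lemma no_touching_definite:
  assumes x0: "x0 \<in> U" and v: "h x0 v v \<noteq> 0" and pos: "det_h x0 > 0" and ne: "p \<noteq> x0"
    and zero: "\<And>y. y \<in> U \<Longrightarrow> dist p y < dist p x0 \<Longrightarrow> disc y = 0"
    and near: "\<And>e. e > 0 \<Longrightarrow> \<exists>y\<in>U. dist y x0 < e \<and> disc y \<noteq> 0"
  shows False
proof -
  define O' where "O' = {y\<in>U. (h y v v)\<^sup>2 * det_h y > 0}"
  have O': "open O'" "O' \<subseteq> U" "x0 \<in> O'"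
    unfolding O'_def using x0 v pos
    by (auto intro!: open_superlevel U smooth_on_continuous smooth_intros smooth_h det_h_smooth)
  have h11: "h y v v \<noteq> 0" and dh: "det_h y > 0" if "y \<in> O'" for y
    using that unfolding O'_def by (auto simp: zero_less_mult_iff not_less)
  have s: "smooth_on O' (\<lambda>y. h y a b)" "smooth_on O' det_h" for a b
    using smooth_on_subset[OF smooth_h O'(2)] smooth_on_subset[OF det_h_smooth O'(2)] by auto
  define z where "z y = of_real (- h y v w / h y v v) + \<i> * of_real (sqrt (det_h y) / h y v v)" for y
  have z: "smooth_on O' z" unfolding z_def
    by (intro smooth_intros O' s) (use h11 dh in auto)
  have sum: "of_real (h y v v) * (z y + cnj (z y)) = - 2 * of_real (h y v w)" if "y \<in> O'" for y
    using h11[OF that] by (simp add: z_def complex_eq_iff)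
  have prod: "of_real (h y v v) * (z y * cnj (z y)) = of_real (h y w w)" if "y \<in> O'" for y
  proof -
    have "h y v v * ((- h y v w / h y v v)\<^sup>2 + (sqrt (det_h y) / h y v v)\<^sup>2) = h y w w"
      using h11[OF that] dh[OF that] unfolding power_divide real_sqrt_pow2[OF less_imp_le[OF dh[OF that]]]
      by (simp add: det_h_def power2_eq_square field_simps)
    moreover have "z y * cnj (z y) = of_real ((- h y v w / h y v v)\<^sup>2 + (sqrt (det_h y) / h y v v)\<^sup>2)"
    proof -
      have "(of_real a + \<i> * of_real b) * cnj (of_real a + \<i> * of_real b) = of_real (a\<^sup>2 + b\<^sup>2)" for a b
        by (simp add: complex_eq_iff power2_eq_square)
      then show ?thesis unfolding z_def .
    qed
    ultimately show ?thesis by (metis of_real_mult)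
  qed
  have Im: "Im (z y) \<noteq> 0" if "y \<in> O'" for y
    using h11[OF that] dh[OF that] by (simp add: z_def)
  then have ne': "z y \<noteq> cnj (z y)" if "y \<in> O'" for y using that by (metis complex_cnj_cancel_iff equal_neg_zero cnj.simps(2))
  have zero_iff: "null_gm z y = 0 \<longleftrightarrow> disc y = 0" if "y \<in> O'" for y
  proof -
    have yU: "y \<in> U" using that O' by blast
    have "null_gm (\<lambda>y. cnj (z y)) y = cnj (null_gm z y)" by (simp add: null_gm_def)
    then have "(of_real (h y v v))\<^sup>2 * (null_gm z y * cnj (null_gm z y)) = of_real ((det_h y)\<^sup>2 * disc y)"
      using null_gm_product[OF yU, of z "\<lambda>y. cnj (z y)"] sum[OF that] prod[OF that] by simp
    moreover have "(of_real (h y v v))\<^sup>2 \<noteq> (0::complex)" "(det_h y)\<^sup>2 \<noteq> 0" using h11[OF that] dh[OF that] by auto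
    ultimately show ?thesis by (metis complex_cnj_zero_iff mult_eq_0_iff of_real_eq_0_iff)
  qed
  have eqs: "pd w z y + cnj (z y) * pd v z y = of_real (conn_coeff y) * z y - of_real (conn_coeff' y)"
    "pd w (null_gm z) y + cnj (z y) * pd v (null_gm z) y = 2 * of_real (conn_coeff y) * null_gm z y"
    if y: "y \<in> O'" for y
    by (rule null_direction_equations[OF O'(1,2) y z h11[OF y] ne'[OF y] sum prod], assumption+)+
  have indep: "n = 0" if "n \<bullet> v = 0" "n \<bullet> w = 0" for n
  proof -
    have "n \<bullet> n = 0" using coordinates[of n] that by (metis add.right_neutral inner_add_right inner_scaleR_right mult_zero_right)
    then show ?thesis by simp
  qed
  show False
  proof (rule continuation_along_complex_field[OF O'(1,3) smooth_null_gm[OF O'(1,2) z] z smooth_conn_coeff[OF O'(1,2) h11] indep Im _ _ _ _ ne])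
    fix y assume y: "y \<in> O'"
    show "cderiv (\<lambda>y. cnj (z y)) v w z y - cnj (cderiv (\<lambda>y. cnj (z y)) v w z y)
        = conn_coeff y * (z y - cnj (z y))"
      unfolding cderiv_def eqs(1)[OF y] by (simp add: algebra_simps)
    show "cderiv (\<lambda>y. cnj (z y)) v w (null_gm z) y = 2 * conn_coeff y * null_gm z y"
      unfolding cderiv_def eqs(2)[OF y] by simp
    show "null_gm z y = 0" if "dist p y < dist p x0"
      using zero_iff[OF y] zero[of y] y O'(2) that by blast
  next
    show "\<exists>y\<in>O'. dist y x0 < e \<and> null_gm z y \<noteq> 0" if "e > 0" for e
      using near_in_neighbourhood[OF O'(1,3) near that] zero_iff by blast
  qed
qed

text \<open>For an indefinite metric the sign \<open>\<epsilon>\<close> selects one of two real null directions, and at least one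
  of them is transversal to the sphere. Diagonalizability enters here: \<open>null_gm_product\<close> only shows
  that one of the two null components of \<open>\<gamma>\<close> vanishes with \<open>disc\<close>, but a scalar \<open>S\<close> makes
  both vanish.\<close>

lemma no_touching_indefinite:
  assumes x0: "x0 \<in> U" and v: "h x0 v v \<noteq> 0" and neg: "det_h x0 < 0" and ne: "p \<noteq> x0"
    and zero: "\<And>y. y \<in> U \<Longrightarrow> dist p y < dist p x0 \<Longrightarrow> disc y = 0"
    and near: "\<And>e. e > 0 \<Longrightarrow> \<exists>y\<in>U. dist y x0 < e \<and> disc y \<noteq> 0"
  shows False
proof -
  define O' where "O' = {y\<in>U. - ((h y v v)\<^sup>2 * det_h y) > 0}"
  have "open O'"
    unfolding O'_def by (intro open_superlevel U smooth_on_continuous smooth_intros smooth_h det_h_smooth)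
  then have O': "open O'" "O' \<subseteq> U" "x0 \<in> O'"
    unfolding O'_def using x0 v neg by (auto simp: mult_less_0_iff)
  have h11: "h y v v \<noteq> 0" and dh: "- det_h y > 0" if "y \<in> O'" for y
    using that unfolding O'_def by (auto simp: mult_less_0_iff)
  have s: "smooth_on O' (\<lambda>y. h y a b)" "smooth_on O' det_h" for a b
    using smooth_on_subset[OF smooth_h O'(2)] smooth_on_subset[OF det_h_smooth O'(2)] by auto
  define z :: "real \<Rightarrow> real^2 \<Rightarrow> real" where "z \<epsilon> y = (- h y v w + \<epsilon> * sqrt (- det_h y)) / h y v v" for \<epsilon> y
  have z: "smooth_on O' (z \<epsilon>)" for \<epsilon> unfolding z_def
    by (intro smooth_intros O' s) (use h11 dh in auto)
  have sum: "of_real (h y v v) * (z \<epsilon> y + z (- \<epsilon>) y) = - 2 * of_real (h y v w)" if "y \<in> O'" for y \<epsilon>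
    using h11[OF that] by (simp add: z_def field_simps)
  have prod: "of_real (h y v v) * (z \<epsilon> y * z (- \<epsilon>) y) = of_real (h y w w)" if "y \<in> O'" "\<epsilon>\<^sup>2 = 1" for y \<epsilon>
  proof -
    have "h y v v * (z \<epsilon> y * z (- \<epsilon>) y) = ((h y v w)\<^sup>2 - \<epsilon>\<^sup>2 * (sqrt (- det_h y))\<^sup>2) / h y v v"
      using h11[OF that(1)] by (simp add: z_def power2_eq_square field_simps)
    also have "\<dots> = h y w w"
      using h11[OF that(1)] unfolding that(2) real_sqrt_pow2[OF less_imp_le[OF dh[OF that(1)]]]
      by (simp add: det_h_def power2_eq_square)
    finally show ?thesis by simp
  qed
  have ne': "z \<epsilon> y \<noteq> z (- \<epsilon>) y" if "y \<in> O'" "\<epsilon>\<^sup>2 = 1" for y \<epsilon>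
    using h11[OF that(1)] dh[OF that(1)] that(2) by (auto simp: z_def)
  have zero_iff: "null_gm (z \<epsilon>) y = 0 \<longleftrightarrow> disc y = 0" if y: "y \<in> O'" and \<epsilon>: "\<epsilon>\<^sup>2 = 1" for y \<epsilon>
  proof
    have yU: "y \<in> U" using y O' by blast
    show "disc y = 0" if "null_gm (z \<epsilon>) y = 0"
      using null_gm_product[where z = "z \<epsilon>" and z' = "z (- \<epsilon>)", OF yU sum[OF y] prod[OF y \<epsilon>]] that dh[OF y] by simp
    assume "disc y = 0"
    then have S: "S y a = (tr y / 2) *\<^sub>R a" for a using S_scalar_iff_disc_zero[OF yU] by blast
    have g: "gm y a b = tr y / 2 * h y a b" for a b
      unfolding gm_def S bilinear_lmul[OF h_bilinear[OF yU]] by simp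
    have "null_gm (z \<epsilon>) y = tr y / 2 * (h y v v * (z \<epsilon> y)\<^sup>2 - (- 2 * h y v w) * z \<epsilon> y + h y w w)"
      by (simp add: null_gm_def g algebra_simps)
    also have "\<dots> = 0"
      using sum[OF y, of \<epsilon>, symmetric] prod[OF y \<epsilon>, symmetric]
      by (simp add: power2_eq_square algebra_simps)
    finally show "null_gm (z \<epsilon>) y = 0" .
  qed
  have "\<exists>\<epsilon>. \<epsilon>\<^sup>2 = 1 \<and> (x0 - p) \<bullet> (w + z (- \<epsilon>) x0 *\<^sub>R v) \<noteq> 0"
  proof (rule ccontr)
    assume c: "\<not> ?thesis"
    have "(x0 - p) \<bullet> (w + z (- \<epsilon>) x0 *\<^sub>R v) = 0" if "\<epsilon>\<^sup>2 = 1" for \<epsilon> using c that by blast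
    from this[of 1] this[of "-1"]
    have e: "(x0 - p) \<bullet> w + z (- 1) x0 * ((x0 - p) \<bullet> v) = 0" "(x0 - p) \<bullet> w + z 1 x0 * ((x0 - p) \<bullet> v) = 0"
      by (simp_all add: inner_add_right)
    then have "(z 1 x0 - z (- 1) x0) * ((x0 - p) \<bullet> v) = 0" by algebra
    then have "(x0 - p) \<bullet> v = 0" using ne'[OF O'(3), of 1] by simp
    moreover then have "(x0 - p) \<bullet> w = 0" using e by simp
    ultimately have "(x0 - p) \<bullet> (x0 - p) = 0"
      using coordinates[of "x0 - p"] by (metis add.right_neutral inner_add_right inner_scaleR_right mult_zero_right)
    then show False using ne by simp
  qed
  then obtain \<epsilon> where \<epsilon>: "\<epsilon>\<^sup>2 = 1" and trans: "(x0 - p) \<bullet> (w + z (- \<epsilon>) x0 *\<^sub>R v) \<noteq> 0" by blast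
  note W = smooth_null_gm[OF O'(1,2) z[of \<epsilon>]]
  have eqs: "pd w (null_gm (z \<epsilon>)) y + z (- \<epsilon>) y * pd v (null_gm (z \<epsilon>)) y
      = 2 * of_real (conn_coeff y) * null_gm (z \<epsilon>) y" if y: "y \<in> O'" for y
    by (rule null_direction_equations(2)[OF O'(1,2) y z h11[OF y] ne'[OF y \<epsilon>] sum prod[OF _ \<epsilon>]], assumption+)
  show False
  proof (rule continuation_along_transversal_field[OF O'(1,3) W, where b = "\<lambda>y. w + z (- \<epsilon>) y *\<^sub>R v" and a = "\<lambda>y. 2 * conn_coeff y"])
    show "continuous_on O' (\<lambda>y. w + z (- \<epsilon>) y *\<^sub>R v)"
      by (intro continuous_intros smooth_on_continuous z)
    show "continuous_on O' (\<lambda>y. 2 * conn_coeff y)"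
      by (intro continuous_intros smooth_on_continuous smooth_conn_coeff[OF O'(1,2) h11])
    show "(x0 - p) \<bullet> (w + z (- \<epsilon>) x0 *\<^sub>R v) \<noteq> 0" by (rule trans)
    fix y assume y: "y \<in> O'"
    show "pd (w + z (- \<epsilon>) y *\<^sub>R v) (null_gm (z \<epsilon>)) y = 2 * conn_coeff y * null_gm (z \<epsilon>) y"
      using eqs[OF y] smooth_on_differentiable[OF O'(1) W y]
      by (simp add: pd_add_dir pd_scaleR_dir)
    show "null_gm (z \<epsilon>) y = 0" if "dist p y < dist p x0"
      using zero_iff[OF y \<epsilon>] zero[of y] y O'(2) that by blast
  next
    show "\<exists>y\<in>O'. dist y x0 < e \<and> null_gm (z \<epsilon>) y \<noteq> 0" if "e > 0" for e
      using near_in_neighbourhood[OF O'(1,3) near that] zero_iff[OF _ \<epsilon>] by blast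
  qed
qed

end

lemma nonnull_vector:
  assumes x: "x \<in> U"
  obtains v where "h x v v \<noteq> 0"
proof -
  have "h x e1 e1 \<noteq> 0 \<or> h x e2 e2 \<noteq> 0 \<or> h x (e1 + e2) (e1 + e2) \<noteq> 0"
    using det_h_nonzero[OF x] h_sym[OF x, of e1 e2]
    by (auto simp: bilinear_ladd[OF h_bilinear[OF x]] bilinear_radd[OF h_bilinear[OF x]])
  then show thesis using that by blast
qed

lemma no_touching:
  assumes x0: "x0 \<in> U" and ne: "p \<noteq> x0"
    and zero: "\<And>y. y \<in> U \<Longrightarrow> dist p y < dist p x0 \<Longrightarrow> disc y = 0"
    and near: "\<And>e. e > 0 \<Longrightarrow> \<exists>y\<in>U. dist y x0 < e \<and> disc y \<noteq> 0"
  shows False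
proof -
  obtain v where v: "h x0 v v \<noteq> 0" using nonnull_vector[OF x0] .
  define w :: "real^2" where "w = vector [- v$2, v$1]"
  have "v \<noteq> 0" using v bilinear_lzero[OF h_bilinear[OF x0]] by auto
  then have "v$1 \<noteq> 0 \<or> v$2 \<noteq> 0" by (auto simp: vec_eq_iff forall_2)
  then have \<delta>: "v$1 * w$2 - v$2 * w$1 \<noteq> 0" unfolding w_def by (simp add: sum_squares_eq_zero_iff)
  have "tr2 (h x0) (h x0) v w = (v$1 * w$2 - v$2 * w$1)\<^sup>2 * tr2 (h x0) (h x0) e1 e2"
    by (rule tr2_basis[OF h_bilinear[OF x0] h_bilinear[OF x0] h_sym[OF x0] h_sym[OF x0]])
  then have "2 * det_h v w x0 = (v$1 * w$2 - v$2 * w$1)\<^sup>2 * (2 * (h x0 e1 e1 * h x0 e2 e2 - (h x0 e1 e2)\<^sup>2))"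
    by (simp add: tr2_def det_h_def[OF \<delta>] power2_eq_square algebra_simps)
  then have "det_h v w x0 \<noteq> 0" using \<delta> det_h_nonzero[OF x0] by auto
  then consider "det_h v w x0 > 0" | "det_h v w x0 < 0" by linarith
  then show False
    using no_touching_definite[OF \<delta> x0 v _ ne zero near] no_touching_indefinite[OF \<delta> x0 v _ ne zero near]
    by cases blast+
qed

lemma disc_unique_continuation:
  assumes Q: "open Q" "connected Q" "Q \<subseteq> U" and B: "open B" "B \<noteq> {}" "B \<subseteq> Q"
    and zero: "\<And>y. y \<in> B \<Longrightarrow> disc y = 0" and x: "x \<in> Q"
  shows "disc x = 0"
proof (rule ccontr)
  assume "disc x \<noteq> 0"
  define V where "V = {y\<in>U. disc y \<noteq> 0}"
  have ne: "V \<inter> Q \<noteq> {}" using x Q(3) \<open>disc x \<noteq> 0\<close> by (auto simp: V_def)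
  have BV: "B \<inter> V = {}" using zero by (auto simp: V_def)
  obtain p r x0 where t: "r > 0" "x0 \<in> Q" "dist p x0 = r" "ball p r \<inter> V = {}"
    "\<And>e. e > 0 \<Longrightarrow> \<exists>y\<in>V. dist y x0 < e"
    using touching_ball[OF Q(1,2) ne B BV] by metis
  show False
  proof (rule no_touching)
    show "x0 \<in> U" using t(2) Q(3) by blast
    show "p \<noteq> x0" using t(1,3) by auto
    show "disc y = 0" if "y \<in> U" "dist p y < dist p x0" for y
      using that t(3,4) by (auto simp: V_def)
    show "\<exists>y\<in>U. dist y x0 < e \<and> disc y \<noteq> 0" if "e > 0" for e
      using t(5)[OF that] by (auto simp: V_def)
  qed
qed

lemma parallel_curvature_if_dense:
  assumes dense: "\<And>x e. x \<in> U \<Longrightarrow> e > 0 \<Longrightarrow> \<exists>y\<in>U. dist y x < e \<and> disc y \<noteq> 0"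
  shows "parallel_curvature U nabla"
proof (rule parallel_curvature_if, rule ccontr)
  fix x u v w assume x: "x \<in> U" and nz: "G x u v w \<noteq> 0"
  have "continuous_on U (\<lambda>y. \<bar>G y u v w\<bar>)" by (intro continuous_intros smooth_on_continuous smooth_G)
  then have "open {y\<in>U. \<bar>G y u v w\<bar> > 0}" by (rule open_superlevel[OF U])
  moreover have "x \<in> {y\<in>U. \<bar>G y u v w\<bar> > 0}" using x nz by simp
  ultimately obtain e where e: "e > 0" "ball x e \<subseteq> {y\<in>U. \<bar>G y u v w\<bar> > 0}" using openE by blast
  obtain y where y: "y \<in> U" "dist y x < e" "disc y \<noteq> 0" using dense[OF x e(1)] by blast
  then have "G y u v w \<noteq> 0" using e(2) by (auto simp: dist_commute)
  then show False using G_zero_if_disc_nonzero[OF y(1,3)] by simp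
qed

lemma scalar_iff: "x \<in> U \<Longrightarrow> (\<exists>H. \<forall>v. S x v = H *\<^sub>R v) \<longleftrightarrow> disc x = 0"
proof
  assume x: "x \<in> U" and "\<exists>H. \<forall>v. S x v = H *\<^sub>R v"
  then obtain H where H: "\<And>v. S x v = H *\<^sub>R v" by blast
  then have "tr x / 2 = H" by (simp add: tr_def axis_nth2)
  then show "disc x = 0" using S_scalar_iff_disc_zero[OF x] H by simp
qed (use S_scalar_iff_disc_zero in blast)

text \<open>The trace of \<open>S\<close> is continuous and takes at most the two values with \<open>(tr S)\<^sup>2 = 4 \<tau>\<close>.\<close>

lemma scalar_locally_constant:
  assumes Q: "connected Q" "Q \<subseteq> U" and scalar: "\<And>y. y \<in> Q \<Longrightarrow> \<exists>H. \<forall>v. S y v = H *\<^sub>R v"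
  obtains H where "\<And>y v. y \<in> Q \<Longrightarrow> S y v = H *\<^sub>R v"
proof -
  have tr: "(tr y)\<^sup>2 = 4 * \<tau>" if "y \<in> Q" for y
    using scalar_iff[of y] scalar[OF that] Q(2) that by (auto simp: disc_def)
  have "tr ` Q \<subseteq> {sqrt (4 * \<tau>), - sqrt (4 * \<tau>)}"
  proof
    fix t assume "t \<in> tr ` Q"
    then have "t\<^sup>2 = 4 * \<tau>" using tr by auto
    then have "\<bar>t\<bar> = sqrt (4 * \<tau>)" by (metis real_sqrt_abs)
    then show "t \<in> {sqrt (4 * \<tau>), - sqrt (4 * \<tau>)}" by (auto simp: abs_if split: if_splits)
  qed
  then have "finite (tr ` Q)" by (rule finite_subset) simp
  moreover have "continuous_on Q tr" using smooth_on_continuous[OF smooth_tr] Q(2) continuous_on_subset by blast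
  ultimately have "tr constant_on Q" using continuous_finite_range_constant[OF Q(1)] by blast
  then obtain t where t: "\<And>y. y \<in> Q \<Longrightarrow> tr y = t" unfolding constant_on_def by blast
  have "S y v = (t / 2) *\<^sub>R v" if "y \<in> Q" for y v
    using S_scalar_iff_disc_zero[of y] scalar_iff[of y] scalar[OF that] Q(2) that t[OF that] by auto
  then show thesis using that by blast
qed

end


section \<open>From charts to the surface\<close>

text \<open>The points where \<open>P\<close> holds form a set that is both open and closed.\<close>

lemma connected_space_propagate:
  assumes M: "connected_space M" and p0: "p0 \<in> topspace M" "P p0" and p: "p \<in> topspace M"
    and loc: "\<And>p. p \<in> topspace M \<Longrightarrow> \<exists>N. openin M N \<and> p \<in> N \<and> (\<forall>q\<in>N. P q \<longrightarrow> (\<forall>q'\<in>N. P q'))"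
  shows "P p"
proof -
  define T where "T = {p\<in>topspace M. P p}"
  have "openin M T"
    unfolding openin_subopen[of M T]
  proof
    fix x assume "x \<in> T"
    then obtain N where "openin M N" "x \<in> N" "\<forall>q'\<in>N. P q'" using loc[of x] by (auto simp: T_def)
    moreover from this have "N \<subseteq> T" using openin_subset[of M N] by (auto simp: T_def)
    ultimately show "\<exists>N. openin M N \<and> x \<in> N \<and> N \<subseteq> T" by blast
  qed
  moreover have "openin M (topspace M - T)"
    unfolding openin_subopen[of M "topspace M - T"]
  proof
    fix x assume x: "x \<in> topspace M - T"
    then obtain N where N: "openin M N" "x \<in> N" "\<forall>q\<in>N. P q \<longrightarrow> (\<forall>q'\<in>N. P q')" using loc[of x] by auto
    then have "N \<subseteq> topspace M - T" using x openin_subset[of M N] by (auto simp: T_def)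
    then show "\<exists>N. openin M N \<and> x \<in> N \<and> N \<subseteq> topspace M - T" using N by blast
  qed
  then have "closedin M T" by (auto simp: closedin_def T_def)
  ultimately have "T = {} \<or> T = topspace M" using M connected_space_clopen_in by metis
  then show ?thesis using p0 p by (auto simp: T_def)
qed

lemma topspace_chart:
  assumes "is_chart M c"
  shows "topspace (subtopology M (fst c)) = fst c"
  using assms openin_subset[of M "fst c"] by (auto simp: is_chart_def)

lemma chart_inverse:
  assumes "is_chart M c"
  shows "p \<in> fst c \<Longrightarrow> snd c p \<in> coord_dom c"
    and "p \<in> fst c \<Longrightarrow> inv_into (fst c) (snd c) (snd c p) = p"
    and "x \<in> coord_dom c \<Longrightarrow> inv_into (fst c) (snd c) x \<in> fst c"
    and "x \<in> coord_dom c \<Longrightarrow> snd c (inv_into (fst c) (snd c) x) = x"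
proof -
  have inj: "inj_on (snd c) (fst c)"
    using assms homeomorphic_imp_injective_map topspace_chart[OF assms] unfolding is_chart_def by metis
  show "p \<in> fst c \<Longrightarrow> snd c p \<in> coord_dom c" by (simp add: coord_dom_def)
  show "p \<in> fst c \<Longrightarrow> inv_into (fst c) (snd c) (snd c p) = p" using inj by simp
  show "x \<in> coord_dom c \<Longrightarrow> inv_into (fst c) (snd c) x \<in> fst c" by (simp add: coord_dom_def inv_into_into)
  show "x \<in> coord_dom c \<Longrightarrow> snd c (inv_into (fst c) (snd c) x) = x" by (simp add: coord_dom_def f_inv_into_f)
qed

lemma openin_chart_preimage:
  assumes c: "is_chart M c" and W: "open W"
  shows "openin M {p \<in> fst c. snd c p \<in> W}"
proof -
  have ts: "topspace (subtopology M (fst c)) = fst c" and o: "openin M (fst c)"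
    using topspace_chart[OF c] c by (simp_all add: is_chart_def)
  have cont: "continuous_map (subtopology M (fst c)) (top_of_set (coord_dom c)) (snd c)"
    using c homeomorphic_imp_continuous_map unfolding is_chart_def by blast
  have "openin (top_of_set (coord_dom c)) (coord_dom c \<inter> W)" using W by (simp add: openin_open_Int)
  then have "openin (subtopology M (fst c)) {p \<in> topspace (subtopology M (fst c)). snd c p \<in> coord_dom c \<inter> W}"
    using cont openin_continuous_map_preimage by blast
  moreover have "{p \<in> topspace (subtopology M (fst c)). snd c p \<in> coord_dom c \<inter> W} = {p \<in> fst c. snd c p \<in> W}"
    unfolding ts by (auto simp: coord_dom_def)
  ultimately show ?thesis using openin_trans_full[OF _ o] by auto
qed

lemma open_chart_image:
  assumes c: "is_chart M c" and N: "openin M N"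
  shows "open (snd c ` (N \<inter> fst c))"
proof -
  have op: "open_map (subtopology M (fst c)) (top_of_set (coord_dom c)) (snd c)"
    using c homeomorphic_imp_open_map unfolding is_chart_def by blast
  have "openin (subtopology M (fst c)) (N \<inter> fst c)" using N by (rule openin_subtopology_Int)
  then have "openin (top_of_set (coord_dom c)) (snd c ` (N \<inter> fst c))"
    using op unfolding open_map_def by blast
  then show ?thesis using c openin_open_trans unfolding is_chart_def by blast
qed

lemma push_eq: "push c f x v = pd v (coord_rep c f) x"
  by (simp add: push_def pd_def)

lemma blaschke_chart_of_structure:
  assumes "surface M A" "immersion A f" "nondegenerate A h" "blaschke_structure A f \<xi> nabla h S"
    and "\<forall>c\<in>A. projectively_flat (coord_dom c) (nabla c)"
    and "\<forall>c\<in>A. \<forall>x\<in>coord_dom c. det (matrix (S c x)) = \<tau>"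
    and "\<forall>c\<in>A. \<forall>x\<in>coord_dom c. C_diagonalizable (S c x)"
    and c: "c \<in> A"
  shows "blaschke_chart (coord_dom c) (coord_rep c f) (coord_rep c \<xi>) (nabla c) (h c) (S c) \<tau>"
proof -
  have eq: "equiaffine_structure A f \<xi> nabla h S" and ap: "apolar (coord_dom c) (nabla c) (h c)"
    using assms(4) c by (auto simp: blaschke_structure_def)
  have p: "push c g x = (\<lambda>v. pd v (coord_rep c g) x)" for g :: "'a \<Rightarrow> real^3" and x
    by (rule ext) (rule push_eq)
  show ?thesis
  proof (rule blaschke_chart.intro)
    show "open (coord_dom c)"
      using assms(1) c by (auto simp: surface_def smooth_2_manifold_def is_chart_def)
    show "smooth_on (coord_dom c) (coord_rep c f)"
      using assms(2) c by (auto simp: immersion_def smooth_fun_def)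
    show "inj (\<lambda>v. pd v (coord_rep c f) x)" if "x \<in> coord_dom c" for x
      using assms(2) c that by (auto simp: immersion_def p)
    show "\<exists>w. h c x v w \<noteq> 0" if "x \<in> coord_dom c" "v \<noteq> 0" for x v
      using assms(3) c that by (auto simp: nondegenerate_def)
    show "apolar (coord_dom c) (nabla c) (h c)" by (rule ap)
    show "projectively_flat (coord_dom c) (nabla c)" using assms(5) c by blast
    show "det (matrix (S c x)) = \<tau>" "C_diagonalizable (S c x)" if "x \<in> coord_dom c" for x
      using assms(6,7) c that by blast+
    show "smooth_on (coord_dom c) (coord_rep c \<xi>)"
      using eq c by (auto simp: equiaffine_structure_def smooth_fun_def)
    show "bilinear (h c x)" "linear (S c x)" if "x \<in> coord_dom c" for x
      using eq c that unfolding equiaffine_structure_def by blast+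
    show "coord_rep c \<xi> x \<notin> range (\<lambda>v. pd v (coord_rep c f) x)" if "x \<in> coord_dom c" for x
      using eq c that unfolding equiaffine_structure_def p[symmetric] by blast
    show "pd v (coord_rep c \<xi>) x = - pd (S c x v) (coord_rep c f) x" if "x \<in> coord_dom c" for x v
      using eq c that unfolding equiaffine_structure_def push_eq[symmetric] by blast
    show "pd (X x) (\<lambda>y. pd (Y y) (coord_rep c f) y) x
        = pd (nabla c X Y x) (coord_rep c f) x + h c x (X x) (Y x) *\<^sub>R coord_rep c \<xi> x"
      if "smooth_on (coord_dom c) X" "smooth_on (coord_dom c) Y" "x \<in> coord_dom c" for X Y x
    proof -
      have "dir_deriv X (\<lambda>y. push c f y (Y y)) x
          = push c f x (nabla c X Y x) + h c x (X x) (Y x) *\<^sub>R coord_rep c \<xi> x"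
        using eq c that unfolding equiaffine_structure_def vfields_def by blast
      then show ?thesis by (simp add: dir_deriv_def push_def pd_def)
    qed
  qed
qed

lemma pd_compose:
  assumes "\<phi> differentiable (at y)" "F differentiable (at (\<phi> y))"
  shows "pd v (\<lambda>z. F (\<phi> z)) y = pd (pd v \<phi> y) F (\<phi> y)"
  using pd_eqI[OF has_derivative_compose[OF has_derivative_pd[OF assms(1)] has_derivative_pd[OF assms(2)]]] by simp

lemma coord_rep_transition:
  assumes M: "smooth_2_manifold M A" and cd: "c \<in> A" "d \<in> A" and p: "p \<in> fst c" "p \<in> fst d"
    and g: "smooth_on (coord_dom c) (coord_rep c g)"
  defines "\<phi> \<equiv> coord_rep d (snd c)"
  shows "pd v (coord_rep d g) (snd d p) = pd (pd v \<phi> (snd d p)) (coord_rep c g) (snd c p)"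
proof -
  have ch: "is_chart M c" "is_chart M d" using M cd by (auto simp: smooth_2_manifold_def)
  define O' where "O' = snd d ` (fst c \<inter> fst d)"
  have "open O'" unfolding O'_def using open_chart_image[OF ch(2), of "fst c"] ch(1) by (simp add: is_chart_def)
  have y: "snd d p \<in> O'" using p by (auto simp: O'_def)
  have "smooth_on O' \<phi>"
    unfolding O'_def \<phi>_def using M cd by (auto simp: smooth_2_manifold_def Int_commute)
  then have d\<phi>: "\<phi> differentiable (at (snd d p))"
    using smooth_on_differentiable[OF \<open>open O'\<close>] y by blast
  have \<phi>y: "\<phi> (snd d p) = snd c p" unfolding \<phi>_def coord_rep_def using chart_inverse(2)[OF ch(2) p(2)] by simp
  have oc: "open (coord_dom c)" using ch(1) by (simp add: is_chart_def)
  have dg: "coord_rep c g differentiable (at (\<phi> (snd d p)))"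
    unfolding \<phi>y using smooth_on_differentiable[OF oc g] chart_inverse(1)[OF ch(1) p(1)] by blast
  have eq: "coord_rep c g (\<phi> z) = coord_rep d g z" if "z \<in> O'" for z
  proof -
    obtain q where q: "q \<in> fst c" "q \<in> fst d" "z = snd d q" using \<open>z \<in> O'\<close> unfolding O'_def by blast
    then show ?thesis
      using chart_inverse(2)[OF ch(1) q(1)] chart_inverse(2)[OF ch(2) q(2)] by (simp add: coord_rep_def \<phi>_def)
  qed
  have "pd v (coord_rep d g) (snd d p) = pd v (\<lambda>z. coord_rep c g (\<phi> z)) (snd d p)"
    by (rule pd_transform[OF \<open>open O'\<close> y]) (use differentiable_chain_at[OF d\<phi> dg] eq in \<open>auto simp: o_def\<close>)
  then show ?thesis using pd_compose[OF d\<phi> dg] \<phi>y by simp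
qed

lemma affinely_equivalent_refl:
  assumes "smooth_2_manifold M A"
  shows "affinely_equivalent M A f M A f"
proof -
  have "smooth_map M A M A (\<lambda>p. p)"
    unfolding smooth_map_def
  proof (intro conjI ballI)
    show "continuous_map M M (\<lambda>p. p)" by simp
    fix c d assume "c \<in> A" "d \<in> A"
    then have "smooth_on (snd c ` (fst c \<inter> fst d)) (coord_rep c (snd d))"
      using assms by (auto simp: smooth_2_manifold_def)
    moreover have "{p \<in> fst c. p \<in> fst d} = fst c \<inter> fst d" by blast
    ultimately show "smooth_on (snd c ` {p \<in> fst c. p \<in> fst d}) (coord_rep c (snd d \<circ> (\<lambda>p. p)))"
      by (simp add: o_def)
  qed
  then have "diffeomorphism M A M A (\<lambda>p. p)" unfolding diffeomorphism_def by auto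
  moreover have "affine_transformation (\<lambda>x. x)"
    unfolding affine_transformation_def by (rule exI[of _ "\<lambda>x. x"]) (auto intro!: exI[of _ 0] linearI simp: bij_def)
  ultimately show ?thesis unfolding affinely_equivalent_def by blast
qed

text \<open>The property \<open>S = H Id\<close> in a neighbourhood propagates along \<open>M\<close> by connectedness: inside a chart
  through \<open>disc_unique_continuation\<close>, and from chart to chart because \<open>f\<close> and \<open>\<xi>\<close> determine it.\<close>

theorem theorem1:
  fixes M :: "'a topology" and A :: "'a chart set"
    and f \<xi> :: "'a \<Rightarrow> real^3"
    and nabla :: "'a chart \<Rightarrow> connection"
    and h :: "'a chart \<Rightarrow> metric"
    and S :: "'a chart \<Rightarrow> endo_field"
  assumes "surface M A" and "immersion A f"
    and "nondegenerate A h" and "blaschke_structure A f \<xi> nabla h S"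
    and "\<forall>c\<in>A. projectively_flat (coord_dom c) (nabla c)"
    and "\<exists>\<tau>::real. \<forall>c\<in>A. \<forall>x\<in>coord_dom c. det (matrix (S c x)) = \<tau>"
    and "\<forall>c\<in>A. \<forall>x\<in>coord_dom c. C_diagonalizable (S c x)"
  shows "\<exists>(N :: 'a topology) B g. affinely_equivalent M A f N B g \<and>
           (locally_symmetric_affine_surface N B g \<or> affine_sphere N B g)"
proof -
  obtain \<tau> where \<tau>: "\<forall>c\<in>A. \<forall>x\<in>coord_dom c. det (matrix (S c x)) = \<tau>" using assms(6) by blast
  have M: "smooth_2_manifold M A" and conn: "connected_space M" using assms(1) by (auto simp: surface_def)
  have ch: "is_chart M c" if "c \<in> A" for c using M that by (auto simp: smooth_2_manifold_def)
  have cover: "\<exists>c\<in>A. p \<in> fst c" if "p \<in> topspace M" for p using M that by (auto simp: smooth_2_manifold_def)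
  have topsp: "p \<in> topspace M" if "c \<in> A" "p \<in> fst c" for c p using M that by (auto simp: smooth_2_manifold_def)
  note B = blaschke_chart_of_structure[OF assms(1-5) \<tau> assms(7)]
  have trans: "S d (snd d p) v = H *\<^sub>R v"
    if cd: "c \<in> A" "d \<in> A" and p: "p \<in> fst c" "p \<in> fst d" and H: "\<And>v. S c (snd c p) v = H *\<^sub>R v" for c d p H v
  proof -
    interpret c: blaschke_chart "coord_dom c" "coord_rep c f" "coord_rep c \<xi>" "nabla c" "h c" "S c" \<tau> by (rule B[OF cd(1)])
    interpret d: blaschke_chart "coord_dom d" "coord_rep d f" "coord_rep d \<xi>" "nabla d" "h d" "S d" \<tau> by (rule B[OF cd(2)])
    have x: "snd c p \<in> coord_dom c" "snd d p \<in> coord_dom d" using p by (auto simp: coord_dom_def)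
    note t = coord_rep_transition[OF M cd p]
    have "- pd (S d (snd d p) v) (coord_rep d f) (snd d p) = - pd (H *\<^sub>R v) (coord_rep d f) (snd d p)"
      using d.weingarten[OF x(2), of v] t[OF c.\<xi>, of v] t[OF c.F, of v]
      by (simp add: c.weingarten[OF x(1)] H c.push_simps[OF x(1)] d.push_simps[OF x(2)])
    then show ?thesis using d.immersed[OF x(2)] by (auto dest: injD)
  qed
  \<comment> \<open>the eigenvalue \<open>H\<close> is characterized by \<open>d(\<xi> + H f) = 0\<close> at the point, hence the chart does not matter\<close>
  define sc where "sc H p \<longleftrightarrow> (\<forall>c\<in>A. p \<in> fst c \<longrightarrow> (\<forall>v. S c (snd c p) v = H *\<^sub>R v))" for H p
  define nbhd where "nbhd c Q = {q \<in> fst c. snd c q \<in> Q}" for c :: "'a chart" and Q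
  have nbhd: "openin M (nbhd c Q)" if "c \<in> A" "open Q" for c Q
    unfolding nbhd_def using openin_chart_preimage[OF ch[OF that(1)] that(2)] .
  have sc_const: "\<exists>H. \<forall>q\<in>nbhd c Q. sc H q"
    if c: "c \<in> A" and Q: "connected Q" "Q \<subseteq> coord_dom c" and z: "\<And>y. y \<in> Q \<Longrightarrow> \<exists>H. \<forall>v. S c y v = H *\<^sub>R v" for c Q
  proof -
    interpret c: blaschke_chart "coord_dom c" "coord_rep c f" "coord_rep c \<xi>" "nabla c" "h c" "S c" \<tau> by (rule B[OF c])
    obtain H where "\<And>y v. y \<in> Q \<Longrightarrow> S c y v = H *\<^sub>R v"
      by (rule c.scalar_locally_constant[OF Q z]) blast+
    then have "\<forall>q\<in>nbhd c Q. sc H q" unfolding sc_def nbhd_def using trans[OF c] by blast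
    then show ?thesis by blast
  qed
  define near where "near H p \<longleftrightarrow> (\<exists>N. openin M N \<and> p \<in> N \<and> (\<forall>q\<in>N. sc H q))" for H p
  show ?thesis
  proof (cases "\<exists>p0\<in>topspace M. \<exists>H. near H p0")
    case True
    then obtain p0 H where p0: "p0 \<in> topspace M" "near H p0" by blast
    have near: "near H p" if p: "p \<in> topspace M" for p
    proof (rule connected_space_propagate[where P = "near H", OF conn p0 p])
      fix p assume p: "p \<in> topspace M"
      obtain c where c: "c \<in> A" "p \<in> fst c" using cover[OF p] by blast
      interpret c: blaschke_chart "coord_dom c" "coord_rep c f" "coord_rep c \<xi>" "nabla c" "h c" "S c" \<tau> by (rule B[OF c(1)])
      have "snd c p \<in> coord_dom c" using c(2) by (simp add: coord_dom_def)
      then obtain e where e: "e > 0" "ball (snd c p) e \<subseteq> coord_dom c" using c.U openE by blast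
      define Q where "Q = ball (snd c p) e"
      have Q: "open Q" "connected Q" "Q \<subseteq> coord_dom c" using e by (auto simp: Q_def)
      have pN: "p \<in> nbhd c Q" using c(2) e(1) by (simp add: nbhd_def Q_def)
      have "near H q'" if q: "q \<in> nbhd c Q" "near H q" and q': "q' \<in> nbhd c Q" for q q'
      proof -
        obtain N where N: "openin M N" "q \<in> N" "\<forall>q\<in>N. sc H q" using q(2) unfolding near_def by blast
        define V where "V = snd c ` ((N \<inter> nbhd c Q) \<inter> fst c)"
        have V: "open V" "V \<noteq> {}" "V \<subseteq> Q"
          unfolding V_def using open_chart_image[OF ch[OF c(1)] openin_Int[OF N(1) nbhd[OF c(1) Q(1)]]] q(1) N(2)
          by (auto simp: nbhd_def)
        have "c.disc y = 0" if "y \<in> V" for y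
        proof -
          obtain r where "r \<in> N" "r \<in> fst c" "y = snd c r" using \<open>y \<in> V\<close> unfolding V_def by blast
          then have "\<forall>v. S c y v = H *\<^sub>R v" using N(3) c(1) unfolding sc_def by blast
          then show ?thesis using c.scalar_iff[of y] V(3) Q(3) \<open>y \<in> V\<close> by blast
        qed
        then have "\<exists>H. \<forall>v. S c y v = H *\<^sub>R v" if "y \<in> Q" for y
          using c.disc_unique_continuation[OF Q V _ that] c.scalar_iff[of y] Q(3) that by blast
        then obtain H' where H': "\<forall>q\<in>nbhd c Q. sc H' q" using sc_const[OF c(1) Q(2,3)] by blast
        have "\<forall>v. S c (snd c q) v = H' *\<^sub>R v" "\<forall>v. S c (snd c q) v = H *\<^sub>R v"
          using H' q(1) N(2,3) c(1) unfolding sc_def nbhd_def by blast+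
        then have "H' *\<^sub>R e1 = H *\<^sub>R e1" by metis
        then have "H' = H" by (simp add: vec_eq_iff forall_2 axis_def)
        then show ?thesis unfolding near_def using H' q' nbhd[OF c(1) Q(1)] by blast
      qed
      then show "\<exists>N. openin M N \<and> p \<in> N \<and> (\<forall>q\<in>N. near H q \<longrightarrow> (\<forall>q'\<in>N. near H q'))"
        using pN nbhd[OF c(1) Q(1)] by blast
    qed
    have "S c x v = H *\<^sub>R v" if "c \<in> A" "x \<in> coord_dom c" for c x v
    proof -
      obtain q where "q \<in> fst c" "x = snd c q" using \<open>x \<in> coord_dom c\<close> unfolding coord_dom_def by blast
      then show ?thesis using near[OF topsp[OF that(1)]] that(1) unfolding near_def sc_def by blast
    qed
    then have "affine_sphere M A f"
      unfolding affine_sphere_def using assms(1-4) by blast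
    then show ?thesis using affinely_equivalent_refl[OF M] by blast
  next
    case False
    have "parallel_curvature (coord_dom c) (nabla c)" if c: "c \<in> A" for c
    proof -
      interpret c: blaschke_chart "coord_dom c" "coord_rep c f" "coord_rep c \<xi>" "nabla c" "h c" "S c" \<tau> by (rule B[OF c])
      show ?thesis
      proof (rule c.parallel_curvature_if_dense, rule ccontr)
        fix x e assume x: "x \<in> coord_dom c" and e: "(0::real) < e"
          and none: "\<not> (\<exists>y\<in>coord_dom c. dist y x < e \<and> c.disc y \<noteq> 0)"
        obtain p where p: "p \<in> fst c" "x = snd c p" using x by (auto simp: coord_dom_def)
        obtain e' where e': "e' > 0" "ball x e' \<subseteq> coord_dom c" using c.U x openE by blast
        define Q where "Q = ball x (min e e')"
        have Q: "open Q" "connected Q" "Q \<subseteq> coord_dom c" using e' by (auto simp: Q_def)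
        have "\<exists>H. \<forall>v. S c y v = H *\<^sub>R v" if "y \<in> Q" for y
          using none c.scalar_iff[of y] Q(3) that by (auto simp: Q_def dist_commute)
        then obtain H where "\<forall>q\<in>nbhd c Q. sc H q" using sc_const[OF c Q(2,3)] by blast
        moreover have "p \<in> nbhd c Q" using p e e'(1) by (simp add: nbhd_def Q_def)
        ultimately have "near H p" unfolding near_def using nbhd[OF c Q(1)] by blast
        then show False using False topsp[OF c p(1)] by blast
      qed
    qed
    then have "locally_symmetric_affine_surface M A f"
      unfolding locally_symmetric_affine_surface_def using assms(1-4) by blast
    then show ?thesis using affinely_equivalent_refl[OF M] by blast
  qed
qed

end
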